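(* Let $X$ be a Tychonoff space. The following assertions are equivalent: (1) $C_k(X)$ is an Asplund space. (2) Every compact set in $X$ is scattered. (3) The space $C_k(X)$ does not contain any isomorphic copy of $\ell_1$. (4) Every separable Banach subspace of $C_k(X)$ has separable dual. (5) $C_k(X)$ satisfies the Namioka--Phelps property. (6) $C_k(X)$ is tame, in the sense that every weak$^*$-compact equicontinuous convex subset $K\subset C_k(X)^*$ is the closed (in the strong topology) convex hull of the extreme points of $K$.
   Context: All vector spaces are real. For a Tychonoff space $X$, $C_k(X)$ is the vector space of all continuous real-valued functions on $X$ with the compact-open topology: a neighbourhood base at zero consists of the sets $\{f: f[K]\subset(-\varepsilon,\varepsilon)\}$ with $K\subset X$ nonempty compact and $\varepsilon>0$. This is a locally convex space. Fréchet differentiability: let $Z$ be a locally convex space and $D\subset Z$ open and convex. A continuous convex function $\varphi:D\to\mathbb{R}$ is Fréchet differentiable at $z\in D$ if there is a continuous linear functional $\xi:Z\to\mathbb{R}$ such that, for every bounded set $M\subset Z$, $\sup_{h\in M}\bigl(\varphi(z+th)-\varphi(z)-\xi(th)\bigr)=o(t)$ as $t\to 0$. A locally convex space $E$ is an Asplund space if every continuous convex function $f:D\to\mathbb{R}$, where $D\subset E$ is any nonempty open convex set, is Fréchet differentiable at the points of a dense $G_\delta$ subset of $D$. A topological space is scattered if every nonempty subset $S$ of it has a point isolated in $S$. A locally convex space contains an isomorphic copy of a Banach space $Y$ if there is an injective continuous linear map $T:Y\to E$ whose inverse $T^{-1}:T[Y]\to Y$ is continuous (with $T[Y]$ carrying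 the topology induced from $E$). A Banach subspace of $E$ is a linear subspace whose induced topology is given by a complete norm; its dual carries the dual norm. For a locally convex space $E$, $E^*$ is its space of continuous linear functionals; the strong topology on $E^*$ is the topology of uniform convergence on bounded subsets of $E$. A locally convex space $E$ has the Namioka--Phelps property if every bounded subset $B\subset E$ is fragmented on each weak$^*$-compact equicontinuous subset $K\subset E^*$; explicitly, for every nonempty $A\subset K$ and every $\varepsilon>0$ there is a weak$^*$-open set $U\subset E^*$ such that $U\cap A\neq\emptyset$ and $\operatorname{diam}\{\langle v,x\rangle: x\in U\cap A\}<\varepsilon$ for every $v\in B$. *)

theory Defs
  imports "HOL-Analysis.Analysis" "HOL-Library.Function_Algebras" "HOL-Library.Landau_Symbols"
begin

instantiation "fun" :: (type, scaleR) scaleR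
begin

definition scaleR_fun_def: "c *\<^sub>R f = (\<lambda>x. c *\<^sub>R f x)"

instance ..

end

lemma scaleR_fun_apply [simp]: "(c *\<^sub>R f) x = c *\<^sub>R f x"
  by (simp add: scaleR_fun_def)

instance "fun" :: (type, real_vector) real_vector
  by standard (simp_all add: fun_eq_iff scaleR_add_right scaleR_add_left)

text \<open>The topology on a set \<open>F\<close> of functions given by uniform convergence on the members of
  a family \<open>S\<close>. The family is meant to be nonempty and directed, see \<open>openin_uniform_on\<close>.\<close>

definition uniform_nhd :: "('a \<Rightarrow> real) set \<Rightarrow> 'a set \<Rightarrow> real \<Rightarrow> ('a \<Rightarrow> real) \<Rightarrow> ('a \<Rightarrow> real) set"
  where "uniform_nhd F K \<epsilon> f = {g \<in> F. \<forall>x\<in>K. \<bar>g x - f x\<bar> < \<epsilon>}"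

definition uniform_on_topology :: "('a \<Rightarrow> real) set \<Rightarrow> 'a set set \<Rightarrow> ('a \<Rightarrow> real) topology"
  where "uniform_on_topology F S =
    topology (\<lambda>U. U \<subseteq> F \<and> (\<forall>f\<in>U. \<exists>K\<in>S. \<exists>\<epsilon>>0. uniform_nhd F K \<epsilon> f \<subseteq> U))"

lemma openin_uniform_on:
  assumes "S \<noteq> {}" and dir: "\<And>K L. K \<in> S \<Longrightarrow> L \<in> S \<Longrightarrow> K \<union> L \<in> S"
  shows "openin (uniform_on_topology F S) U \<longleftrightarrow>
    U \<subseteq> F \<and> (\<forall>f\<in>U. \<exists>K\<in>S. \<exists>\<epsilon>>0. uniform_nhd F K \<epsilon> f \<subseteq> U)"
proof -
  have "istopology (\<lambda>U. U \<subseteq> F \<and> (\<forall>f\<in>U. \<exists>K\<in>S. \<exists>\<epsilon>>0. uniform_nhd F K \<epsilon> f \<subseteq> U))"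
    unfolding istopology_def
  proof (intro conjI allI impI ballI; (elim conjE)?)
    fix U V f
    assume U: "\<forall>f\<in>U. \<exists>K\<in>S. \<exists>\<epsilon>>0. uniform_nhd F K \<epsilon> f \<subseteq> U"
      and V: "\<forall>f\<in>V. \<exists>K\<in>S. \<exists>\<epsilon>>0. uniform_nhd F K \<epsilon> f \<subseteq> V" and f: "f \<in> U \<inter> V"
    obtain K \<epsilon> where 1: "K \<in> S" "\<epsilon> > 0" "uniform_nhd F K \<epsilon> f \<subseteq> U" using U f by blast
    obtain L \<delta> where 2: "L \<in> S" "\<delta> > 0" "uniform_nhd F L \<delta> f \<subseteq> V" using V f by blast
    have "uniform_nhd F (K \<union> L) (min \<epsilon> \<delta>) f \<subseteq> U \<inter> V"
      using 1 2 unfolding uniform_nhd_def by auto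
    then show "\<exists>K\<in>S. \<exists>\<epsilon>>0. uniform_nhd F K \<epsilon> f \<subseteq> U \<inter> V"
      using 1 2 dir[of K L] by (intro bexI[of _ "K \<union> L"] exI[of _ "min \<epsilon> \<delta>"]) simp_all
  next
    fix \<K> f
    assume *: "\<forall>U\<in>\<K>. U \<subseteq> F \<and> (\<forall>f\<in>U. \<exists>K\<in>S. \<exists>\<epsilon>>0. uniform_nhd F K \<epsilon> f \<subseteq> U)" "f \<in> \<Union>\<K>"
    then obtain U where U: "U \<in> \<K>" "f \<in> U" by blast
    then obtain K \<epsilon> where "K \<in> S" "\<epsilon> > 0" "uniform_nhd F K \<epsilon> f \<subseteq> U"
      using * by meson
    then show "\<exists>K\<in>S. \<exists>\<epsilon>>0. uniform_nhd F K \<epsilon> f \<subseteq> \<Union>\<K>"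
      using U by blast
  qed auto
  then show ?thesis
    by (simp add: uniform_on_topology_def topology_inverse')
qed

text \<open>A topological vector space is given by its topology \<open>E\<close>; the underlying vector space is
  the linear subspace \<open>topspace E\<close> of the ambient type.\<close>

definition locally_convex_space :: "'v::real_vector topology \<Rightarrow> bool"
  where "locally_convex_space E \<longleftrightarrow>
    subspace (topspace E) \<and>
    continuous_map (prod_topology E E) E (\<lambda>(x, y). x + y) \<and>
    continuous_map (prod_topology euclideanreal E) E (\<lambda>(c, x). c *\<^sub>R x) \<and>
    (\<forall>U. openin E U \<and> 0 \<in> U \<longrightarrow> (\<exists>V. openin E V \<and> 0 \<in> V \<and> convex V \<and> V \<subseteq> U))"

definition linear_on_set :: "'v::real_vector set \<Rightarrow> ('v \<Rightarrow> 'w::real_vector) \<Rightarrow> bool"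
  where "linear_on_set V T \<longleftrightarrow>
    (\<forall>x\<in>V. \<forall>y\<in>V. T (x + y) = T x + T y) \<and> (\<forall>c. \<forall>x\<in>V. T (c *\<^sub>R x) = c *\<^sub>R T x)"

definition lcs_bounded :: "'v::real_vector topology \<Rightarrow> 'v set \<Rightarrow> bool"
  where "lcs_bounded E B \<longleftrightarrow>
    B \<subseteq> topspace E \<and>
    (\<forall>U. openin E U \<and> 0 \<in> U \<longrightarrow> (\<exists>s>0. \<forall>t>s. B \<subseteq> (\<lambda>x. t *\<^sub>R x) ` U))"

text \<open>Functionals are normalised to vanish outside \<open>topspace E\<close>, so that equality of
  functionals on the space is equality of HOL functions.\<close>

definition dual_space :: "'v::real_vector topology \<Rightarrow> ('v \<Rightarrow> real) set"
  where "dual_space E = {\<xi>. linear_on_set (topspace E) \<xi> \<and> continuous_map E euclideanreal \<xi> \<and>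
    (\<forall>x. x \<notin> topspace E \<longrightarrow> \<xi> x = 0)}"

definition weak_star :: "'v::real_vector topology \<Rightarrow> ('v \<Rightarrow> real) topology"
  where "weak_star E = subtopology (product_topology (\<lambda>_. euclideanreal) UNIV) (dual_space E)"

definition strong_dual :: "'v::real_vector topology \<Rightarrow> ('v \<Rightarrow> real) topology"
  where "strong_dual E = uniform_on_topology (dual_space E) {B. lcs_bounded E B}"

lemma openin_strong_dual:
  "openin (strong_dual E) U \<longleftrightarrow> U \<subseteq> dual_space E \<and>
    (\<forall>\<xi>\<in>U. \<exists>B. lcs_bounded E B \<and> (\<exists>\<epsilon>>0. uniform_nhd (dual_space E) B \<epsilon> \<xi> \<subseteq> U))"
proof -
  have "lcs_bounded E (B \<union> C)" if B: "lcs_bounded E B" and C: "lcs_bounded E C" for B C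
    unfolding lcs_bounded_def
  proof (intro conjI allI impI)
    fix U assume U: "openin E U \<and> 0 \<in> U"
    obtain s where s: "s > 0" "\<forall>t>s. B \<subseteq> (\<lambda>x. t *\<^sub>R x) ` U" using B U by (auto simp: lcs_bounded_def)
    obtain r where r: "r > 0" "\<forall>t>r. C \<subseteq> (\<lambda>x. t *\<^sub>R x) ` U" using C U by (auto simp: lcs_bounded_def)
    show "\<exists>s>0. \<forall>t>s. B \<union> C \<subseteq> (\<lambda>x. t *\<^sub>R x) ` U"
      by (rule exI[of _ "max s r"]) (use s r in simp)
  qed (use that in \<open>auto simp: lcs_bounded_def\<close>)
  moreover have "lcs_bounded E {}"
    by (auto simp: lcs_bounded_def intro: exI[of _ 1])
  ultimately show ?thesis
    unfolding strong_dual_def by (subst openin_uniform_on) auto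
qed

definition equicontinuous :: "'v topology \<Rightarrow> ('v \<Rightarrow> real) set \<Rightarrow> bool"
  where "equicontinuous E K \<longleftrightarrow>
    (\<forall>x\<in>topspace E. \<forall>\<epsilon>>0. \<exists>U. openin E U \<and> x \<in> U \<and> (\<forall>\<xi>\<in>K. \<forall>y\<in>U. \<bar>\<xi> y - \<xi> x\<bar> < \<epsilon>))"

text \<open>Only the values of \<open>\<phi>\<close> on \<open>D\<close> matter: for small \<open>t\<close> one has \<open>z + t M \<subseteq> D\<close>. The real
  supremum is then over a set bounded above, as \<open>\<phi>\<close> is continuous at \<open>z\<close>.\<close>

definition frechet_differentiable_at ::
    "'v::real_vector topology \<Rightarrow> ('v \<Rightarrow> real) \<Rightarrow> 'v \<Rightarrow> bool"
  where "frechet_differentiable_at E \<phi> z \<longleftrightarrow>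
    (\<exists>\<xi>\<in>dual_space E. \<forall>M. lcs_bounded E M \<and> M \<noteq> {} \<longrightarrow>
      (\<lambda>t::real. SUP h\<in>M. \<phi> (z + t *\<^sub>R h) - \<phi> z - \<xi> (t *\<^sub>R h)) \<in> o[at 0](\<lambda>t. t))"

definition asplund_space :: "'v::real_vector topology \<Rightarrow> bool"
  where "asplund_space E \<longleftrightarrow>
    locally_convex_space E \<and>
    (\<forall>D f. openin E D \<and> D \<noteq> {} \<and> convex D \<and>
        continuous_map (subtopology E D) euclideanreal f \<and> convex_on D f \<longrightarrow>
      (\<exists>G. gdelta_in (subtopology E D) G \<and> subtopology E D closure_of G = D \<and>
        (\<forall>z\<in>G. frechet_differentiable_at E f z)))"

definition scattered_space :: "'a topology \<Rightarrow> bool"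
  where "scattered_space X \<longleftrightarrow>
    (\<forall>S. S \<subseteq> topspace X \<and> S \<noteq> {} \<longrightarrow> (\<exists>x\<in>S. openin (subtopology X S) {x}))"

definition norm_on :: "'v::real_vector set \<Rightarrow> ('v \<Rightarrow> real) \<Rightarrow> bool"
  where "norm_on V n \<longleftrightarrow>
    subspace V \<and>
    (\<forall>x\<in>V. 0 \<le> n x \<and> (n x = 0 \<longleftrightarrow> x = 0)) \<and>
    (\<forall>c. \<forall>x\<in>V. n (c *\<^sub>R x) = \<bar>c\<bar> * n x) \<and>
    (\<forall>x\<in>V. \<forall>y\<in>V. n (x + y) \<le> n x + n y)"

text \<open>The cut-off outside \<open>V\<close> is needed because the locale \<open>Metric_space\<close> demands
  nonnegativity and symmetry on the whole type.\<close>

definition norm_dist :: "'v::real_vector set \<Rightarrow> ('v \<Rightarrow> real) \<Rightarrow> 'v \<Rightarrow> 'v \<Rightarrow> real"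
  where "norm_dist V n x y = (if x \<in> V \<and> y \<in> V then n (x - y) else 0)"

definition norm_topology :: "'v::real_vector set \<Rightarrow> ('v \<Rightarrow> real) \<Rightarrow> 'v topology"
  where "norm_topology V n = Metric_space.mtopology V (norm_dist V n)"

definition complete_norm_on :: "'v::real_vector set \<Rightarrow> ('v \<Rightarrow> real) \<Rightarrow> bool"
  where "complete_norm_on V n \<longleftrightarrow> norm_on V n \<and> Metric_space.mcomplete V (norm_dist V n)"

lemma Metric_space_norm_dist:
  assumes "norm_on V n"
  shows "Metric_space V (norm_dist V n)"
proof
  note n = assms[unfolded norm_on_def]
  have sub: "x - y \<in> V" if "x \<in> V" "y \<in> V" for x y
    using subspace_diff[OF conjunct1[OF n] that] .
  have pos: "0 \<le> n x" "n x = 0 \<longleftrightarrow> x = 0" if "x \<in> V" for x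
    using bspec[OF conjunct1[OF conjunct2[OF n]] that] by simp_all
  have scale: "n (c *\<^sub>R x) = \<bar>c\<bar> * n x" if "x \<in> V" for c x
    using bspec[OF spec[OF conjunct1[OF conjunct2[OF conjunct2[OF n]]], of c] that] .
  have tri: "n (x + y) \<le> n x + n y" if "x \<in> V" "y \<in> V" for x y
    using bspec[OF bspec[OF conjunct2[OF conjunct2[OF conjunct2[OF n]]] that(1)] that(2)] .
  show "0 \<le> norm_dist V n x y" for x y
    by (simp add: norm_dist_def pos sub)
  show "norm_dist V n x y = norm_dist V n y x" for x y
  proof (cases "x \<in> V \<and> y \<in> V")
    case True
    then show ?thesis
      using scale[OF sub, of x y "-1"] by (simp add: norm_dist_def)
  qed (auto simp: norm_dist_def)
  show "norm_dist V n x y = 0 \<longleftrightarrow> x = y" if "x \<in> V" "y \<in> V" for x y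
    using that by (simp add: norm_dist_def pos sub)
  show "norm_dist V n x z \<le> norm_dist V n x y + norm_dist V n y z"
    if "x \<in> V" "y \<in> V" "z \<in> V" for x y z
    using tri[OF sub sub, of x y y z] that by (simp add: norm_dist_def)
qed

definition dual_norm :: "'v::real_vector set \<Rightarrow> ('v \<Rightarrow> real) \<Rightarrow> ('v \<Rightarrow> real) \<Rightarrow> real"
  where "dual_norm V n \<xi> = (SUP x\<in>{x \<in> V. n x \<le> 1}. \<bar>\<xi> x\<bar>)"

definition banach_subspace :: "'v::real_vector topology \<Rightarrow> 'v set \<Rightarrow> ('v \<Rightarrow> real) \<Rightarrow> bool"
  where "banach_subspace E V n \<longleftrightarrow>
    subspace V \<and> V \<subseteq> topspace E \<and> complete_norm_on V n \<and> subtopology E V = norm_topology V n"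

definition l1_seqs :: "(nat \<Rightarrow> real) set"
  where "l1_seqs = {x. summable (\<lambda>k. \<bar>x k\<bar>)}"

definition l1_norm :: "(nat \<Rightarrow> real) \<Rightarrow> real"
  where "l1_norm x = (\<Sum>k. \<bar>x k\<bar>)"

lemma norm_on_l1: "norm_on l1_seqs l1_norm"
proof -
  have add: "summable (\<lambda>k. \<bar>x k + y k\<bar>)" "(\<Sum>k. \<bar>x k + y k\<bar>) \<le> (\<Sum>k. \<bar>x k\<bar>) + (\<Sum>k. \<bar>y k\<bar>)"
    if "summable (\<lambda>k. \<bar>x k\<bar>)" "summable (\<lambda>k. \<bar>y k\<bar>)" for x y :: "nat \<Rightarrow> real"
  proof -
    have s: "summable (\<lambda>k. \<bar>x k\<bar> + \<bar>y k\<bar>)" using that by (rule summable_add)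
    show s': "summable (\<lambda>k. \<bar>x k + y k\<bar>)"
      by (rule summable_comparison_test'[OF s, of 0]) auto
    have "(\<Sum>k. \<bar>x k + y k\<bar>) \<le> (\<Sum>k. \<bar>x k\<bar> + \<bar>y k\<bar>)"
      using s s' by (intro suminf_le) auto
    then show "(\<Sum>k. \<bar>x k + y k\<bar>) \<le> (\<Sum>k. \<bar>x k\<bar>) + (\<Sum>k. \<bar>y k\<bar>)"
      using that by (simp add: suminf_add)
  qed
  have "subspace l1_seqs"
    unfolding subspace_def l1_seqs_def
    by (simp add: add(1) abs_mult summable_mult)
  moreover have "0 \<le> l1_norm x" if "x \<in> l1_seqs" for x
    using that by (simp add: l1_seqs_def l1_norm_def suminf_nonneg)
  moreover have "l1_norm x = 0 \<longleftrightarrow> x = 0" if "x \<in> l1_seqs" for x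
    using that suminf_eq_zero_iff[of "\<lambda>k. \<bar>x k\<bar>"]
    by (simp add: l1_seqs_def l1_norm_def fun_eq_iff)
  moreover have "l1_norm (c *\<^sub>R x) = \<bar>c\<bar> * l1_norm x" if "x \<in> l1_seqs" for c x
    using that by (simp add: l1_seqs_def l1_norm_def abs_mult suminf_mult)
  moreover have "l1_norm (x + y) \<le> l1_norm x + l1_norm y" if "x \<in> l1_seqs" "y \<in> l1_seqs" for x y
    using that add(2) by (simp add: l1_seqs_def l1_norm_def)
  ultimately show ?thesis by (simp add: norm_on_def)
qed

definition contains_isomorphic_copy ::
    "'v::real_vector topology \<Rightarrow> 'w::real_vector topology \<Rightarrow> bool"
  where "contains_isomorphic_copy E Y \<longleftrightarrow>
    (\<exists>T. linear_on_set (topspace Y) T \<and> embedding_map Y E T)"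

text \<open>Equicontinuity of \<open>K\<close> makes the sets of values of which \<open>diameter\<close> is taken bounded.\<close>

definition fragmented_on :: "'v::real_vector topology \<Rightarrow> 'v set \<Rightarrow> ('v \<Rightarrow> real) set \<Rightarrow> bool"
  where "fragmented_on E B K \<longleftrightarrow>
    (\<forall>A \<epsilon>. A \<subseteq> K \<and> A \<noteq> {} \<and> \<epsilon> > 0 \<longrightarrow>
      (\<exists>U. openin (weak_star E) U \<and> U \<inter> A \<noteq> {} \<and>
        (\<forall>v\<in>B. diameter ((\<lambda>\<xi>. \<xi> v) ` (U \<inter> A)) < \<epsilon>)))"

definition namioka_phelps :: "'v::real_vector topology \<Rightarrow> bool"
  where "namioka_phelps E \<longleftrightarrow>
    locally_convex_space E \<and>
    (\<forall>B K. lcs_bounded E B \<and> compactin (weak_star E) K \<and> equicontinuous E K \<longrightarrow>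
      fragmented_on E B K)"

definition tame_space :: "'v::real_vector topology \<Rightarrow> bool"
  where "tame_space E \<longleftrightarrow>
    locally_convex_space E \<and>
    (\<forall>K. compactin (weak_star E) K \<and> equicontinuous E K \<and> convex K \<longrightarrow>
      K = strong_dual E closure_of (convex hull {\<xi>. \<xi> extreme_point_of K}))"

text \<open>Continuous functions on \<open>X\<close> are normalised to vanish outside \<open>topspace X\<close>.\<close>

definition cont_funs :: "'a topology \<Rightarrow> ('a \<Rightarrow> real) set"
  where "cont_funs X = {f. continuous_map X euclideanreal f \<and> (\<forall>x. x \<notin> topspace X \<longrightarrow> f x = 0)}"

text \<open>Admitting the empty compact set only adds the whole space as a basic neighbourhood; it
  matters only for empty \<open>X\<close>, where it makes the one-point space come out right.\<close>

definition Ck :: "'a topology \<Rightarrow> ('a \<Rightarrow> real) topology"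
  where "Ck X = uniform_on_topology (cont_funs X) {K. compactin X K}"

lemma openin_Ck:
  "openin (Ck X) U \<longleftrightarrow> U \<subseteq> cont_funs X \<and>
    (\<forall>f\<in>U. \<exists>K. compactin X K \<and> (\<exists>\<epsilon>>0. uniform_nhd (cont_funs X) K \<epsilon> f \<subseteq> U))"
  unfolding Ck_def
  by (subst openin_uniform_on) (auto intro: compactin_Un)

lemma topspace_Ck: "topspace (Ck X) = cont_funs X"
proof -
  have "openin (Ck X) (cont_funs X)"
    unfolding openin_Ck
    by (intro conjI ballI exI[of _ "{}"] exI[of _ 1]) (auto simp: uniform_nhd_def)
  then show ?thesis
    using openin_Ck[of X "topspace (Ck X)"] by (meson openin_subset openin_topspace subset_antisym)
qed

lemma cont_fun_bounded:
  assumes "f \<in> cont_funs X" "compactin X K"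
  obtains M where "M > 0" "\<And>x. x \<in> K \<Longrightarrow> \<bar>f x\<bar> < M"
proof -
  have "compactin euclideanreal (f ` K)"
    using assms image_compactin unfolding cont_funs_def by blast
  then have "bounded (f ` K)"
    by (simp add: compact_imp_bounded)
  then obtain M where "\<And>x. x \<in> K \<Longrightarrow> \<bar>f x\<bar> \<le> M"
    by (auto simp: bounded_iff)
  then show thesis
    by (intro that[of "max M 0 + 1"]) fastforce+
qed

lemma openin_uniform_nhd:
  assumes "f \<in> cont_funs X" "compactin X K"
  shows "openin (Ck X) (uniform_nhd (cont_funs X) K \<epsilon> f)"
  unfolding openin_Ck
proof (intro conjI ballI)
  fix g assume g: "g \<in> uniform_nhd (cont_funs X) K \<epsilon> f"
  then have gC: "g \<in> cont_funs X" and ge: "\<And>x. x \<in> K \<Longrightarrow> \<bar>g x - f x\<bar> < \<epsilon>"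
    by (auto simp: uniform_nhd_def)
  have "\<exists>\<delta>>0. \<forall>x\<in>K. \<bar>g x - f x\<bar> \<le> \<epsilon> - \<delta>"
  proof (cases "K = {}")
    case False
    have "continuous_map X euclideanreal (\<lambda>x. \<bar>g x - f x\<bar>)"
      using gC assms by (auto simp: cont_funs_def intro!: continuous_intros)
    then have "compact ((\<lambda>x. \<bar>g x - f x\<bar>) ` K)"
      using assms image_compactin by force
    from compact_attains_sup[OF this] False
    obtain x where "x \<in> K" "\<And>y. y \<in> K \<Longrightarrow> \<bar>g y - f y\<bar> \<le> \<bar>g x - f x\<bar>"
      by auto
    then show ?thesis
      using ge by (intro exI[of _ "\<epsilon> - \<bar>g x - f x\<bar>"]) auto
  qed (auto intro: exI[of _ 1])
  then obtain \<delta> where \<delta>: "\<delta> > 0" "\<forall>x\<in>K. \<bar>g x - f x\<bar> \<le> \<epsilon> - \<delta>" by blast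
  have "uniform_nhd (cont_funs X) K \<delta> g \<subseteq> uniform_nhd (cont_funs X) K \<epsilon> f"
    using \<delta> by (fastforce simp: uniform_nhd_def)
  then show "\<exists>L. compactin X L \<and>
      (\<exists>\<delta>>0. uniform_nhd (cont_funs X) L \<delta> g \<subseteq> uniform_nhd (cont_funs X) K \<epsilon> f)"
    using assms \<delta> by blast
qed (auto simp: uniform_nhd_def)

lemma subspace_cont_funs: "subspace (cont_funs X)"
  unfolding subspace_def cont_funs_def
  by (simp add: plus_fun_def zero_fun_def scaleR_fun_def continuous_map_add
      continuous_map_real_mult_left)

lemma continuous_map_into_Ck:
  assumes maps: "\<And>p. p \<in> topspace Z \<Longrightarrow> T p \<in> cont_funs X"
    and nhd: "\<And>p K \<epsilon>. p \<in> topspace Z \<Longrightarrow> compactin X K \<Longrightarrow> \<epsilon> > 0 \<Longrightarrow>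
      \<exists>W. openin Z W \<and> p \<in> W \<and> (\<forall>q\<in>W. \<forall>x\<in>K. \<bar>T q x - T p x\<bar> < \<epsilon>)"
  shows "continuous_map Z (Ck X) T"
  unfolding continuous_map_def
proof (intro conjI allI impI)
  show "T \<in> topspace Z \<rightarrow> topspace (Ck X)"
    using maps by (auto simp: topspace_Ck)
next
  fix U assume U: "openin (Ck X) U"
  show "openin Z {p \<in> topspace Z. T p \<in> U}"
  proof (subst openin_subopen, intro ballI)
    fix p assume p: "p \<in> {p \<in> topspace Z. T p \<in> U}"
    then obtain K \<epsilon> where K: "compactin X K" "\<epsilon> > 0" "uniform_nhd (cont_funs X) K \<epsilon> (T p) \<subseteq> U"
      using U unfolding openin_Ck by blast
    obtain W where W: "openin Z W" "p \<in> W" "\<forall>q\<in>W. \<forall>x\<in>K. \<bar>T q x - T p x\<bar> < \<epsilon>"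
      using nhd[of p K \<epsilon>] p K by blast
    have "W \<subseteq> {p \<in> topspace Z. T p \<in> U}"
    proof
      fix q assume q: "q \<in> W"
      then have qZ: "q \<in> topspace Z" using W openin_subset by blast
      then have "T q \<in> uniform_nhd (cont_funs X) K \<epsilon> (T p)"
        using W q maps by (auto simp: uniform_nhd_def)
      then show "q \<in> {p \<in> topspace Z. T p \<in> U}" using K qZ by blast
    qed
    then show "\<exists>W. openin Z W \<and> p \<in> W \<and> W \<subseteq> {p \<in> topspace Z. T p \<in> U}"
      using W by blast
  qed
qed

lemma locally_convex_space_Ck: "locally_convex_space (Ck X)"
  unfolding locally_convex_space_def
proof (intro conjI allI impI)
  show "subspace (topspace (Ck X))"
    by (simp add: topspace_Ck subspace_cont_funs)
  show "continuous_map (prod_topology (Ck X) (Ck X)) (Ck X) (\<lambda>(f, g). f + g)"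
  proof (rule continuous_map_into_Ck)
    fix p assume "p \<in> topspace (prod_topology (Ck X) (Ck X))"
    then show "(case p of (f, g) \<Rightarrow> f + g) \<in> cont_funs X"
      by (auto simp: topspace_Ck intro: subspace_add[OF subspace_cont_funs])
  next
    fix p K \<epsilon>
    assume p: "p \<in> topspace (prod_topology (Ck X) (Ck X))" and K: "compactin X K" "(\<epsilon>::real) > 0"
    obtain f g where fg: "p = (f, g)" "f \<in> cont_funs X" "g \<in> cont_funs X"
      using p by (auto simp: topspace_Ck)
    let ?N = "\<lambda>f. uniform_nhd (cont_funs X) K (\<epsilon> / 2) f"
    have "openin (prod_topology (Ck X) (Ck X)) (?N f \<times> ?N g)"
      using fg K by (simp add: openin_prod_Times_iff openin_uniform_nhd)
    moreover have "p \<in> ?N f \<times> ?N g"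
      using fg K by (auto simp: uniform_nhd_def)
    moreover have "\<bar>(case q of (f, g) \<Rightarrow> f + g) x - (case p of (f, g) \<Rightarrow> f + g) x\<bar> < \<epsilon>"
      if "q \<in> ?N f \<times> ?N g" "x \<in> K" for q x
    proof -
      obtain a b where q: "q = (a, b)" by (cases q)
      have "\<bar>a x - f x\<bar> < \<epsilon> / 2" "\<bar>b x - g x\<bar> < \<epsilon> / 2"
        using that q by (auto simp: uniform_nhd_def)
      then have "\<bar>(a x + b x) - (f x + g x)\<bar> < \<epsilon>" by linarith
      then show ?thesis by (simp add: q fg)
    qed
    ultimately show "\<exists>W. openin (prod_topology (Ck X) (Ck X)) W \<and> p \<in> W \<and>
        (\<forall>q\<in>W. \<forall>x\<in>K. \<bar>(case q of (f, g) \<Rightarrow> f + g) x - (case p of (f, g) \<Rightarrow> f + g) x\<bar> < \<epsilon>)"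
      by blast
  qed
  show "continuous_map (prod_topology euclideanreal (Ck X)) (Ck X) (\<lambda>(c, f). c *\<^sub>R f)"
  proof (rule continuous_map_into_Ck)
    fix p :: "real \<times> _" assume "p \<in> topspace (prod_topology euclideanreal (Ck X))"
    then show "(case p of (c, f) \<Rightarrow> c *\<^sub>R f) \<in> cont_funs X"
      by (auto simp: topspace_Ck intro: subspace_scale[OF subspace_cont_funs])
  next
    fix p :: "real \<times> _" and K \<epsilon>
    assume p: "p \<in> topspace (prod_topology euclideanreal (Ck X))"
      and K: "compactin X K" "(\<epsilon>::real) > 0"
    obtain c f where cf: "p = (c, f)" "f \<in> cont_funs X"
      using p by (auto simp: topspace_Ck)
    obtain M where M: "M > 0" "\<And>x. x \<in> K \<Longrightarrow> \<bar>f x\<bar> < M"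
      using cont_fun_bounded cf K by metis
    define \<delta> where "\<delta> = \<epsilon> / (2 * M)"
    define \<eta> where "\<eta> = \<epsilon> / (2 * (\<bar>c\<bar> + \<delta>))"
    have \<delta>: "\<delta> > 0" and \<eta>: "\<eta> > 0"
      using M K by (auto simp: \<delta>_def \<eta>_def intro!: divide_pos_pos add_nonneg_pos mult_pos_pos)
    let ?W = "ball c \<delta> \<times> uniform_nhd (cont_funs X) K \<eta> f"
    have "openin (prod_topology euclideanreal (Ck X)) ?W"
      using cf K by (simp add: openin_prod_Times_iff openin_uniform_nhd)
    moreover have "p \<in> ?W"
      using cf \<delta> \<eta> by (auto simp: uniform_nhd_def)
    moreover have "\<bar>(case q of (c, f) \<Rightarrow> c *\<^sub>R f) x - (case p of (c, f) \<Rightarrow> c *\<^sub>R f) x\<bar> < \<epsilon>"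
      if "q \<in> ?W" "x \<in> K" for q x
    proof -
      obtain d g where q: "q = (d, g)" by (cases q)
      have d: "\<bar>d - c\<bar> < \<delta>" and g: "\<bar>g x - f x\<bar> < \<eta>"
        using that q by (auto simp: uniform_nhd_def dist_real_def)
      have 1: "\<bar>d\<bar> * \<bar>g x - f x\<bar> \<le> (\<bar>c\<bar> + \<delta>) * \<eta>"
        using d g by (intro mult_mono) auto
      have 2: "\<bar>d - c\<bar> * \<bar>f x\<bar> < \<delta> * M"
        using d M(2)[OF that(2)] by (intro mult_strict_mono') auto
      have "(\<bar>c\<bar> + \<delta>) * \<eta> = \<epsilon> / 2"
        using \<delta> by (simp add: \<eta>_def field_simps)
      moreover have "\<delta> * M = \<epsilon> / 2"
        using M by (simp add: \<delta>_def)
      moreover have "d * g x - c * f x = d * (g x - f x) + (d - c) * f x"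
        by (simp add: algebra_simps)
      then have "\<bar>d * g x - c * f x\<bar> \<le> \<bar>d\<bar> * \<bar>g x - f x\<bar> + \<bar>d - c\<bar> * \<bar>f x\<bar>"
        by (metis abs_mult abs_triangle_ineq)
      ultimately show ?thesis
        using 1 2 by (simp add: q cf)
    qed
    ultimately show "\<exists>W. openin (prod_topology euclideanreal (Ck X)) W \<and> p \<in> W \<and>
        (\<forall>q\<in>W. \<forall>x\<in>K. \<bar>(case q of (c, f) \<Rightarrow> c *\<^sub>R f) x - (case p of (c, f) \<Rightarrow> c *\<^sub>R f) x\<bar> < \<epsilon>)"
      by blast
  qed
next
  fix U assume "openin (Ck X) U \<and> 0 \<in> U"
  then obtain K \<epsilon> where K: "compactin X K" "\<epsilon> > 0" "uniform_nhd (cont_funs X) K \<epsilon> 0 \<subseteq> U"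
    unfolding openin_Ck by blast
  have 0: "0 \<in> cont_funs X"
    using subspace_cont_funs by (rule subspace_0)
  have eq: "uniform_nhd (cont_funs X) K \<epsilon> 0 = cont_funs X \<inter> (\<Inter>x\<in>K. {f. f x \<in> {-\<epsilon><..<\<epsilon>}})"
    by (auto simp: uniform_nhd_def abs_less_iff minus_less_iff)
  have "convex {f :: _ \<Rightarrow> real. f x \<in> {-\<epsilon><..<\<epsilon>}}" for x
  proof (rule convexI)
    fix f g :: "_ \<Rightarrow> real" and u v :: real
    assume *: "f \<in> {f. f x \<in> {-\<epsilon><..<\<epsilon>}}" "g \<in> {f. f x \<in> {-\<epsilon><..<\<epsilon>}}" "0 \<le> u" "0 \<le> v" "u + v = 1"
    then have "u *\<^sub>R f x + v *\<^sub>R g x \<in> {-\<epsilon><..<\<epsilon>}"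
      using convexD[OF convex_real_interval(8)] by blast
    then show "u *\<^sub>R f + v *\<^sub>R g \<in> {f. f x \<in> {-\<epsilon><..<\<epsilon>}}" by simp
  qed
  then have "convex (uniform_nhd (cont_funs X) K \<epsilon> 0)"
    unfolding eq by (intro convex_Int convex_INT subspace_imp_convex[OF subspace_cont_funs]) auto
  then show "\<exists>V. openin (Ck X) V \<and> 0 \<in> V \<and> convex V \<and> V \<subseteq> U"
    using K 0 openin_uniform_nhd[OF 0 K(1)]
    by (intro exI[of _ "uniform_nhd (cont_funs X) K \<epsilon> 0"]) (auto simp: uniform_nhd_def)
qed

definition tychonoff_space :: "'a topology \<Rightarrow> bool"
  where "tychonoff_space X \<longleftrightarrow> completely_regular_space X \<and> Hausdorff_space X"

end

theory Submission
  imports Defs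
begin

text \<open>It suffices to prove that (2) implies (1), (1) implies (6), (6) implies (2), and that
  (2) implies (5), (5) implies (4), (4) implies (3), (3) implies (2).

  No representation of functionals by measures is needed. Everything positive rests on one
  fact about a compact scattered set \<open>L\<close>: if a family of nonempty sets of functionals bounded by
  \<open>C \<parallel>\<cdot>\<parallel>\<^sub>L\<close> is closed under passing, inside a member, to some member contained in a slice
  \<open>{\<nu>. c < \<nu> h}\<close> that meets it, then every member contains a member of arbitrarily small norm
  diameter. Relatively weak-star open pieces of an equicontinuous set form such a family, which
  gives (5). So do the sets of subgradients of a convex function over small balls, by
  monotonicity of the subdifferential; a convex function on \<open>C\<^sub>k(X)\<close> depends locally only on
  values on a compact set, and a Baire argument relative to that set gives (1).

  For (6), let \<open>\<mu> \<in> K\<close> be strictly separated by \<open>F\<close>, linear on the dual, from the extreme points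
  of \<open>K\<close>. A Frechet derivative, at a point near \<open>0\<close>, of \<open>h \<mapsto> sup {F \<nu> + \<nu> h | \<nu> \<in> K}\<close> strongly
  exposes \<open>K\<close>, so it is an extreme point that violates the separation.

  For (4), an uncountable separated subset of the dual of \<open>V\<close>, thinned out to have no isolated
  points, is lifted by Hahn-Banach to a compact set of functionals on \<open>C\<^sub>k(X)\<close>; a minimal closed
  set mapping onto it is not fragmented.

  Conversely, a non-scattered compact set carries a sequence of continuous functions
  that attains all sign patterns; it spans a copy of \<open>\<ell>\<^sub>1\<close> and supports a diffuse state,
  which is far from all convex combinations of point evaluations.\<close>

section \<open>The Hahn-Banach theorem and subgradients\<close>

text \<open>\<open>Ck X\<close> is in general neither normed nor complete. In place of a norm there
  is one compact \<open>L\<close>: an equicontinuous set of functionals, and likewise all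
  subgradients near a given point, are bounded by a multiple of the supremum over a common
  \<open>L\<close> (\<open>dominated\<close>). Functions may then be altered freely off
  \<open>L\<close>.

  Small oscillation is stated for abstract families because the sets of subgradients over balls are
  not open pieces of one fixed set of functionals. Closure under slices is what both families share,
  and a slice cut near a supremum fixes the value at one function up to a small error.

  In (6), the Krein-Milman theorem would give only the weak-star closed hull. The separating
  \<open>F\<close> acts on the dual and need not be weak-star continuous, so its supremum over
  \<open>K\<close> need not be attained; the perturbation \<open>\<nu> h\<close> repairs this.

  In (4), separability of \<open>V\<close> allows the dual of \<open>V\<close> to be coordinatised
  by real sequences, where uncountable sets have condensation points.\<close>

definition sublinear_on :: "'v::real_vector set \<Rightarrow> ('v \<Rightarrow> real) \<Rightarrow> bool"
  where "sublinear_on V p \<longleftrightarrow>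
    (\<forall>x\<in>V. \<forall>y\<in>V. p (x + y) \<le> p x + p y) \<and> (\<forall>c>0. \<forall>x\<in>V. p (c *\<^sub>R x) \<le> c * p x)"

lemma sublinear_onD:
  assumes "sublinear_on V p"
  shows "x \<in> V \<Longrightarrow> y \<in> V \<Longrightarrow> p (x + y) \<le> p x + p y"
    and "c > 0 \<Longrightarrow> x \<in> V \<Longrightarrow> p (c *\<^sub>R x) \<le> c * p x"
  using assms by (auto simp: sublinear_on_def)

lemma sublinear_on_0:
  assumes "subspace V" "sublinear_on V p"
  shows "p 0 = 0"
proof -
  have "0 \<in> V" using assms by (simp add: subspace_0)
  then have "p 0 \<le> 2 * p 0" "p 0 \<le> (1/2) * p 0"
    using sublinear_onD(2)[OF assms(2), of 2 0] sublinear_onD(2)[OF assms(2), of "1/2" 0] by auto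
  then show ?thesis by simp
qed

text \<open>\<open>sublinear_on\<close> asks only for an inequality; applying it to
  \<open>1 / c\<close> gives the reverse one.\<close>

lemma sublinear_on_scale:
  assumes "subspace V" "sublinear_on V p" "c \<ge> 0" "x \<in> V"
  shows "p (c *\<^sub>R x) = c * p x"
proof (cases "c = 0")
  case False
  then have c: "c > 0" using assms by simp
  have "p ((1 / c) *\<^sub>R (c *\<^sub>R x)) \<le> (1 / c) * p (c *\<^sub>R x)"
    using c assms by (intro sublinear_onD(2)[of V]) (auto simp: subspace_scale)
  then have "c * p x \<le> p (c *\<^sub>R x)" using c by (simp add: field_simps)
  then show ?thesis using sublinear_onD(2)[OF assms(2) c assms(4)] by simp
qed (use sublinear_on_0[OF assms(1,2)] in simp)

lemma sublinear_on_minus_le: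
  assumes "subspace V" "sublinear_on V p" "x \<in> V"
  shows "- p (- x) \<le> p x"
  using sublinear_onD(1)[OF assms(2), of x "-x"] sublinear_on_0[OF assms(1,2)]
    assms(1,3) subspace_neg[of V x] by simp

lemma convex_on_two:
  assumes "convex_on D f" "x \<in> D" "y \<in> D" "0 \<le> u" "0 \<le> v" "u + v = 1"
  shows "f (u *\<^sub>R x + v *\<^sub>R y) \<le> u * f x + v * f y"
  using assms unfolding convex_on_def by blast

text \<open>A pointwise minimal sublinear function \<open>q\<close> is linear: comparing \<open>q\<close> with the sublinear function
  \<open>x \<mapsto> inf {q (x + t a) - t q a | t \<ge> 0}\<close> gives \<open>q x + q a \<le> q (x + a)\<close>.\<close>
theorem hahn_banach_sublinear:
  fixes V :: "'v::real_vector set"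
  assumes V: "subspace V" and p: "sublinear_on V p"
  obtains g where "linear_on_set V g" "\<And>x. x \<in> V \<Longrightarrow> g x \<le> p x" "\<And>x. x \<notin> V \<Longrightarrow> g x = 0"
proof -
  \<comment> \<open>With the value 0 prescribed outside \<open>V\<close>, the order of HOL functions
    on \<open>Q\<close> is the pointwise order on \<open>V\<close>, so minimality yields equality of
    functions.\<close>
  define Q where "Q = {q. sublinear_on V q \<and> (\<forall>x\<in>V. q x \<le> p x) \<and> (\<forall>x. x \<notin> V \<longrightarrow> q x = 0)}"
  have Qsub: "sublinear_on V q" and Qle: "\<And>x. x \<in> V \<Longrightarrow> q x \<le> p x"
    and Q0: "\<And>x. x \<notin> V \<Longrightarrow> q x = 0" if "q \<in> Q" for q
    using that by (auto simp: Q_def)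
  have lower: "- p (- x) \<le> q x" if "q \<in> Q" "x \<in> V" for q x
    using sublinear_on_minus_le[OF V Qsub[OF that(1)] that(2)]
      Qle[OF that(1) subspace_neg[OF V that(2)]] by simp
  have p0: "(\<lambda>x. if x \<in> V then p x else 0) \<in> Q"
    using p V by (auto simp: Q_def sublinear_on_def subspace_add subspace_scale)
  \<comment> \<open>Zorn's lemma for the reversed order: chains are bounded by their pointwise
    infima, and the maximal element is a minimal function.\<close>
  have "\<exists>m\<in>Q. \<forall>a\<in>Q. m \<ge> a \<longrightarrow> a = m"
  proof (rule predicate_Zorn[where P="(\<ge>)"])
    show "partial_order_on Q (relation_of (\<ge>) Q)"
      by (rule partial_order_on_relation_ofI) auto
  next
    fix C assume C: "C \<in> Chains (relation_of (\<ge>) Q)"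
    then have CQ: "C \<subseteq> Q" and tot: "\<And>a b. a \<in> C \<Longrightarrow> b \<in> C \<Longrightarrow> a \<le> b \<or> b \<le> a"
      by (auto simp: Chains_def relation_of_def)
    show "\<exists>u\<in>Q. \<forall>a\<in>C. u \<le> a"
    proof (cases "C = {}")
      case True
      then show ?thesis using p0 by auto
    next
      case False
      define u where "u x = (if x \<in> V then (INF q\<in>C. q x) else 0)" for x
      have bdd: "bdd_below ((\<lambda>q. q x) ` C)" if "x \<in> V" for x
        using lower CQ that by (intro bdd_belowI2[where m="- p (- x)"]) auto
      have ule: "u x \<le> q x" if "q \<in> C" for q x
      proof (cases "x \<in> V")
        case True
        then show ?thesis unfolding u_def using that by (auto intro!: cINF_lower bdd)
      next
        case False
        then show ?thesis unfolding u_def using that CQ Q0[of q x] by auto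
      qed
      have uge: "r \<le> u x" if "x \<in> V" "\<And>q. q \<in> C \<Longrightarrow> r \<le> q x" for r x
        unfolding u_def using that False by (auto intro!: cINF_greatest)
      have "sublinear_on V u"
        unfolding sublinear_on_def
      proof (intro conjI ballI allI impI)
        fix x y assume xy: "x \<in> V" "y \<in> V"
        \<comment> \<open>An infimum of sublinear functions need not be subadditive; along a chain,
          the smaller of \<open>q1\<close> and \<open>q2\<close> serves both arguments.\<close>
        have *: "u (x + y) \<le> q1 x + q2 y" if q: "q1 \<in> C" "q2 \<in> C" for q1 q2
        proof -
          obtain q where q: "q \<in> C" "q \<le> q1" "q \<le> q2" using tot[OF q] q by auto
          have "u (x + y) \<le> q (x + y)" using ule q by blast
          also have "\<dots> \<le> q x + q y" using sublinear_onD(1)[OF Qsub] q CQ xy by blast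
          also have "\<dots> \<le> q1 x + q2 y" using q by (intro add_mono) (auto simp: le_fun_def)
          finally show ?thesis .
        qed
        have "u (x + y) - q1 x \<le> u y" if "q1 \<in> C" for q1
          using *[OF that] xy by (intro uge) (auto simp: algebra_simps)
        then have "u (x + y) - u y \<le> u x"
          using xy by (intro uge) (auto simp: algebra_simps)
        then show "u (x + y) \<le> u x + u y" by simp
      next
        fix c :: real and x assume c: "c > 0" and x: "x \<in> V"
        have "u (c *\<^sub>R x) \<le> c * q x" if "q \<in> C" for q
          using ule[OF that, of "c *\<^sub>R x"] sublinear_onD(2)[OF Qsub c x, of q] that CQ by auto
        then have "u (c *\<^sub>R x) / c \<le> u x"
          using c x by (intro uge) (auto simp: field_simps)
        then show "u (c *\<^sub>R x) \<le> c * u x" using c by (simp add: field_simps)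
      qed
      moreover have "u x \<le> p x" if "x \<in> V" for x
      proof -
        obtain q where "q \<in> C" using False by auto
        then show ?thesis using ule[of q x] Qle[of q x] CQ that by fastforce
      qed
      ultimately have "u \<in> Q" by (simp add: Q_def u_def)
      then show ?thesis using ule by (auto simp: le_fun_def)
    qed
  qed
  then obtain q where q: "q \<in> Q" and min: "\<And>a. a \<in> Q \<Longrightarrow> a \<le> q \<Longrightarrow> a = q" by blast
  note qs = Qsub[OF q]
  note qscale = sublinear_on_scale[OF V qs]
  have super: "q x + q a \<le> q (x + a)" if x: "x \<in> V" and a: "a \<in> V" for x a
  proof -
    define r where "r y = (if y \<in> V then (INF t\<in>{0..}. q (y + t *\<^sub>R a) - t * q a) else 0)" for y
    \<comment> \<open>Subadditivity for \<open>y + t a\<close> and \<open>- y\<close> bounds the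
      infimum from below, so that \<open>r\<close> is a genuine infimum.\<close>
    have low: "- q (- y) \<le> q (y + t *\<^sub>R a) - t * q a" if "t \<ge> 0" "y \<in> V" for t y
      using sublinear_onD(1)[OF qs, of "y + t *\<^sub>R a" "- y"] qscale[OF that(1) a] that a V
      by (simp add: subspace_add subspace_scale subspace_neg)
    have rle: "r y \<le> q (y + t *\<^sub>R a) - t * q a" if "t \<ge> 0" "y \<in> V" for t y
      unfolding r_def using that low
      by (auto intro!: cINF_lower bdd_belowI2[where m="- q (- y)"])
    have rge: "s \<le> r y" if "y \<in> V" "\<And>t. t \<ge> 0 \<Longrightarrow> s \<le> q (y + t *\<^sub>R a) - t * q a" for s y
      unfolding r_def using that by (auto intro!: cINF_greatest)
    have rq: "r y \<le> q y" for y
      using rle[of 0 y] Q0[OF q, of y] by (cases "y \<in> V") (auto simp: r_def)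
    have "sublinear_on V r"
      unfolding sublinear_on_def
    proof (intro conjI ballI allI impI)
      fix y z assume yz: "y \<in> V" "z \<in> V"
      have *: "r (y + z) \<le> (q (y + t *\<^sub>R a) - t * q a) + (q (z + s *\<^sub>R a) - s * q a)"
        if "t \<ge> 0" "s \<ge> 0" for s t
      proof -
        have "r (y + z) \<le> q ((y + z) + (t + s) *\<^sub>R a) - (t + s) * q a"
          using that yz V by (intro rle) (auto simp: subspace_add)
        moreover have "q ((y + t *\<^sub>R a) + (z + s *\<^sub>R a)) \<le> q (y + t *\<^sub>R a) + q (z + s *\<^sub>R a)"
          using yz a V by (intro sublinear_onD(1)[OF qs]) (auto simp: subspace_add subspace_scale)
        moreover have "(y + t *\<^sub>R a) + (z + s *\<^sub>R a) = (y + z) + (t + s) *\<^sub>R a"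
          by (simp add: algebra_simps)
        ultimately show ?thesis by (simp add: algebra_simps)
      qed
      have "r (y + z) - (q (y + t *\<^sub>R a) - t * q a) \<le> r z" if "t \<ge> 0" for t
        using *[OF that] yz by (intro rge) (auto simp: algebra_simps)
      then have "r (y + z) - r z \<le> r y"
        using yz by (intro rge) (auto simp: algebra_simps)
      then show "r (y + z) \<le> r y + r z" by simp
    next
      fix c :: real and y assume c: "c > 0" and y: "y \<in> V"
      have "r (c *\<^sub>R y) \<le> c * (q (y + t *\<^sub>R a) - t * q a)" if "t \<ge> 0" for t
      proof -
        have "r (c *\<^sub>R y) \<le> q (c *\<^sub>R y + (c * t) *\<^sub>R a) - (c * t) * q a"
          using that c y V by (intro rle) (auto simp: subspace_scale)
        also have "c *\<^sub>R y + (c * t) *\<^sub>R a = c *\<^sub>R (y + t *\<^sub>R a)" by (simp add: algebra_simps)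
        also have "q \<dots> = c * q (y + t *\<^sub>R a)"
          using c y a V by (intro qscale) (auto simp: subspace_add subspace_scale)
        finally show ?thesis by (simp add: algebra_simps)
      qed
      then have "r (c *\<^sub>R y) / c \<le> r y"
        using c y by (intro rge) (auto simp: field_simps)
      then show "r (c *\<^sub>R y) \<le> c * r y" using c by (simp add: field_simps)
    qed
    then have "r \<in> Q" using order_trans[OF rq Qle[OF q]] by (simp add: Q_def) (simp add: r_def)
    then have "r = q" using min rq by (auto simp: le_fun_def)
    then show ?thesis using rle[of 1 x] x by simp
  qed
  have add: "q (x + y) = q x + q y" if "x \<in> V" "y \<in> V" for x y
    using super[OF that] sublinear_onD(1)[OF qs that] by simp
  have neg: "q (- x) = - q x" if "x \<in> V" for x
    using add[OF that subspace_neg[OF V that]] sublinear_on_0[OF V qs] by simp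
  have "q (c *\<^sub>R x) = c *\<^sub>R q x" if x: "x \<in> V" for c x
  proof (cases "c \<ge> 0")
    case True
    then show ?thesis using qscale x by simp
  next
    case False
    then have "q (c *\<^sub>R x) = - q ((- c) *\<^sub>R x)"
      using neg[OF subspace_scale[OF V x, of "- c"]] by simp
    then show ?thesis using False qscale[of "- c", OF _ x] by simp
  qed
  then have "linear_on_set V q" using add by (auto simp: linear_on_set_def)
  then show thesis using that Qle[OF q] Q0[OF q] by blast
qed

text \<open>The one-sided directional derivative \<open>p h\<close>, the infimum of the difference
  quotients over \<open>t > 0\<close>, is finite because \<open>x\<close> can be moved inside
  \<open>D\<close> along both \<open>h\<close> and \<open>- h\<close>, and it is sublinear by
  convexity. A linear functional below \<open>p\<close> is a subgradient, as the quotient at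
  \<open>t = 1\<close> shows.\<close>

theorem subgradient_exists:
  fixes V D :: "'v::real_vector set"
  assumes V: "subspace V" and D: "D \<subseteq> V" "x \<in> D" and f: "convex_on D f"
    and abs: "\<And>h. h \<in> V \<Longrightarrow> \<exists>t>0. x + t *\<^sub>R h \<in> D"
  obtains g where "linear_on_set V g" "\<And>y. y \<in> D \<Longrightarrow> f x + g (y - x) \<le> f y"
    "\<And>y. y \<notin> V \<Longrightarrow> g y = 0"
proof -
  define R where "R h = {t. t > 0 \<and> x + t *\<^sub>R h \<in> D}" for h
  define s where "s h t = (f (x + t *\<^sub>R h) - f x) / t" for h t
  have cD: "convex D" using f by (simp add: convex_on_def)
  have Rne: "R h \<noteq> {}" if "h \<in> V" for h
    using abs[OF that] by (auto simp: R_def)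
  \<comment> \<open>\<open>x\<close> is the convex combination of \<open>x + t h\<close> and
    \<open>x - u h\<close> with weights \<open>u / (u + t)\<close> and \<open>t / (u + t)\<close>;
    so quotients in direction \<open>- h\<close> bound those in direction \<open>h\<close> from
    below.\<close>
  have low: "- s (- h) u \<le> s h t" if u: "u \<in> R (- h)" and t: "t \<in> R h" for h u t
  proof -
    have pos: "u > 0" "t > 0" "u + t > 0" and inD: "x + t *\<^sub>R h \<in> D" "x + u *\<^sub>R (- h) \<in> D"
      using u t by (auto simp: R_def)
    have eq: "(u / (u + t)) *\<^sub>R (x + t *\<^sub>R h) + (t / (u + t)) *\<^sub>R (x + u *\<^sub>R (- h)) =
        (u / (u + t) + t / (u + t)) *\<^sub>R x"
      by (simp add: algebra_simps)
    have one: "u / (u + t) + t / (u + t) = 1" using pos by (simp add: add_divide_distrib[symmetric])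
    have "f ((u / (u + t)) *\<^sub>R (x + t *\<^sub>R h) + (t / (u + t)) *\<^sub>R (x + u *\<^sub>R (- h))) \<le>
        (u / (u + t)) * f (x + t *\<^sub>R h) + (t / (u + t)) * f (x + u *\<^sub>R (- h))"
      using convex_on_two[OF f inD _ _ one] pos by simp
    then have "f x \<le> (u * f (x + t *\<^sub>R h) + t * f (x + u *\<^sub>R (- h))) / (u + t)"
      unfolding eq one by (simp add: add_divide_distrib)
    then have "f x * (u + t) \<le> u * f (x + t *\<^sub>R h) + t * f (x + u *\<^sub>R (- h))"
      using pos by (simp add: field_simps)
    then show ?thesis unfolding s_def using pos by (simp add: field_simps)
  qed
  define p where "p h = (INF t\<in>R h. s h t)" for h
  have ple: "p h \<le> s h t" if h: "h \<in> V" and t: "t \<in> R h" for h t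
  proof -
    obtain u where "u \<in> R (- h)" using Rne[OF subspace_neg[OF V h]] by auto
    then show ?thesis unfolding p_def using low t
      by (intro cINF_lower bdd_belowI2[where m="- s (- h) u"]) auto
  qed
  have pge: "r \<le> p h" if "h \<in> V" "\<And>t. t \<in> R h \<Longrightarrow> r \<le> s h t" for r h
    unfolding p_def using Rne that by (intro cINF_greatest) auto
  have sub: "sublinear_on V p"
    unfolding sublinear_on_def
  proof (intro conjI ballI allI impI)
    fix h k assume hk: "h \<in> V" "k \<in> V"
    have *: "p (h + k) \<le> s h t + s k u" if t: "t \<in> R h" and u: "u \<in> R k" for t u
    proof -
      have pos: "u > 0" "t > 0" "u + t > 0" and inD: "x + t *\<^sub>R h \<in> D" "x + u *\<^sub>R k \<in> D"
        using u t by (auto simp: R_def)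
      \<comment> \<open>The step for \<open>h + k\<close>: with weights \<open>u / (u + t)\<close>
        and \<open>t / (u + t)\<close> the points \<open>x + t h\<close> and \<open>x + u k\<close>
        combine to \<open>x + v (h + k)\<close>.\<close>
      define v where "v = t * u / (u + t)"
      have v: "v > 0" using pos by (simp add: v_def)
      have one: "u / (u + t) + t / (u + t) = 1" using pos by (simp add: add_divide_distrib[symmetric])
      have "(u / (u + t)) *\<^sub>R (x + t *\<^sub>R h) + (t / (u + t)) *\<^sub>R (x + u *\<^sub>R k) =
          (u / (u + t) + t / (u + t)) *\<^sub>R x + v *\<^sub>R (h + k)"
        by (simp add: algebra_simps v_def)
      then have eq: "(u / (u + t)) *\<^sub>R (x + t *\<^sub>R h) + (t / (u + t)) *\<^sub>R (x + u *\<^sub>R k) =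
          x + v *\<^sub>R (h + k)" using one by simp
      have "x + v *\<^sub>R (h + k) \<in> D"
        using convexD[OF cD inD, of "u / (u + t)" "t / (u + t)"] pos one eq by simp
      then have "v \<in> R (h + k)" using v by (simp add: R_def)
      then have 1: "p (h + k) \<le> s (h + k) v" using hk V by (intro ple) (auto simp: subspace_add)
      have "f ((u / (u + t)) *\<^sub>R (x + t *\<^sub>R h) + (t / (u + t)) *\<^sub>R (x + u *\<^sub>R k)) \<le>
          (u / (u + t)) * f (x + t *\<^sub>R h) + (t / (u + t)) * f (x + u *\<^sub>R k)"
        using convex_on_two[OF f inD _ _ one] pos by simp
      then have "f (x + v *\<^sub>R (h + k)) - f x \<le>
          (u / (u + t)) * f (x + t *\<^sub>R h) + (t / (u + t)) * f (x + u *\<^sub>R k) -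
          (u / (u + t) + t / (u + t)) * f x"
        unfolding eq one by simp
      also have "\<dots> = v * (s h t + s k u)"
      proof -
        have "v * s h t = (u / (u + t)) * (f (x + t *\<^sub>R h) - f x)"
          "v * s k u = (t / (u + t)) * (f (x + u *\<^sub>R k) - f x)"
          using pos by (simp_all add: s_def v_def)
        then show ?thesis by (simp only: distrib_left) (simp add: algebra_simps)
      qed
      finally have "s (h + k) v \<le> s h t + s k u"
        using v unfolding s_def[of "h + k"] by (simp add: field_simps)
      then show ?thesis using 1 by simp
    qed
    have "p (h + k) - s h t \<le> p k" if "t \<in> R h" for t
      using *[OF that] hk by (intro pge) (auto simp: algebra_simps)
    then have "p (h + k) - p k \<le> p h"
      using hk by (intro pge) (auto simp: algebra_simps)
    then show "p (h + k) \<le> p h + p k" by simp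
  next
    fix c :: real and h assume c: "c > 0" and h: "h \<in> V"
    have "p (c *\<^sub>R h) \<le> c * s h t" if "t \<in> R h" for t
    proof -
      have "t / c \<in> R (c *\<^sub>R h)" using that c by (simp add: R_def)
      then have "p (c *\<^sub>R h) \<le> s (c *\<^sub>R h) (t / c)" using h V by (intro ple) (auto simp: subspace_scale)
      then show ?thesis using c by (simp add: s_def mult.commute)
    qed
    then have "p (c *\<^sub>R h) / c \<le> p h" using c h by (intro pge) (auto simp: field_simps)
    then show "p (c *\<^sub>R h) \<le> c * p h" using c by (simp add: field_simps)
  qed
  obtain g where g: "linear_on_set V g" "\<And>h. h \<in> V \<Longrightarrow> g h \<le> p h" "\<And>y. y \<notin> V \<Longrightarrow> g y = 0"
    using hahn_banach_sublinear[OF V sub] by blast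
  have "f x + g (y - x) \<le> f y" if "y \<in> D" for y
  proof -
    have "y - x \<in> V" using that D subspace_diff[OF V] by blast
    moreover have "1 \<in> R (y - x)" using that by (simp add: R_def)
    ultimately have "g (y - x) \<le> s (y - x) 1" using g(2) ple by fastforce
    then show ?thesis by (simp add: s_def)
  qed
  then show thesis using that g by blast
qed

section \<open>Small oscillation on scattered compact sets\<close>

lemma cont_funs_continuous: "f \<in> cont_funs X \<Longrightarrow> continuous_map X euclideanreal f"
  by (simp add: cont_funs_def)

lemma cont_funs_outside: "f \<in> cont_funs X \<Longrightarrow> x \<notin> topspace X \<Longrightarrow> f x = 0"
  by (simp add: cont_funs_def)

lemma cont_funs_add: "f \<in> cont_funs X \<Longrightarrow> g \<in> cont_funs X \<Longrightarrow> f + g \<in> cont_funs X"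
  by (rule subspace_add[OF subspace_cont_funs])

lemma cont_funs_diff: "f \<in> cont_funs X \<Longrightarrow> g \<in> cont_funs X \<Longrightarrow> f - g \<in> cont_funs X"
  by (rule subspace_diff[OF subspace_cont_funs])

lemma cont_funs_uminus: "f \<in> cont_funs X \<Longrightarrow> - f \<in> cont_funs X"
  by (rule subspace_neg[OF subspace_cont_funs])

lemma cont_funs_scaleR: "f \<in> cont_funs X \<Longrightarrow> c *\<^sub>R f \<in> cont_funs X"
  by (rule subspace_scale[OF subspace_cont_funs])

lemma cont_funs_0: "0 \<in> cont_funs X"
  by (rule subspace_0[OF subspace_cont_funs])

lemma cont_funs_mult:
  "f \<in> cont_funs X \<Longrightarrow> g \<in> cont_funs X \<Longrightarrow> (\<lambda>x. f x * g x) \<in> cont_funs X"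
  unfolding cont_funs_def by (auto intro!: continuous_intros)

lemma cont_funs_compose:
  assumes "f \<in> cont_funs X" "continuous_on UNIV \<phi>" "\<phi> 0 = 0"
  shows "(\<lambda>x. \<phi> (f x)) \<in> cont_funs X"
proof -
  have "continuous_map X euclideanreal (\<phi> \<circ> f)"
    by (rule continuous_map_compose[of _ euclideanreal]) (use assms in \<open>auto simp: cont_funs_def\<close>)
  then show ?thesis using assms by (simp add: cont_funs_def o_def)
qed

lemma cont_funs_cutoff:
  assumes "continuous_map X euclideanreal f"
  shows "(\<lambda>x. if x \<in> topspace X then f x else 0) \<in> cont_funs X"
  unfolding cont_funs_def using assms by (auto intro: continuous_map_eq)

lemma cont_funs_bump:
  assumes X: "completely_regular_space X" and S: "closedin X S" and x: "x \<in> topspace X" "x \<notin> S"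
  obtains b where "b \<in> cont_funs X" "b x = 1" "\<And>y. y \<in> S \<Longrightarrow> b y = 0" "\<And>y. 0 \<le> b y" "\<And>y. b y \<le> 1"
proof -
  obtain f where f: "continuous_map X (top_of_set {0..1::real}) f" "f x = 0" "f ` S \<subseteq> {1}"
    using X S x unfolding completely_regular_space_def by blast
  have fc: "continuous_map X euclideanreal f" and f01: "\<And>y. y \<in> topspace X \<Longrightarrow> f y \<in> {0..1}"
    using f(1) by (auto simp: continuous_map_in_subtopology)
  let ?b = "\<lambda>y. if y \<in> topspace X then 1 - f y else 0"
  show thesis
  proof (rule that[of ?b])
    show "?b \<in> cont_funs X" using fc by (intro cont_funs_cutoff) (auto intro!: continuous_intros)
    show "?b x = 1" using f(2) x by simp
    show "?b y = 0" if "y \<in> S" for y using f(3) that by auto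
    show "0 \<le> ?b y" "?b y \<le> 1" for y using f01[of y] by auto
  qed
qed

abbreviation truncation :: "real \<Rightarrow> ('a \<Rightarrow> real) \<Rightarrow> 'a \<Rightarrow> real"
  where "truncation c f \<equiv> \<lambda>x. max (- c) (min c (f x))"

lemma truncation_real:
  fixes c y :: real
  shows "0 \<le> c \<Longrightarrow> \<bar>max (- c) (min c y)\<bar> \<le> c" and "\<bar>y\<bar> \<le> c \<Longrightarrow> max (- c) (min c y) = y"
  by (auto simp: max_def min_def)

lemma cont_funs_truncation: "f \<in> cont_funs X \<Longrightarrow> c \<ge> 0 \<Longrightarrow> truncation c f \<in> cont_funs X"
  by (rule cont_funs_compose) (auto intro!: continuous_intros)

section \<open>Functionals dominated by the supremum over a set\<close>

lemma linear_on_set_diff: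
  assumes "linear_on_set V T" "subspace V" "x \<in> V" "y \<in> V"
  shows "T (x - y) = T x - T y"
proof -
  have "T (x + (-1) *\<^sub>R y) = T x + (-1) *\<^sub>R T y"
    using assms subspace_scale[OF assms(2,4), of "-1"] unfolding linear_on_set_def by presburger
  then show ?thesis by simp
qed

lemma linear_on_set_uminus:
  assumes "linear_on_set V T" "x \<in> V"
  shows "T (- x) = - T x"
proof -
  have "T ((-1) *\<^sub>R x) = (-1) *\<^sub>R T x" using assms unfolding linear_on_set_def by blast
  then show ?thesis by simp
qed

lemma linear_on_set_0:
  assumes "linear_on_set V T" "subspace V"
  shows "T 0 = 0"
  using linear_on_set_diff[OF assms subspace_0[OF assms(2)] subspace_0[OF assms(2)]] by simp

text \<open>\<open>\<nu>\<close> has norm at most \<open>C\<close> with respect to the seminorm of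
  uniform convergence on \<open>L\<close>. Quantifying over bounds \<open>c\<close> instead of
  taking a supremum covers the empty \<open>L\<close>, where \<open>\<nu>\<close> vanishes on
  \<open>cont_funs X\<close>.\<close>

definition dominated :: "'a topology \<Rightarrow> 'a set \<Rightarrow> real \<Rightarrow> (('a \<Rightarrow> real) \<Rightarrow> real) \<Rightarrow> bool"
  where "dominated X L C \<nu> \<longleftrightarrow> linear_on_set (cont_funs X) \<nu> \<and>
    (\<forall>h\<in>cont_funs X. \<forall>c\<ge>0. (\<forall>x\<in>L. \<bar>h x\<bar> \<le> c) \<longrightarrow> \<bar>\<nu> h\<bar> \<le> C * c)"

lemma dominatedD:
  assumes "dominated X L C \<nu>"
  shows "f \<in> cont_funs X \<Longrightarrow> g \<in> cont_funs X \<Longrightarrow> \<nu> (f + g) = \<nu> f + \<nu> g"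
    and "f \<in> cont_funs X \<Longrightarrow> g \<in> cont_funs X \<Longrightarrow> \<nu> (f - g) = \<nu> f - \<nu> g"
    and "f \<in> cont_funs X \<Longrightarrow> \<nu> (- f) = - \<nu> f"
    and "f \<in> cont_funs X \<Longrightarrow> \<nu> (c *\<^sub>R f) = c * \<nu> f"
    and "f \<in> cont_funs X \<Longrightarrow> 0 \<le> c \<Longrightarrow> (\<And>x. x \<in> L \<Longrightarrow> \<bar>f x\<bar> \<le> c) \<Longrightarrow> \<bar>\<nu> f\<bar> \<le> C * c"
proof -
  have *: "linear_on_set (cont_funs X) \<nu>" using assms by (simp add: dominated_def)
  show "f \<in> cont_funs X \<Longrightarrow> g \<in> cont_funs X \<Longrightarrow> \<nu> (f + g) = \<nu> f + \<nu> g"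
    "f \<in> cont_funs X \<Longrightarrow> \<nu> (c *\<^sub>R f) = c * \<nu> f"
    using * by (auto simp: linear_on_set_def)
  show "f \<in> cont_funs X \<Longrightarrow> g \<in> cont_funs X \<Longrightarrow> \<nu> (f - g) = \<nu> f - \<nu> g"
    by (rule linear_on_set_diff[OF * subspace_cont_funs])
  show "f \<in> cont_funs X \<Longrightarrow> \<nu> (- f) = - \<nu> f"
    by (rule linear_on_set_uminus[OF *])
  show "f \<in> cont_funs X \<Longrightarrow> 0 \<le> c \<Longrightarrow> (\<And>x. x \<in> L \<Longrightarrow> \<bar>f x\<bar> \<le> c) \<Longrightarrow> \<bar>\<nu> f\<bar> \<le> C * c"
    using assms by (auto simp: dominated_def)
qed

lemma dominated_nonneg: "dominated X L C \<nu> \<Longrightarrow> 0 \<le> C"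
  using dominatedD(5)[of X L C \<nu> 0 1] cont_funs_0 by force

lemma dominated_agree:
  assumes "dominated X L C \<nu>" "f \<in> cont_funs X" "g \<in> cont_funs X" "\<And>x. x \<in> L \<Longrightarrow> f x = g x"
  shows "\<nu> f = \<nu> g"
  using dominatedD(5)[OF assms(1), of "f - g" 0] dominatedD(2)[OF assms(1-3)]
    cont_funs_diff[OF assms(2,3)] assms(4) by simp

text \<open>Call a relatively open \<open>W \<subseteq> L\<close> good if the conclusion holds for all \<open>k\<close> that vanish on \<open>L - W\<close>.
  Unions of chains of good sets are good: if \<open>\<nu> h\<close> nearly attains the supremum of all \<open>\<nu> k\<close>, then \<open>\<nu>\<close>
  is almost zero on functions supported where \<open>h\<close> is small. By Zorn's lemma there is a
  maximal good set, and an isolated point of its complement could be added to it.\<close>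
theorem small_oscillation_on_scattered:
  fixes X :: "'a topology" and \<A> :: "(('a \<Rightarrow> real) \<Rightarrow> real) set set"
  assumes X: "completely_regular_space X" and L: "compactin X L"
    and sc: "scattered_space (subtopology X L)"
    and dom: "\<And>A \<nu>. A \<in> \<A> \<Longrightarrow> \<nu> \<in> A \<Longrightarrow> dominated X L C \<nu>"
    and ne: "\<And>A. A \<in> \<A> \<Longrightarrow> A \<noteq> {}"
    and slice: "\<And>A \<mu> h c. A \<in> \<A> \<Longrightarrow> \<mu> \<in> A \<Longrightarrow> h \<in> cont_funs X \<Longrightarrow> c < \<mu> h \<Longrightarrow>
      \<exists>A'\<in>\<A>. A' \<subseteq> A \<and> (\<forall>\<nu>\<in>A'. c < \<nu> h)"
    and "A \<in> \<A>" "\<epsilon> > 0"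
  shows "\<exists>A'\<in>\<A>. A' \<subseteq> A \<and> (\<forall>\<nu>\<in>A'. \<forall>\<nu>'\<in>A'. \<forall>k\<in>cont_funs X. (\<forall>x\<in>L. \<bar>k x\<bar> \<le> 1) \<longrightarrow> \<bar>\<nu> k - \<nu>' k\<bar> \<le> \<epsilon>)"
proof -
  have LX: "L \<subseteq> topspace X" using L by (rule compactin_subset_topspace)
  define H where "H W = {k \<in> cont_funs X. (\<forall>x\<in>L. \<bar>k x\<bar> \<le> 1) \<and> (\<forall>x\<in>L-W. k x = 0)}" for W
  \<comment> \<open>The refinement is required inside every member of the family and for every
    \<open>\<epsilon>\<close>, so that refinements obtained for different open sets can be
    iterated.\<close>
  define good where "good W \<longleftrightarrow> (\<forall>A\<in>\<A>. \<forall>\<epsilon>>0. \<exists>A'\<in>\<A>. A' \<subseteq> A \<and>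
    (\<forall>\<nu>\<in>A'. \<forall>\<nu>'\<in>A'. \<forall>k\<in>H W. \<bar>\<nu> k - \<nu>' k\<bar> \<le> \<epsilon>))" for W
  define G where "G = {W. openin (subtopology X L) W \<and> good W}"
  have HC: "\<nu> k \<le> C" if "A \<in> \<A>" "\<nu> \<in> A" "k \<in> H W" for A \<nu> k W
    using dominatedD(5)[OF dom[OF that(1,2)], of k 1] that by (auto simp: H_def)
  have empty: "{} \<in> G"
  proof -
    have "\<nu> k = 0" if "A \<in> \<A>" "\<nu> \<in> A" "k \<in> H {}" for A \<nu> k
      using dominatedD(5)[OF dom[OF that(1,2)], of k 0] that by (auto simp: H_def)
    then have "good {}" unfolding good_def by (metis abs_zero diff_self less_eq_real_def subset_refl)
    then show ?thesis by (simp add: G_def)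
  qed
  have chain: "\<Union>\<C> \<in> G" if \<C>: "\<C> \<noteq> {}" "subset.chain G \<C>" for \<C>
  proof -
    have \<C>G: "\<And>W. W \<in> \<C> \<Longrightarrow> openin (subtopology X L) W" "\<And>W. W \<in> \<C> \<Longrightarrow> good W"
      using \<C> by (auto simp: subset.chain_def G_def)
    let ?W = "\<Union>\<C>"
    have "good ?W"
      unfolding good_def
    proof (intro ballI allI impI)
      fix A and \<epsilon> :: real assume A: "A \<in> \<A>" and \<epsilon>: "\<epsilon> > 0"
      \<comment> \<open>\<open>\<delta> \<le> 1 / 4\<close> keeps \<open>1 - 2 \<delta>\<close> at
        least \<open>1 / 2\<close>. In the end each of two functionals costs
        \<open>2 \<delta>\<close>, which together use half of \<open>\<epsilon>\<close>.\<close>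
      define \<delta> where "\<delta> = min (1/4) (\<epsilon> / 8)"
      have \<delta>: "\<delta> > 0" "\<delta> \<le> 1/4" "8 * \<delta> \<le> \<epsilon>" using \<epsilon> by (auto simp: \<delta>_def)
      \<comment> \<open>The largest value that functionals in \<open>A\<close> reach on the test
        functions for \<open>?W\<close>. It is nearly attained by \<open>\<mu>\<close> at
        \<open>h\<close>, and the slice \<open>A2\<close> makes all its members nearly attain it at
        the same \<open>h\<close>.\<close>
      define s where "s = (SUP (\<nu>, k)\<in>A \<times> H ?W. \<nu> k)"
      have bdd: "bdd_above ((\<lambda>(\<nu>, k). \<nu> k) ` (A \<times> H ?W))"
        using HC[OF A] by (intro bdd_aboveI2[where M=C]) auto
      have sge: "\<nu> k \<le> s" if "\<nu> \<in> A" "k \<in> H ?W" for \<nu> k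
        using cSUP_upper[OF _ bdd, of "(\<nu>, k)"] that by (simp add: s_def)
      have "0 \<in> H ?W" by (simp add: H_def cont_funs_0)
      then have "A \<times> H ?W \<noteq> {}" using ne[OF A] by blast
      then obtain \<mu> h where \<mu>: "\<mu> \<in> A" "h \<in> H ?W" "s - \<delta> < \<mu> h"
        using less_cSUP_iff[OF _ bdd, of "s - \<delta>"] \<delta> by (auto simp: s_def)
      have hC: "h \<in> cont_funs X" and h1: "\<And>x. x \<in> L \<Longrightarrow> \<bar>h x\<bar> \<le> 1"
        using \<mu> by (auto simp: H_def)
      obtain A2 where A2: "A2 \<in> \<A>" "A2 \<subseteq> A" "\<And>\<nu>. \<nu> \<in> A2 \<Longrightarrow> s - \<delta> < \<nu> h"
        using slice[OF A \<mu>(1) hC \<mu>(3)] by blast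
      define Q where "Q = {x \<in> L. \<delta> \<le> \<bar>h x\<bar>}"
      have "closedin X {x \<in> topspace X. (\<lambda>x. \<bar>h x\<bar>) x \<in> {\<delta>..}}"
        using hC by (intro closedin_continuous_map_preimage[of _ euclideanreal])
          (auto simp: cont_funs_def intro!: continuous_intros)
      then have "compactin X (L \<inter> {x \<in> topspace X. (\<lambda>x. \<bar>h x\<bar>) x \<in> {\<delta>..}})"
        using L by (rule compact_Int_closedin[rotated])
      moreover have "L \<inter> {x \<in> topspace X. (\<lambda>x. \<bar>h x\<bar>) x \<in> {\<delta>..}} = Q"
        using LX by (auto simp: Q_def)
      ultimately have Q: "compactin (subtopology X L) Q" by (simp add: compactin_subtopology Q_def)
      have QO: "Q \<subseteq> \<Union>\<C>"
      proof
        fix x assume "x \<in> Q"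
        then have "x \<in> L" "h x \<noteq> 0" using \<delta>(1) by (auto simp: Q_def)
        then show "x \<in> \<Union>\<C>" using \<mu>(2) by (auto simp: H_def)
      qed
      \<comment> \<open>Compactness covers \<open>Q\<close> by finitely many members of the chain,
        hence by the largest of these.\<close>
      obtain W' where W': "W' \<in> \<C>" "Q \<subseteq> W'"
      proof -
        obtain \<F> where \<F>: "finite \<F>" "\<F> \<subseteq> \<C>" "Q \<subseteq> \<Union>\<F>"
          using compactinD[OF Q \<C>G(1) QO] by blast
        show thesis
        proof (cases "\<F> = {}")
          case True
          then show thesis using that \<F> \<C>(1) by auto
        next
          case False
          have "subset.chain G \<F>" using \<C>(2) \<F>(2) unfolding subset.chain_def by blast
          then have "\<Union>\<F> \<in> \<F>" using Union_in_chain[OF \<F>(1) False] by blast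
          then show thesis using that \<F> by blast
        qed
      qed
      obtain A3 where A3: "A3 \<in> \<A>" "A3 \<subseteq> A2"
        and osc: "\<And>\<nu> \<nu>' k. \<nu> \<in> A3 \<Longrightarrow> \<nu>' \<in> A3 \<Longrightarrow> k \<in> H W' \<Longrightarrow> \<bar>\<nu> k - \<nu>' k\<bar> \<le> \<epsilon> / 2"
        using \<C>G(2)[OF W'(1), unfolded good_def, rule_format, OF A2(1), of "\<epsilon> / 2"] \<epsilon> by auto
      \<comment> \<open>A cut-off equal to 1 where \<open>\<bar>h\<bar>\<close> is at least
        \<open>2 \<delta>\<close> and to 0 where it is at most \<open>\<delta>\<close>. So
        \<open>k w\<close> vanishes on \<open>L - W'\<close>, while \<open>k - k w\<close> lives
        where \<open>h\<close> is small.\<close>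
      define w where "w x = max 0 (min 1 (\<bar>h x\<bar> / \<delta> - 1))" for x
      have wC: "w \<in> cont_funs X"
        unfolding w_def
        by (rule cont_funs_compose[OF hC]) (use \<delta>(1) in \<open>auto intro!: continuous_intros\<close>)
      have w01: "0 \<le> w x" "w x \<le> 1" for x by (auto simp: w_def)
      have w0: "w x = 0" if "\<bar>h x\<bar> \<le> \<delta>" for x
      proof -
        have "\<bar>h x\<bar> / \<delta> \<le> 1" using that \<delta>(1) by simp
        then show ?thesis by (simp add: w_def)
      qed
      have w1: "w x = 1" if "2 * \<delta> \<le> \<bar>h x\<bar>" for x using that \<delta> by (simp add: w_def field_simps)
      \<comment> \<open>Adding \<open>(1 - 2 \<delta>) (k - k w)\<close> to \<open>h\<close> stays
        in the unit ball, so it cannot raise \<open>\<nu>\<close> above \<open>s\<close>; but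
        \<open>\<nu> h\<close> is already within \<open>\<delta>\<close> of
        \<open>s\<close>.\<close>
      have rest: "\<nu> (k - (\<lambda>x. k x * w x)) \<le> 2 * \<delta>" if \<nu>: "\<nu> \<in> A3" and k: "k \<in> H ?W" for \<nu> k
      proof -
        let ?k = "k - (\<lambda>x. k x * w x)"
        have kC: "?k \<in> cont_funs X"
          using k wC by (intro cont_funs_diff cont_funs_mult) (auto simp: H_def)
        have "\<bar>h x + (1 - 2 * \<delta>) * (k x - k x * w x)\<bar> \<le> 1" if x: "x \<in> L" for x
        proof (cases "2 * \<delta> \<le> \<bar>h x\<bar>")
          case True
          then show ?thesis using w1 h1 x by simp
        next
          case False
          have "\<bar>k x - k x * w x\<bar> = \<bar>k x\<bar> * \<bar>1 - w x\<bar>" by (simp add: abs_mult[symmetric] algebra_simps)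
          also have "\<dots> \<le> 1 * 1" using k x w01[of x] by (intro mult_mono) (auto simp: H_def)
          finally have "\<bar>(1 - 2 * \<delta>) * (k x - k x * w x)\<bar> \<le> (1 - 2 * \<delta>) * 1"
            using \<delta> by (simp add: abs_mult)
          then show ?thesis
            using False abs_triangle_ineq[of "h x" "(1 - 2 * \<delta>) * (k x - k x * w x)"]
            unfolding mult_1_right by linarith
        qed
        moreover have "h x + (1 - 2 * \<delta>) * (k x - k x * w x) = 0" if "x \<in> L - ?W" for x
          using that \<mu>(2) k by (auto simp: H_def)
        ultimately have "h + (1 - 2 * \<delta>) *\<^sub>R ?k \<in> H ?W"
          using hC kC by (auto simp: H_def cont_funs_add cont_funs_scaleR)
        then have "\<nu> (h + (1 - 2 * \<delta>) *\<^sub>R ?k) \<le> s" using sge \<nu> A2 A3 by blast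
        moreover have d: "dominated X L C \<nu>" using dom A3(1) \<nu> .
        ultimately have "\<nu> h + (1 - 2 * \<delta>) * \<nu> ?k \<le> s"
          using hC kC by (simp add: dominatedD(1)[OF d] dominatedD(4)[OF d] cont_funs_scaleR)
        moreover have "s - \<delta> < \<nu> h" using A2 A3 \<nu> by blast
        ultimately have 1: "(1 - 2 * \<delta>) * \<nu> ?k \<le> \<delta>" by linarith
        show "\<nu> ?k \<le> 2 * \<delta>"
        proof (rule ccontr)
          assume "\<not> \<nu> ?k \<le> 2 * \<delta>"
          then have "(1/2) * (2 * \<delta>) < (1 - 2 * \<delta>) * \<nu> ?k" using \<delta> by (intro mult_le_less_imp_less) auto
          then show False using 1 by simp
        qed
      qed
      have "\<bar>\<nu> k - \<nu>' k\<bar> \<le> \<epsilon>" if \<nu>: "\<nu> \<in> A3" "\<nu>' \<in> A3" and k: "k \<in> H ?W" for \<nu> \<nu>' k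
      proof -
        let ?kw = "\<lambda>x. k x * w x"
        have kC: "k \<in> cont_funs X" "?kw \<in> cont_funs X"
          using k wC by (auto intro: cont_funs_mult simp: H_def)
        have "\<bar>k x * w x\<bar> \<le> 1" if "x \<in> L" for x
        proof -
          have "\<bar>k x\<bar> * \<bar>w x\<bar> \<le> 1 * 1" using k that w01[of x] by (intro mult_mono) (auto simp: H_def)
          then show ?thesis by (simp add: abs_mult)
        qed
        moreover have "w x = 0" if "x \<in> L - W'" for x
        proof -
          have "x \<notin> Q" using that W' by blast
          then show ?thesis using that by (intro w0) (auto simp: Q_def)
        qed
        ultimately have "?kw \<in> H W'" using kC by (simp add: H_def)
        then have 1: "\<bar>\<nu> ?kw - \<nu>' ?kw\<bar> \<le> \<epsilon> / 2" using osc \<nu> by blast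
        have mk: "- k \<in> H ?W" using k by (auto simp: H_def cont_funs_uminus)
        have 2: "\<bar>\<nu> k - \<nu> ?kw\<bar> \<le> 2 * \<delta>" if "\<nu> \<in> A3" for \<nu>
        proof -
          have d: "dominated X L C \<nu>" using dom A3(1) that .
          have "- k - (\<lambda>x. (- k) x * w x) = - (k - ?kw)" by (auto simp: fun_eq_iff)
          then have "\<nu> (- (k - ?kw)) \<le> 2 * \<delta>" using rest[OF that mk] by (simp only:)
          then show ?thesis
            using rest[OF that k] kC
            by (simp add: dominatedD(2)[OF d] dominatedD(3)[OF d] cont_funs_diff)
        qed
        show ?thesis using 1 2[OF \<nu>(1)] 2[OF \<nu>(2)] \<delta>(3) by linarith
      qed
      then show "\<exists>A'\<in>\<A>. A' \<subseteq> A \<and> (\<forall>\<nu>\<in>A'. \<forall>\<nu>'\<in>A'. \<forall>k\<in>H ?W. \<bar>\<nu> k - \<nu>' k\<bar> \<le> \<epsilon>)"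
        using A3 A2 by (intro bexI[of _ A3]) auto
    qed
    then show ?thesis using \<C>G(1) by (auto simp: G_def)
  qed
  obtain M where M: "M \<in> G" and max: "\<And>W. W \<in> G \<Longrightarrow> M \<subseteq> W \<Longrightarrow> W = M"
    using subset_Zorn_nonempty[of G] empty chain by blast
  have Mo: "openin (subtopology X L) M" and Mg: "good M" using M by (auto simp: G_def)
  have "M = L"
  proof (rule ccontr)
    assume "M \<noteq> L"
    then have "L - M \<subseteq> topspace (subtopology X L)" "L - M \<noteq> {}"
      using openin_subset[OF Mo] LX by auto
    then obtain x where x: "x \<in> L - M" "openin (subtopology (subtopology X L) (L - M)) {x}"
      using sc unfolding scattered_space_def by blast
    then obtain V where V: "openin X V" "{x} = V \<inter> (L - M)"
      by (auto simp: openin_subtopology subtopology_subtopology)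
    let ?W = "insert x M"
    have "?W = M \<union> (V \<inter> L)" using V(2) openin_subset[OF Mo] x(1) by auto
    then have Oo: "openin (subtopology X L) ?W"
      using openin_Un[OF Mo openin_subtopology_Int[OF V(1), of L]] by simp
    have "closedin X (topspace X - V)" "x \<in> topspace X" "x \<notin> topspace X - V"
      using V x LX by auto
    from cont_funs_bump[OF X this] obtain \<psi> where \<psi>C: "\<psi> \<in> cont_funs X" and \<psi>1: "\<psi> x = 1"
      and \<psi>V: "\<And>y. y \<in> topspace X - V \<Longrightarrow> \<psi> y = 0" and \<psi>01: "\<And>y. 0 \<le> \<psi> y" "\<And>y. \<psi> y \<le> 1"
      by blast
    have \<psi>b: "\<bar>\<psi> y\<bar> \<le> 1" for y using \<psi>01[of y] by simp
    have \<psi>0: "\<psi> y = 0" if "y \<in> L - ?W" for y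
      using that V(2) LX by (intro \<psi>V) auto
    have "good ?W"
      unfolding good_def
    proof (intro ballI allI impI)
      fix A and \<epsilon> :: real assume A: "A \<in> \<A>" and \<epsilon>: "\<epsilon> > 0"
      obtain A1 where A1: "A1 \<in> \<A>" "A1 \<subseteq> A"
        and osc: "\<And>\<nu> \<nu>' k. \<nu> \<in> A1 \<Longrightarrow> \<nu>' \<in> A1 \<Longrightarrow> k \<in> H M \<Longrightarrow> \<bar>\<nu> k - \<nu>' k\<bar> \<le> \<epsilon> / 4"
        using Mg[unfolded good_def, rule_format, OF A, of "\<epsilon> / 4"] \<epsilon> by auto
      \<comment> \<open>Only one further direction \<open>\<psi>\<close> distinguishes test
        functions for \<open>?W\<close> from those for \<open>M\<close>. Slicing near this supremum
        fixes \<open>\<nu> \<psi>\<close> up to \<open>\<epsilon> / 2\<close>.\<close>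
      define s where "s = (SUP \<nu>\<in>A1. \<nu> \<psi>)"
      have bdd: "bdd_above ((\<lambda>\<nu>. \<nu> \<psi>) ` A1)"
        using dominatedD(5)[OF dom[OF A1(1)] \<psi>C, of _ 1] \<psi>b by (intro bdd_aboveI2[where M=C]) fastforce
      have sge: "\<nu> \<psi> \<le> s" if "\<nu> \<in> A1" for \<nu>
        using cSUP_upper[OF that bdd] by (simp add: s_def)
      obtain \<mu> where \<mu>: "\<mu> \<in> A1" "s - \<epsilon> / 2 < \<mu> \<psi>"
        using less_cSUP_iff[OF ne[OF A1(1)] bdd, of "s - \<epsilon> / 2"] \<epsilon> by (auto simp: s_def)
      obtain A2 where A2: "A2 \<in> \<A>" "A2 \<subseteq> A1" "\<And>\<nu>. \<nu> \<in> A2 \<Longrightarrow> s - \<epsilon> / 2 < \<nu> \<psi>"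
        using slice[OF A1(1) \<mu>(1) \<psi>C \<mu>(2)] by blast
      have "\<bar>\<nu> k - \<nu>' k\<bar> \<le> \<epsilon>" if \<nu>: "\<nu> \<in> A2" "\<nu>' \<in> A2" and k: "k \<in> H ?W" for \<nu> \<nu>' k
      proof -
        have kC: "k \<in> cont_funs X" and k1: "\<And>y. y \<in> L \<Longrightarrow> \<bar>k y\<bar> \<le> 1" using k by (auto simp: H_def)
        \<comment> \<open>Subtracting \<open>k x\<close> times the bump makes \<open>k\<close>
          vanish at \<open>x\<close> too, hence on \<open>L - M\<close>. The difference is bounded
          by 2 on \<open>L\<close>, whence the factor \<open>1/2\<close> and the tolerance
          \<open>\<epsilon> / 4\<close> above.\<close>
        define k2 where "k2 = k - (k x) *\<^sub>R \<psi>"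
        have k2C: "k2 \<in> cont_funs X" using kC \<psi>C by (simp add: k2_def cont_funs_diff cont_funs_scaleR)
        have "\<bar>k2 y\<bar> \<le> 2" if "y \<in> L" for y
        proof -
          have "\<bar>k x\<bar> * \<bar>\<psi> y\<bar> \<le> 1 * 1" using k1[of x] x \<psi>b by (intro mult_mono) auto
          then have "\<bar>k x * \<psi> y\<bar> \<le> 1" by (simp add: abs_mult)
          then show ?thesis using k1[OF that] by (simp add: k2_def)
        qed
        moreover have "k2 y = 0" if "y \<in> L - M" for y
          using that k \<psi>0[of y] \<psi>1 by (cases "y = x") (auto simp: k2_def H_def)
        ultimately have "(1/2) *\<^sub>R k2 \<in> H M" using k2C by (simp add: H_def cont_funs_scaleR)
        then have 1: "\<bar>\<nu> ((1/2) *\<^sub>R k2) - \<nu>' ((1/2) *\<^sub>R k2)\<bar> \<le> \<epsilon> / 4"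
          using osc \<nu> A2 by blast
        have 2: "\<nu> k2 = \<nu> k - k x * \<nu> \<psi>" "\<nu> ((1/2) *\<^sub>R k2) = \<nu> k2 / 2" if "\<nu> \<in> A2" for \<nu>
          using kC \<psi>C k2C dominatedD(2,4)[OF dom[OF A2(1) that]] by (auto simp: k2_def cont_funs_scaleR)
        have "\<bar>\<nu> \<psi> - \<nu>' \<psi>\<bar> \<le> \<epsilon> / 2"
          using A2(3)[OF \<nu>(1)] A2(3)[OF \<nu>(2)] sge \<nu> A2(2) by (smt (verit) subsetD)
        then have "\<bar>k x\<bar> * \<bar>\<nu> \<psi> - \<nu>' \<psi>\<bar> \<le> 1 * (\<epsilon> / 2)"
          using k1[of x] x by (intro mult_mono) auto
        then have "\<bar>k x * \<nu> \<psi> - k x * \<nu>' \<psi>\<bar> \<le> \<epsilon> / 2"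
          by (simp add: abs_mult[symmetric] algebra_simps)
        then show ?thesis using 1 2[OF \<nu>(1)] 2[OF \<nu>(2)] by linarith
      qed
      then show "\<exists>A'\<in>\<A>. A' \<subseteq> A \<and> (\<forall>\<nu>\<in>A'. \<forall>\<nu>'\<in>A'. \<forall>k\<in>H ?W. \<bar>\<nu> k - \<nu>' k\<bar> \<le> \<epsilon>)"
        using A2 A1 by (intro bexI[of _ A2]) auto
    qed
    then have "?W = M" using max Oo by (auto simp: G_def)
    then show False using x by auto
  qed
  then have "good L" using Mg by simp
  from this[unfolded good_def, rule_format, OF \<open>A \<in> \<A>\<close> \<open>\<epsilon> > 0\<close>]
  obtain A' where "A' \<in> \<A>" "A' \<subseteq> A"
    "\<forall>\<nu>\<in>A'. \<forall>\<nu>'\<in>A'. \<forall>k\<in>H L. \<bar>\<nu> k - \<nu>' k\<bar> \<le> \<epsilon>" by blast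
  then show ?thesis by (intro bexI[of _ A'] conjI ballI impI) (auto simp: H_def)
qed

section \<open>The Namioka--Phelps property\<close>

lemma weak_star_euclidean: "weak_star E = subtopology euclidean (dual_space E)"
  by (simp add: weak_star_def euclidean_product_topology)

lemma compactin_weak_star: "compactin (weak_star E) K \<longleftrightarrow> compact K \<and> K \<subseteq> dual_space E"
  by (auto simp: weak_star_euclidean compactin_subtopology)

lemma continuous_on_eval: "continuous_on S (\<lambda>\<nu>::'v \<Rightarrow> real. \<nu> h)"
  using continuous_on_product_coordinates[of h] continuous_on_subset by blast

text \<open>An upper bound for \<open>\<nu>\<close> on an open ball suffices because the ball is
  symmetric. The factor 2 comes from scaling \<open>h\<close> to half the radius, which secures the
  strict inequality.\<close>

lemma dominatedI:
  assumes lin: "linear_on_set (cont_funs X) \<nu>" and r: "r > 0"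
    and le: "\<And>h. h \<in> cont_funs X \<Longrightarrow> (\<And>x. x \<in> L \<Longrightarrow> \<bar>h x\<bar> < r) \<Longrightarrow> \<nu> h \<le> B"
  shows "dominated X L (2 * B / r) \<nu>"
  unfolding dominated_def
proof (intro conjI ballI allI impI lin)
  fix h :: "'a \<Rightarrow> real" and c :: real assume h: "h \<in> cont_funs X" and c: "0 \<le> c" "\<forall>x\<in>L. \<bar>h x\<bar> \<le> c"
  have scale: "\<nu> (t *\<^sub>R g) = t * \<nu> g" if "g \<in> cont_funs X" for t g
    using lin that by (simp add: linear_on_set_def)
  have up: "\<nu> g \<le> 2 * B / r * d" if g: "g \<in> cont_funs X" and d: "d > 0" "\<forall>x\<in>L. \<bar>g x\<bar> \<le> d" for g d
  proof -
    let ?t = "r / (2 * d)"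
    have "\<bar>(?t *\<^sub>R g) x\<bar> < r" if "x \<in> L" for x
    proof -
      have "\<bar>?t\<bar> * \<bar>g x\<bar> \<le> ?t * d" using d r that by (intro mult_mono) auto
      also have "\<dots> < r" using d r by simp
      finally show ?thesis by (simp add: abs_mult)
    qed
    then have "\<nu> (?t *\<^sub>R g) \<le> B" using g by (intro le) (auto simp: cont_funs_scaleR)
    then have "?t * \<nu> g \<le> B" using scale g by simp
    then show ?thesis using d r by (simp add: field_simps)
  qed
  have B: "0 \<le> 2 * B / r" 
  proof -
    have "\<nu> 0 \<le> 2 * B / r * 1" by (rule up) (auto simp: cont_funs_0)
    then show ?thesis using linear_on_set_0[OF lin subspace_cont_funs] by simp
  qed
  \<comment> \<open>\<open>up\<close> divides by its bound, so a bound \<open>d > c\<close> is used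
    here and then decreased to \<open>c\<close>; this covers \<open>c = 0\<close>.\<close>
  have both: "\<bar>\<nu> h\<bar> \<le> 2 * B / r * d" if "d > c" for d
  proof -
    have d: "d > 0" "\<forall>x\<in>L. \<bar>h x\<bar> \<le> d" using that c by force+
    have "\<nu> (- h) = - \<nu> h" by (rule linear_on_set_uminus[OF lin h])
    then show ?thesis using up[OF h d] up[OF cont_funs_uminus[OF h] d(1)] d by simp
  qed
  show "\<bar>\<nu> h\<bar> \<le> 2 * B / r * c"
  proof (rule field_le_epsilon)
    fix e :: real assume e: "e > 0"
    have "\<bar>\<nu> h\<bar> \<le> 2 * B / r * (c + e / (2 * B / r + 1))"
      using e B by (intro both) (auto intro!: divide_pos_pos)
    also have "\<dots> = 2 * B / r * c + e * (2 * B / r / (2 * B / r + 1))" by (simp add: algebra_simps)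
    also have "\<dots> \<le> 2 * B / r * c + e * 1"
    proof -
      have "q / (q + 1) \<le> 1" if "q \<ge> 0" for q :: real using that by simp
      from mult_left_mono[OF this[OF B], of e] show ?thesis using e by linarith
    qed
    finally show "\<bar>\<nu> h\<bar> \<le> 2 * B / r * c + e" by simp
  qed
qed

lemma equicontinuous_imp_dominated:
  assumes "K \<subseteq> dual_space (Ck X)" "equicontinuous (Ck X) K"
  obtains L C where "compactin X L" "\<And>\<nu>. \<nu> \<in> K \<Longrightarrow> dominated X L C \<nu>"
proof -
  have "\<exists>U. openin (Ck X) U \<and> 0 \<in> U \<and> (\<forall>\<nu>\<in>K. \<forall>y\<in>U. \<bar>\<nu> y - \<nu> 0\<bar> < 1)"
    using assms(2) cont_funs_0[of X] unfolding equicontinuous_def by (simp add: topspace_Ck)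
  then obtain U where U: "openin (Ck X) U" "0 \<in> U" "\<And>\<nu> y. \<nu> \<in> K \<Longrightarrow> y \<in> U \<Longrightarrow> \<bar>\<nu> y - \<nu> 0\<bar> < 1"
    by blast
  obtain L r where L: "compactin X L" "r > 0" "uniform_nhd (cont_funs X) L r 0 \<subseteq> U"
    using U(1,2) unfolding openin_Ck by blast
  have "dominated X L (2 * 1 / r) \<nu>" if \<nu>: "\<nu> \<in> K" for \<nu>
  proof (rule dominatedI[OF _ L(2)])
    show lin: "linear_on_set (cont_funs X) \<nu>"
      using \<nu> assms(1) by (auto simp: dual_space_def topspace_Ck)
    fix h assume h: "h \<in> cont_funs X" "\<And>x. x \<in> L \<Longrightarrow> \<bar>h x\<bar> < r"
    then have "h \<in> U" using L(3) by (auto simp: uniform_nhd_def)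
    then show "\<nu> h \<le> 1"
      using U(3)[OF \<nu>, of h] linear_on_set_0[OF lin subspace_cont_funs] by simp
  qed
  then show thesis using that L(1) by blast
qed

lemma lipschitz_continuous_map_Ck:
  assumes L: "compactin X L" and C: "0 \<le> C"
    and lip: "\<And>g h c. g \<in> cont_funs X \<Longrightarrow> h \<in> cont_funs X \<Longrightarrow> 0 \<le> c \<Longrightarrow>
      (\<And>x. x \<in> L \<Longrightarrow> \<bar>g x - h x\<bar> \<le> c) \<Longrightarrow> \<bar>f g - f h\<bar> \<le> C * c"
  shows "continuous_map (Ck X) euclideanreal f"
  unfolding continuous_map_def
proof (intro conjI allI impI)
  fix U :: "real set" assume "openin euclideanreal U"
  then have U: "open U" by simp
  show "openin (Ck X) {h \<in> topspace (Ck X). f h \<in> U}"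
    unfolding openin_Ck
  proof (intro conjI ballI)
    fix h assume "h \<in> {h \<in> topspace (Ck X). f h \<in> U}"
    then have h: "h \<in> cont_funs X" "f h \<in> U" by (auto simp: topspace_Ck)
    obtain e where e: "e > 0" "ball (f h) e \<subseteq> U" using U h(2) open_contains_ball by blast
    have "uniform_nhd (cont_funs X) L (e / (C + 1)) h \<subseteq> {h \<in> topspace (Ck X). f h \<in> U}"
    proof
      fix g assume g: "g \<in> uniform_nhd (cont_funs X) L (e / (C + 1)) h"
      then have gC: "g \<in> cont_funs X" and le: "\<And>x. x \<in> L \<Longrightarrow> \<bar>g x - h x\<bar> \<le> e / (C + 1)"
        by (auto simp: uniform_nhd_def intro: less_imp_le)
      have "\<bar>f g - f h\<bar> \<le> C * (e / (C + 1))"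
        using e C by (intro lip[OF gC h(1) _ le]) auto
      also have "\<dots> < e" using C e by (simp add: field_simps)
      finally have "f g \<in> ball (f h) e" by (simp add: dist_real_def)
      then show "g \<in> {h \<in> topspace (Ck X). f h \<in> U}" using e gC by (auto simp: topspace_Ck)
    qed
    then show "\<exists>K. compactin X K \<and>
        (\<exists>\<epsilon>>0. uniform_nhd (cont_funs X) K \<epsilon> h \<subseteq> {h \<in> topspace (Ck X). f h \<in> U})"
      using L e C by (intro exI[of _ L] conjI exI[of _ "e / (C + 1)"]) auto
  qed (auto simp: topspace_Ck)
qed auto

lemma dominated_in_dual:
  assumes L: "compactin X L" and d: "dominated X L C \<nu>" and out: "\<And>h. h \<notin> cont_funs X \<Longrightarrow> \<nu> h = 0"
  shows "\<nu> \<in> dual_space (Ck X)"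
proof -
  have "continuous_map (Ck X) euclideanreal \<nu>"
  proof (rule lipschitz_continuous_map_Ck[OF L dominated_nonneg[OF d]])
    fix g h :: "'a \<Rightarrow> real" and c :: real
    assume gh: "g \<in> cont_funs X" "h \<in> cont_funs X" "0 \<le> c" "\<And>x. x \<in> L \<Longrightarrow> \<bar>g x - h x\<bar> \<le> c"
    have "\<bar>\<nu> (g - h)\<bar> \<le> C * c"
      using gh by (intro dominatedD(5)[OF d cont_funs_diff]) auto
    then show "\<bar>\<nu> g - \<nu> h\<bar> \<le> C * c" using dominatedD(2)[OF d gh(1,2)] by simp
  qed
  then show ?thesis using d out by (auto simp: dual_space_def dominated_def topspace_Ck)
qed

lemma lcs_bounded_CkD:
  assumes M: "lcs_bounded (Ck X) M" and L: "compactin X L"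
  obtains c where "c > 0" "\<And>h x. h \<in> M \<Longrightarrow> x \<in> L \<Longrightarrow> \<bar>h x\<bar> \<le> c"
proof -
  let ?U = "uniform_nhd (cont_funs X) L 1 0"
  have "openin (Ck X) ?U" "0 \<in> ?U"
    using openin_uniform_nhd[OF cont_funs_0 L] cont_funs_0 by (auto simp: uniform_nhd_def)
  then obtain s where s: "s > 0" "\<And>t. t > s \<Longrightarrow> M \<subseteq> (\<lambda>x. t *\<^sub>R x) ` ?U"
    using M unfolding lcs_bounded_def by blast
  have "\<bar>h x\<bar> \<le> s + 1" if h: "h \<in> M" and x: "x \<in> L" for h x
  proof -
    obtain g where g: "g \<in> ?U" "h = (s + 1) *\<^sub>R g" using s(2)[of "s + 1"] h by auto
    then have "\<bar>g x\<bar> \<le> 1" using x by (force simp: uniform_nhd_def)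
    then have "(s + 1) * \<bar>g x\<bar> \<le> (s + 1) * 1" using s by (intro mult_left_mono) auto
    then show ?thesis using g s by (simp add: abs_mult)
  qed
  then show thesis using s by (intro that[of "s + 1"]) auto
qed

lemma lcs_bounded_CkI:
  assumes M: "M \<subseteq> cont_funs X"
    and bd: "\<And>L. compactin X L \<Longrightarrow> \<exists>c>0. \<forall>h\<in>M. \<forall>x\<in>L. \<bar>h x\<bar> \<le> c"
  shows "lcs_bounded (Ck X) M"
  unfolding lcs_bounded_def
proof (intro conjI allI impI)
  show "M \<subseteq> topspace (Ck X)" using M by (simp add: topspace_Ck)
  fix U assume "openin (Ck X) U \<and> 0 \<in> U"
  then obtain L r where L: "compactin X L" "r > 0" "uniform_nhd (cont_funs X) L r 0 \<subseteq> U"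
    unfolding openin_Ck by blast
  obtain c where c: "c > 0" "\<And>h x. h \<in> M \<Longrightarrow> x \<in> L \<Longrightarrow> \<bar>h x\<bar> \<le> c" using bd[OF L(1)] by blast
  have "M \<subseteq> (\<lambda>x. t *\<^sub>R x) ` U" if t: "t > c / r" for t
  proof
    fix h assume h: "h \<in> M"
    have t0: "t > 0" using t c L divide_pos_pos less_trans by blast
    have "\<bar>((1 / t) *\<^sub>R h) x\<bar> < r" if "x \<in> L" for x
      using c(2)[OF h that] t t0 L(2) by (simp add: field_simps)
    moreover have "(1 / t) *\<^sub>R h \<in> cont_funs X" using h M by (blast intro: cont_funs_scaleR)
    ultimately have "(1 / t) *\<^sub>R h \<in> uniform_nhd (cont_funs X) L r 0" by (simp add: uniform_nhd_def)
    then have "(1 / t) *\<^sub>R h \<in> U" using L(3) by blast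
    then show "h \<in> (\<lambda>x. t *\<^sub>R x) ` U" using t0 by (intro image_eqI[of _ _ "(1 / t) *\<^sub>R h"]) auto
  qed
  then show "\<exists>s>0. \<forall>t>s. M \<subseteq> (\<lambda>x. t *\<^sub>R x) ` U" using c L by (intro exI[of _ "c / r"]) auto
qed

text \<open>Slices are weak-star open, so the nonempty relatively open pieces of \<open>A\<close>
  form an admissible family. As \<open>B\<close> is uniformly bounded on \<open>L\<close>, small
  norm diameter is smallness of the diameters of the values at all \<open>v \<in> B\<close>
  simultaneously.\<close>

theorem scattered_imp_namioka_phelps:
  fixes X :: "'a topology"
  assumes X: "completely_regular_space X"
    and sc: "\<And>K. compactin X K \<Longrightarrow> scattered_space (subtopology X K)"
  shows "namioka_phelps (Ck X)"
  unfolding namioka_phelps_def fragmented_on_def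
proof (intro conjI locally_convex_space_Ck allI impI; elim conjE)
  fix B K A and \<epsilon> :: real
  assume B: "lcs_bounded (Ck X) B" and K: "compactin (weak_star (Ck X)) K" "equicontinuous (Ck X) K"
    and A: "A \<subseteq> K" "A \<noteq> {}" and \<epsilon>: "\<epsilon> > 0"
  have KD: "K \<subseteq> dual_space (Ck X)" using K(1) by (simp add: compactin_weak_star)
  obtain L C where L: "compactin X L" "\<And>\<nu>. \<nu> \<in> K \<Longrightarrow> dominated X L C \<nu>"
    using equicontinuous_imp_dominated[OF KD K(2)] by blast
  define \<A> where "\<A> = {U \<inter> A | U. openin (weak_star (Ck X)) U \<and> U \<inter> A \<noteq> {}}"
  have slice: "\<exists>A'\<in>\<A>. A' \<subseteq> A1 \<and> (\<forall>\<nu>\<in>A'. c < \<nu> h)"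
    if A1: "A1 \<in> \<A>" and \<mu>: "\<mu> \<in> A1" "c < \<mu> h" for A1 \<mu> h c
  proof -
    obtain U where U: "openin (weak_star (Ck X)) U" "A1 = U \<inter> A" using A1 by (auto simp: \<A>_def)
    have "open {\<nu>::('a \<Rightarrow> real) \<Rightarrow> real. c < \<nu> h}"
      by (intro open_Collect_less continuous_on_eval continuous_on_const)
    then have "openin (weak_star (Ck X)) (dual_space (Ck X) \<inter> {\<nu>. c < \<nu> h})"
      by (auto simp: weak_star_euclidean openin_subtopology)
    then have "openin (weak_star (Ck X)) (U \<inter> (dual_space (Ck X) \<inter> {\<nu>. c < \<nu> h}))"
      using U(1) by blast
    moreover have "\<mu> \<in> U \<inter> (dual_space (Ck X) \<inter> {\<nu>. c < \<nu> h}) \<inter> A"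
      using \<mu> U(2) A KD by auto
    ultimately have "U \<inter> (dual_space (Ck X) \<inter> {\<nu>. c < \<nu> h}) \<inter> A \<in> \<A>"
      unfolding \<A>_def by blast
    then show ?thesis using U(2) by (intro bexI) auto
  qed
  have "\<A> \<noteq> {}" "A \<in> \<A>"
  proof -
    have "openin (weak_star (Ck X)) (dual_space (Ck X))"
      by (simp add: weak_star_euclidean)
    moreover have "dual_space (Ck X) \<inter> A = A" using A KD by auto
    ultimately show "A \<in> \<A>" using A(2) unfolding \<A>_def by blast
    then show "\<A> \<noteq> {}" by auto
  qed
  obtain b where b: "b > 0" "\<And>h x. h \<in> B \<Longrightarrow> x \<in> L \<Longrightarrow> \<bar>h x\<bar> \<le> b"
    using lcs_bounded_CkD[OF B L(1)] by blast
  \<comment> \<open>Functions in \<open>B\<close> have supremum at most \<open>b\<close> on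
    \<open>L\<close>; after rescaling they oscillate by at most \<open>\<epsilon> / 2\<close>, which
    leaves room for the strict inequality.\<close>
  have "\<exists>A'\<in>\<A>. A' \<subseteq> A \<and> (\<forall>\<nu>\<in>A'. \<forall>\<nu>'\<in>A'. \<forall>k\<in>cont_funs X.
      (\<forall>x\<in>L. \<bar>k x\<bar> \<le> 1) \<longrightarrow> \<bar>\<nu> k - \<nu>' k\<bar> \<le> \<epsilon> / (2 * b))"
  proof (rule small_oscillation_on_scattered[OF X L(1) sc[OF L(1)]])
    show "\<And>A' \<nu>. A' \<in> \<A> \<Longrightarrow> \<nu> \<in> A' \<Longrightarrow> dominated X L C \<nu>" using A L(2) by (auto simp: \<A>_def)
    show "\<And>A'. A' \<in> \<A> \<Longrightarrow> A' \<noteq> {}" by (auto simp: \<A>_def)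
    show "A \<in> \<A>" by fact
    show "0 < \<epsilon> / (2 * b)" using b \<epsilon> by simp
  qed (use slice in blast)
  then obtain A' where A': "A' \<in> \<A>" "A' \<subseteq> A"
    and osc: "\<And>\<nu> \<nu>' k. \<nu> \<in> A' \<Longrightarrow> \<nu>' \<in> A' \<Longrightarrow> k \<in> cont_funs X \<Longrightarrow> (\<And>x. x \<in> L \<Longrightarrow> \<bar>k x\<bar> \<le> 1) \<Longrightarrow>
      \<bar>\<nu> k - \<nu>' k\<bar> \<le> \<epsilon> / (2 * b)" by blast
  obtain U where U: "openin (weak_star (Ck X)) U" "U \<inter> A \<noteq> {}" "A' = U \<inter> A" using A'(1) by (auto simp: \<A>_def)
  have "diameter ((\<lambda>\<xi>. \<xi> v) ` (U \<inter> A)) < \<epsilon>" if v: "v \<in> B" for v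
  proof -
    have vC: "v \<in> cont_funs X" using B v by (auto simp: lcs_bounded_def topspace_Ck)
    have "\<bar>\<nu> v - \<nu>' v\<bar> \<le> \<epsilon> / 2" if \<nu>: "\<nu> \<in> A'" "\<nu>' \<in> A'" for \<nu> \<nu>'
    proof -
      have d: "dominated X L C \<nu>" "dominated X L C \<nu>'" using \<nu> A' A L(2) by auto
      have "\<bar>((1 / b) *\<^sub>R v) x\<bar> \<le> 1" if "x \<in> L" for x
        using b(2)[OF v that] b(1) by (simp add: field_simps)
      then have "\<bar>\<nu> ((1 / b) *\<^sub>R v) - \<nu>' ((1 / b) *\<^sub>R v)\<bar> \<le> \<epsilon> / (2 * b)"
        by (rule osc[OF \<nu> cont_funs_scaleR[OF vC]])
      also have "\<nu> ((1 / b) *\<^sub>R v) - \<nu>' ((1 / b) *\<^sub>R v) = (\<nu> v - \<nu>' v) / b"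
        using dominatedD(4)[OF d(1) vC] dominatedD(4)[OF d(2) vC] by (simp add: diff_divide_distrib)
      finally have "\<bar>\<nu> v - \<nu>' v\<bar> / b \<le> \<epsilon> / (2 * b)" using b(1) by (simp add: abs_divide)
      then show ?thesis using b(1) by (simp add: field_simps)
    qed
    then have "diameter ((\<lambda>\<xi>. \<xi> v) ` (U \<inter> A)) \<le> \<epsilon> / 2"
      using U \<epsilon> by (intro diameter_le) auto
    then show ?thesis using \<epsilon> by simp
  qed
  then show "\<exists>U. openin (weak_star (Ck X)) U \<and> U \<inter> A \<noteq> {} \<and> (\<forall>v\<in>B. diameter ((\<lambda>\<xi>. \<xi> v) ` (U \<inter> A)) < \<epsilon>)"
    using U by blast
qed

section \<open>Frechet differentiability\<close>

lemma cont_funs_uniform_limit: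
  assumes f: "\<And>n::nat. f n \<in> cont_funs X" and e: "e \<longlonglongrightarrow> 0"
    and le: "\<And>n x. \<bar>g x - f n x\<bar> \<le> e n"
  shows "g \<in> cont_funs X"
proof -
  have "continuous_map X Met_TC.mtopology g"
  proof (rule Met_TC.continuous_map_uniform_limit[where F=sequentially and f=f])
    show "\<forall>\<^sub>F n in sequentially. continuous_map X Met_TC.mtopology (f n)"
      using f by (simp add: cont_funs_def)
    fix d :: real assume d: "0 < d"
    have "\<forall>\<^sub>F n in sequentially. e n < d" by (rule order_tendstoD(2)[OF e d])
    then show "\<forall>\<^sub>F n in sequentially. \<forall>x\<in>topspace X. g x \<in> UNIV \<and> dist (f n x) (g x) < d"
    proof eventually_elim
      case (elim n)
      have "dist (f n x) (g x) < d" for x using le[of x n] elim by (simp add: dist_real_def)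
      then show ?case by simp
    qed
  qed simp
  moreover have "g x = 0" if "x \<notin> topspace X" for x
  proof -
    have "\<bar>g x\<bar> \<le> e n" for n using le[of x n] cont_funs_outside[OF f that] by simp
    then have "\<bar>g x\<bar> \<le> 0" using LIMSEQ_le_const[OF e] by blast
    then show ?thesis by simp
  qed
  ultimately show ?thesis by (simp add: cont_funs_def)
qed

text \<open>The inner ball is taken over the same \<open>L\<close>, which openness in
  \<open>Ck X\<close> does not provide. It exists because \<open>\<bar>y - w\<bar>\<close> attains
  its maximum on \<open>L\<close>, so this maximum stays below \<open>\<rho>\<close>.\<close>

lemma uniform_nhd_shrink:
  assumes L: "compactin X L" and w: "w \<in> cont_funs X" and y: "y \<in> uniform_nhd (cont_funs X) L \<rho> w"
  obtains \<delta> where "\<delta> > 0" "uniform_nhd (cont_funs X) L \<delta> y \<subseteq> uniform_nhd (cont_funs X) L \<rho> w"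
proof -
  have yC: "y \<in> cont_funs X" and lt: "\<And>x. x \<in> L \<Longrightarrow> \<bar>y x - w x\<bar> < \<rho>"
    using y by (auto simp: uniform_nhd_def)
  have "\<exists>\<delta>>0. \<forall>x\<in>L. \<bar>y x - w x\<bar> \<le> \<rho> - \<delta>"
  proof (cases "L = {}")
    case False
    have "continuous_map X euclideanreal (\<lambda>x. \<bar>y x - w x\<bar>)"
      using yC w by (auto simp: cont_funs_def intro!: continuous_intros)
    then have "compact ((\<lambda>x. \<bar>y x - w x\<bar>) ` L)"
      using L image_compactin by force
    from compact_attains_sup[OF this] False
    obtain x where "x \<in> L" "\<And>u. u \<in> L \<Longrightarrow> \<bar>y u - w u\<bar> \<le> \<bar>y x - w x\<bar>" by auto
    then show ?thesis using lt by (intro exI[of _ "\<rho> - \<bar>y x - w x\<bar>"]) auto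
  qed (auto intro: exI[of _ 1])
  then obtain \<delta> where \<delta>: "\<delta> > 0" "\<And>x. x \<in> L \<Longrightarrow> \<bar>y x - w x\<bar> \<le> \<rho> - \<delta>" by blast
  have "uniform_nhd (cont_funs X) L \<delta> y \<subseteq> uniform_nhd (cont_funs X) L \<rho> w"
    using \<delta> by (fastforce simp: uniform_nhd_def)
  then show thesis using \<delta> that by blast
qed

text \<open>The subgradients are taken algebraically; their continuity is derived from continuity of
  \<open>f\<close> through \<open>subdifferential_locally_dominated\<close> and
  \<open>dominated_in_dual\<close>.\<close>

definition subdifferential :: "'a topology \<Rightarrow> ('a \<Rightarrow> real) set \<Rightarrow> (('a \<Rightarrow> real) \<Rightarrow> real) \<Rightarrow>
    ('a \<Rightarrow> real) \<Rightarrow> (('a \<Rightarrow> real) \<Rightarrow> real) set"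
  where "subdifferential X D f z = {\<nu>. linear_on_set (cont_funs X) \<nu> \<and>
    (\<forall>h. h \<notin> cont_funs X \<longrightarrow> \<nu> h = 0) \<and> (\<forall>y\<in>D. f z + \<nu> (y - z) \<le> f y)}"

lemma subdifferential_nonempty:
  assumes D: "openin (Ck X) D" and f: "convex_on D f" and z: "z \<in> D"
  shows "subdifferential X D f z \<noteq> {}"
proof -
  have DC: "D \<subseteq> cont_funs X" using openin_subset[OF D] by (simp add: topspace_Ck)
  obtain L r where L: "compactin X L" "r > 0" "uniform_nhd (cont_funs X) L r z \<subseteq> D"
    using D z unfolding openin_Ck by blast
  have abs: "\<exists>t>0. z + t *\<^sub>R h \<in> D" if h: "h \<in> cont_funs X" for h
  proof -
    obtain M where M: "M > 0" "\<And>x. x \<in> L \<Longrightarrow> \<bar>h x\<bar> < M"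
      using cont_fun_bounded[OF h L(1)] by blast
    have "z + (r / M) *\<^sub>R h \<in> cont_funs X"
      using z DC h by (intro cont_funs_add cont_funs_scaleR) auto
    moreover have "\<bar>(z + (r / M) *\<^sub>R h) x - z x\<bar> < r" if "x \<in> L" for x
      using M(1) M(2)[OF that] L(2) by (simp add: abs_mult field_simps)
    ultimately have "z + (r / M) *\<^sub>R h \<in> uniform_nhd (cont_funs X) L r z"
      unfolding uniform_nhd_def by blast
    then show ?thesis using L M by (intro exI[of _ "r / M"]) auto
  qed
  obtain g where g: "linear_on_set (cont_funs X) g" "\<And>y. y \<in> D \<Longrightarrow> f z + g (y - z) \<le> f y"
    "\<And>y. y \<notin> cont_funs X \<Longrightarrow> g y = 0"
    using subgradient_exists[OF subspace_cont_funs DC z f abs] by metis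
  then have "g \<in> subdifferential X D f z" by (simp add: subdifferential_def)
  then show ?thesis by blast
qed

text \<open>If \<open>f\<close> stays within 1 of \<open>f z\<close> on a ball of radius
  \<open>2 r\<close>, then for \<open>w\<close> and \<open>h\<close> of size \<open>r\<close> the
  subgradient inequality gives \<open>\<nu> h \<le> f (w + h) - f w \<le> 2\<close>. Hence one
  \<open>L\<close> and one \<open>C\<close> serve all \<open>w\<close> near
  \<open>z\<close>.\<close>

lemma subdifferential_locally_dominated:
  assumes D: "openin (Ck X) D" and cont: "continuous_map (subtopology (Ck X) D) euclideanreal f"
    and z: "z \<in> D"
  obtains L r C where "compactin X L" "r > 0" "uniform_nhd (cont_funs X) L r z \<subseteq> D"
    "\<And>w \<nu>. w \<in> uniform_nhd (cont_funs X) L r z \<Longrightarrow> \<nu> \<in> subdifferential X D f w \<Longrightarrow> dominated X L C \<nu>"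
proof -
  have DC: "D \<subseteq> cont_funs X" using openin_subset[OF D] by (simp add: topspace_Ck)
  have "openin (subtopology (Ck X) D) {y \<in> topspace (subtopology (Ck X) D). f y \<in> ball (f z) 1}"
    by (rule openin_continuous_map_preimage[OF cont]) simp
  moreover have "{y \<in> topspace (subtopology (Ck X) D). f y \<in> ball (f z) 1} = {y \<in> D. f y \<in> ball (f z) 1}"
    using DC by (auto simp: topspace_Ck)
  ultimately have "openin (Ck X) {y \<in> D. f y \<in> ball (f z) 1}"
    using openin_trans_full D by metis
  moreover have "z \<in> {y \<in> D. f y \<in> ball (f z) 1}" using z by simp
  ultimately obtain L r0 where L: "compactin X L" "r0 > 0"
    "uniform_nhd (cont_funs X) L r0 z \<subseteq> {y \<in> D. f y \<in> ball (f z) 1}"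
    unfolding openin_Ck by blast
  define r where "r = r0 / 2"
  have r: "r > 0" "r0 = 2 * r" using L(2) by (auto simp: r_def)
  have near: "y \<in> D \<and> \<bar>f y - f z\<bar> < 1" if "y \<in> uniform_nhd (cont_funs X) L (2 * r) z" for y
    using subsetD[OF L(3)] that r(2) by (auto simp: dist_real_def abs_minus_commute)
  have sub: "uniform_nhd (cont_funs X) L r z \<subseteq> uniform_nhd (cont_funs X) L (2 * r) z"
    using r(1) by (fastforce simp: uniform_nhd_def)
  have "dominated X L (2 * 2 / r) \<nu>"
    if w: "w \<in> uniform_nhd (cont_funs X) L r z" and \<nu>: "\<nu> \<in> subdifferential X D f w" for w \<nu>
  proof (rule dominatedI[OF _ r(1)])
    show "linear_on_set (cont_funs X) \<nu>" using \<nu> by (simp add: subdifferential_def)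
    fix h assume h: "h \<in> cont_funs X" "\<And>x. x \<in> L \<Longrightarrow> \<bar>h x\<bar> < r"
    have wC: "w \<in> cont_funs X" and wz: "\<And>x. x \<in> L \<Longrightarrow> \<bar>w x - z x\<bar> < r"
      using w by (auto simp: uniform_nhd_def)
    have "\<bar>(w + h) x - z x\<bar> < 2 * r" if "x \<in> L" for x
      using h(2)[OF that] wz[OF that] by simp
    then have "w + h \<in> uniform_nhd (cont_funs X) L (2 * r) z"
      using cont_funs_add[OF wC h(1)] by (simp add: uniform_nhd_def)
    then have wh: "w + h \<in> D" "\<bar>f (w + h) - f z\<bar> < 1" using near by auto
    have "f w + \<nu> (w + h - w) \<le> f (w + h)" using \<nu> wh(1) unfolding subdifferential_def by blast
    moreover have "\<bar>f w - f z\<bar> < 1" using near sub w by blast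
    ultimately show "\<nu> h \<le> 2" using wh(2) by simp
  qed
  then show thesis using that[OF L(1) r(1)] near sub by blast
qed

text \<open>\<open>G n\<close> consists of the points near which all subgradients differ by at most
  \<open>1 / Suc n\<close>. At a point of every \<open>G n\<close>, subgradients at neighbouring
  points approach the one at \<open>z\<close> uniformly on bounded sets, and this is Frechet
  differentiability of a convex function.\<close>

theorem scattered_imp_asplund:
  fixes X :: "'a topology"
  assumes X: "completely_regular_space X"
    and sc: "\<And>K. compactin X K \<Longrightarrow> scattered_space (subtopology X K)"
  shows "asplund_space (Ck X)"
  unfolding asplund_space_def
proof (intro conjI locally_convex_space_Ck allI impI; elim conjE)
  fix D and f :: "('a \<Rightarrow> real) \<Rightarrow> real"
  assume D: "openin (Ck X) D" and Dne: "D \<noteq> {}"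
    and cont: "continuous_map (subtopology (Ck X) D) euclideanreal f" and f: "convex_on D f"
  have DC: "D \<subseteq> cont_funs X" using openin_subset[OF D] by (simp add: topspace_Ck)
  let ?N = "uniform_nhd (cont_funs X)"
  let ?S = "subdifferential X D f"
  define osc where "osc W e \<longleftrightarrow> (\<forall>y\<in>W. \<forall>y'\<in>W. \<forall>\<nu>\<in>?S y. \<forall>\<nu>'\<in>?S y'. \<forall>k\<in>cont_funs X.
    (\<forall>x. \<bar>k x\<bar> \<le> 1) \<longrightarrow> \<bar>\<nu> k - \<nu>' k\<bar> \<le> e)" for W e
  \<comment> \<open>Testing \<open>osc\<close> with globally bounded \<open>k\<close> keeps \<open>G n\<close> independent of any compact set; this
    suffices because truncating a function at its supremum over a compact set keeps its values there.\<close>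
  define G where "G n = \<Union>{W. openin (Ck X) W \<and> W \<subseteq> D \<and> osc W (1 / Suc n)}" for n :: nat
  have G_open: "openin (Ck X) (G n)" for n unfolding G_def by (intro openin_Union) auto
  have GD: "G n \<subseteq> D" for n by (auto simp: G_def)
  have dense: "\<exists>z\<in>W0. \<forall>n. z \<in> G n" if W0: "openin (Ck X) W0" "z0 \<in> W0" "z0 \<in> D" for W0 z0
  proof -
    obtain L0 r0 C where L: "compactin X L0" "r0 > 0" "?N L0 r0 z0 \<subseteq> D"
      and dom: "\<And>w \<nu>. w \<in> ?N L0 r0 z0 \<Longrightarrow> \<nu> \<in> ?S w \<Longrightarrow> dominated X L0 C \<nu>"
      using subdifferential_locally_dominated[OF D cont W0(3)] by blast
    obtain L1 r1 where L1: "compactin X L1" "r1 > 0" "?N L1 r1 z0 \<subseteq> W0"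
      using W0(1,2) unfolding openin_Ck by blast
    \<comment> \<open>\<open>L0\<close> controls the subgradients near \<open>z0\<close>, and
      \<open>L1\<close> keeps the balls inside \<open>W0\<close>.\<close>
    define L where "L = L0 \<union> L1"
    define r where "r = min r0 r1"
    have cL: "compactin X L" and r: "r > 0" using L(1,2) L1(1,2) by (auto simp: L_def r_def compactin_Un)
    have N0: "?N L r z0 \<subseteq> ?N L0 r0 z0" "?N L r z0 \<subseteq> ?N L1 r1 z0"
      by (auto simp: uniform_nhd_def L_def r_def)
    have ND: "?N L r z0 \<subseteq> D" using N0 L by blast
    have domL: "dominated X L C \<nu>" if "w \<in> ?N L r z0" "\<nu> \<in> ?S w" for w \<nu>
      using dom[of w \<nu>] that N0(1) unfolding dominated_def L_def by blast
    have z0C: "z0 \<in> cont_funs X" using W0(3) DC by blast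
    \<comment> \<open>The parameter \<open>B\<close> confines the balls over which subgradients are
      collected, so that a refinement yields a ball inside a prescribed one.\<close>
    define \<A> where "\<A> B = {\<Union>y\<in>?N L \<rho> w. ?S y | w \<rho>. \<rho> > 0 \<and> w \<in> cont_funs X \<and> ?N L \<rho> w \<subseteq> B}" for B
    have self: "w \<in> ?N L \<rho> w" if "\<rho> > 0" "w \<in> cont_funs X" for w \<rho>
      using that by (simp add: uniform_nhd_def)
    have \<A>dom: "dominated X L C \<nu>" if B: "B \<subseteq> ?N L r z0" and "A \<in> \<A> B" "\<nu> \<in> A" for A B \<nu>
      using that domL unfolding \<A>_def by blast
    have \<A>ne: "A \<noteq> {}" if B: "B \<subseteq> ?N L r z0" and A: "A \<in> \<A> B" for A B
    proof -
      obtain w \<rho> where w: "A = (\<Union>y\<in>?N L \<rho> w. ?S y)" "\<rho> > 0" "w \<in> cont_funs X" "?N L \<rho> w \<subseteq> B"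
        using A by (auto simp: \<A>_def)
      then have "w \<in> D" using self ND B by blast
      then show ?thesis using subdifferential_nonempty[OF D f] self[OF w(2,3)] w(1) by blast
    qed
    have slice: "\<exists>A'\<in>\<A> B. A' \<subseteq> A \<and> (\<forall>\<nu>\<in>A'. c < \<nu> h)"
      if B: "B \<subseteq> ?N L r z0" and A: "A \<in> \<A> B" and \<mu>: "\<mu> \<in> A" and h: "h \<in> cont_funs X" and c: "c < \<mu> h" for A B \<mu> h c
    proof -
      obtain w \<rho> where w: "A = (\<Union>y\<in>?N L \<rho> w. ?S y)" "\<rho> > 0" "w \<in> cont_funs X" "?N L \<rho> w \<subseteq> B"
        using A by (auto simp: \<A>_def)
      obtain y where y: "y \<in> ?N L \<rho> w" "\<mu> \<in> ?S y" using \<mu> w(1) by blast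
      have yC: "y \<in> cont_funs X" using y by (simp add: uniform_nhd_def)
      have yD: "y \<in> D" using y w(4) ND B by blast
      have dm: "dominated X L C \<mu>" using \<A>dom[OF B A \<mu>] .
      have C0: "0 \<le> C" using dominated_nonneg[OF dm] .
      obtain \<delta> where \<delta>: "\<delta> > 0" "?N L \<delta> y \<subseteq> ?N L \<rho> w"
        using uniform_nhd_shrink[OF cL w(3) y(1)] by blast
      obtain b where b: "b > 0" "\<And>x. x \<in> L \<Longrightarrow> \<bar>h x\<bar> < b" using cont_fun_bounded[OF h cL] by blast
      \<comment> \<open>Monotonicity of the subdifferential: moving from \<open>y\<close> in
        direction \<open>h\<close> cannot lower the value at \<open>h\<close>. This \<open>t\<close>
        moves by at most \<open>\<delta> / 2\<close> on \<open>L\<close>, staying inside the ball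
        around \<open>y\<close>.\<close>
      define t where "t = \<delta> / (2 * b)"
      have t: "t > 0" "t * b = \<delta> / 2" using \<delta> b by (auto simp: t_def)
      define y1 where "y1 = y + t *\<^sub>R h"
      have y1C: "y1 \<in> cont_funs X" using yC h by (simp add: y1_def cont_funs_add cont_funs_scaleR)
      \<comment> \<open>A whole ball around \<open>y1\<close> is needed. A deviation of size
        \<open>\<eta>\<close> changes each of \<open>\<mu>\<close> and \<open>\<nu>\<close> by at
        most \<open>C \<eta>\<close>, and this choice keeps the sum below
        \<open>t (\<mu> h - c)\<close>.\<close>
      define \<eta> where "\<eta> = min (\<delta> / 2) (t * (\<mu> h - c) / (2 * C + 1))"
      have \<eta>: "\<eta> > 0" "\<eta> \<le> \<delta> / 2" using \<delta> t c C0 by (auto simp: \<eta>_def intro!: divide_pos_pos mult_pos_pos)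
      have \<eta>2: "2 * C * \<eta> < t * (\<mu> h - c)"
      proof -
        have "(2 * C + 1) * \<eta> \<le> t * (\<mu> h - c)"
          using C0 pos_le_divide_eq[of "2 * C + 1" \<eta> "t * (\<mu> h - c)"] by (simp add: \<eta>_def mult.commute)
        moreover have "2 * C * \<eta> < (2 * C + 1) * \<eta>" using \<eta>(1) by (simp add: algebra_simps)
        ultimately show ?thesis by linarith
      qed
      have sub: "?N L \<eta> y1 \<subseteq> ?N L \<delta> y"
      proof
        fix v assume v: "v \<in> ?N L \<eta> y1"
        have "\<bar>v x - y x\<bar> < \<delta>" if x: "x \<in> L" for x
        proof -
          have "\<bar>v x - y1 x\<bar> < \<eta>" using v x by (simp add: uniform_nhd_def)
          moreover have "\<bar>y1 x - y x\<bar> \<le> \<delta> / 2"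
          proof -
            have "t * \<bar>h x\<bar> \<le> t * b" using t b(2)[OF x] by (intro mult_left_mono) auto
            then show ?thesis using t by (simp add: y1_def abs_mult)
          qed
          ultimately show ?thesis using \<eta>(2) by linarith
        qed
        then show "v \<in> ?N L \<delta> y" using v by (simp add: uniform_nhd_def)
      qed
      let ?A = "\<Union>y\<in>?N L \<eta> y1. ?S y"
      have "?A \<in> \<A> B" using \<eta>(1) y1C sub \<delta>(2) w(4) unfolding \<A>_def by blast
      moreover have "?A \<subseteq> A" using sub \<delta>(2) w(1) by blast
      moreover have "c < \<nu> h" if \<nu>: "\<nu> \<in> ?A" for \<nu>
      proof -
        obtain y' where y': "y' \<in> ?N L \<eta> y1" "\<nu> \<in> ?S y'" using \<nu> by blast
        have y'C: "y' \<in> cont_funs X" using y' by (simp add: uniform_nhd_def)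
        have y'N: "y' \<in> ?N L r z0" using y'(1) sub \<delta>(2) w(4) B by blast
        then have y'D: "y' \<in> D" using ND by blast
        have dn: "dominated X L C \<nu>" using domL[OF y'N y'(2)] .
        have "f y' + \<nu> (y - y') \<le> f y" "f y + \<mu> (y' - y) \<le> f y'"
          using y' y yD y'D by (auto simp: subdifferential_def)
        moreover have "\<nu> (y - y') = - \<nu> (y' - y)"
          using dominatedD(2)[OF dn] yC y'C by simp
        ultimately have mono: "\<mu> (y' - y) \<le> \<nu> (y' - y)" by linarith
        define d where "d = y' - y1"
        have dC: "d \<in> cont_funs X" using y'C y1C by (simp add: d_def cont_funs_diff)
        have eq: "y' - y = t *\<^sub>R h + d" by (simp add: d_def y1_def fun_eq_iff)
        have db: "\<bar>d x\<bar> \<le> \<eta>" if "x \<in> L" for x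
          using y'(1) that by (auto simp: uniform_nhd_def d_def intro: less_imp_le)
        have "\<bar>\<mu> d\<bar> \<le> C * \<eta>" "\<bar>\<nu> d\<bar> \<le> C * \<eta>"
          using \<eta>(1) db dominatedD(5)[OF dm dC, of \<eta>] dominatedD(5)[OF dn dC, of \<eta>] by auto
        moreover have "\<mu> (t *\<^sub>R h + d) = t * \<mu> h + \<mu> d" "\<nu> (t *\<^sub>R h + d) = t * \<nu> h + \<nu> d"
          using h dC dominatedD(1,4)[OF dm] dominatedD(1,4)[OF dn] by (simp_all add: cont_funs_scaleR)
        ultimately have "t * \<mu> h - t * \<nu> h \<le> 2 * C * \<eta>" using mono unfolding eq by linarith
        then have "t * \<mu> h - t * \<nu> h < t * (\<mu> h - c)" using \<eta>2 by linarith
        then have "t * c < t * \<nu> h" by (simp add: algebra_simps)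
        then show ?thesis using t(1) by simp
      qed
      ultimately show ?thesis by blast
    qed
    \<comment> \<open>One stage of the nested ball construction. The centre moves by at most
      \<open>\<rho> / 4\<close> at every point and the radius at least halves, so the limit remains
      in each ball.\<close>
    have refine: "\<exists>w' \<rho>'. \<rho>' > 0 \<and> \<rho>' \<le> \<rho> / 2 \<and> w' \<in> cont_funs X \<and> ?N L \<rho>' w' \<subseteq> ?N L r z0 \<and>
        (\<forall>x. \<bar>w' x - w x\<bar> \<le> \<rho> / 4) \<and> osc (?N L \<rho>' w') e"
      if w: "\<rho> > 0" "w \<in> cont_funs X" "?N L \<rho> w \<subseteq> ?N L r z0" and e: "e > 0" for w \<rho> e
    proof -
      let ?B = "?N L (\<rho> / 4) w"
      have "?B \<subseteq> ?N L \<rho> w" using w(1) by (fastforce simp: uniform_nhd_def)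
      then have B: "?B \<subseteq> ?N L r z0" using w(3) by blast
      have BA: "(\<Union>y\<in>?B. ?S y) \<in> \<A> ?B" using w unfolding \<A>_def
        by (intro CollectI exI[of _ w] exI[of _ "\<rho> / 4"]) auto
      have "\<exists>A'\<in>\<A> ?B. A' \<subseteq> (\<Union>y\<in>?B. ?S y) \<and> (\<forall>\<nu>\<in>A'. \<forall>\<nu>'\<in>A'. \<forall>k\<in>cont_funs X.
          (\<forall>x\<in>L. \<bar>k x\<bar> \<le> 1) \<longrightarrow> \<bar>\<nu> k - \<nu>' k\<bar> \<le> e)"
        by (rule small_oscillation_on_scattered[OF X cL sc[OF cL] \<A>dom[OF B] \<A>ne[OF B] slice[OF B] BA e])
      then obtain A' where A': "A' \<in> \<A> ?B"
        and A'osc: "\<forall>\<nu>\<in>A'. \<forall>\<nu>'\<in>A'. \<forall>k\<in>cont_funs X. (\<forall>x\<in>L. \<bar>k x\<bar> \<le> 1) \<longrightarrow> \<bar>\<nu> k - \<nu>' k\<bar> \<le> e"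
        by blast
      obtain w1 \<rho>1 where w1: "A' = (\<Union>y\<in>?N L \<rho>1 w1. ?S y)" "\<rho>1 > 0" "w1 \<in> cont_funs X" "?N L \<rho>1 w1 \<subseteq> ?B"
        using A' by (auto simp: \<A>_def)
      have near: "\<bar>w1 x - w x\<bar> < \<rho> / 4" if "x \<in> L" for x
        using self[OF w1(2,3)] w1(4) that by (auto simp: uniform_nhd_def)
      \<comment> \<open>\<open>w'\<close> agrees with \<open>w1\<close> on \<open>L\<close>, so
        balls over \<open>L\<close> around the two coincide, while \<open>w'\<close> is close to
        \<open>w\<close> on all of \<open>X\<close>.\<close>
      define w' where "w' = w + truncation (\<rho> / 4) (w1 - w)"
      have w'C: "w' \<in> cont_funs X"
        unfolding w'_def using w w1(3) by (intro cont_funs_add cont_funs_truncation cont_funs_diff) auto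
      have w'x: "w' x = w x + max (- (\<rho> / 4)) (min (\<rho> / 4) (w1 x - w x))" for x
        by (simp add: w'_def)
      have w'L: "w' x = w1 x" if "x \<in> L" for x
        using truncation_real(2)[OF less_imp_le[OF near[OF that]]] unfolding w'x by simp
      have w'w: "\<bar>w' x - w x\<bar> \<le> \<rho> / 4" for x
        using w(1) truncation_real(1)[of "\<rho> / 4" "w1 x - w x"] unfolding w'x by simp
      have sub: "?N L (min \<rho>1 (\<rho> / 2)) w' \<subseteq> ?N L \<rho>1 w1" using w'L by (auto simp: uniform_nhd_def)
      have "osc (?N L (min \<rho>1 (\<rho> / 2)) w') e"
        unfolding osc_def
      proof (intro ballI impI)
        fix y y' \<nu> \<nu>' k
        assume "y \<in> ?N L (min \<rho>1 (\<rho> / 2)) w'" "y' \<in> ?N L (min \<rho>1 (\<rho> / 2)) w'" "\<nu> \<in> ?S y" "\<nu>' \<in> ?S y'"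
          and k: "k \<in> cont_funs X" "\<forall>x. \<bar>k x\<bar> \<le> 1"
        then have "\<nu> \<in> A'" "\<nu>' \<in> A'" using sub w1(1) by blast+
        then show "\<bar>\<nu> k - \<nu>' k\<bar> \<le> e" using A'osc k by blast
      qed
      moreover have "?N L (min \<rho>1 (\<rho> / 2)) w' \<subseteq> ?N L r z0" using sub w1(4) B by blast
      ultimately show ?thesis using w(1) w1(2) w'C w'w
        by (intro exI[of _ w'] exI[of _ "min \<rho>1 (\<rho> / 2)"]) auto
    qed
    \<comment> \<open>\<open>C\<^sub>k(X)\<close> need not be a Baire space. All balls are taken over the same compact \<open>L\<close>, and the
      centres are truncated so that they converge uniformly on \<open>X\<close>.\<close>
    define P where "P n p \<longleftrightarrow> snd p > 0 \<and> fst p \<in> cont_funs X \<and> ?N L (snd p) (fst p) \<subseteq> ?N L r z0"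
      for n :: nat and p :: "('a \<Rightarrow> real) \<times> real"
    define Q where "Q n p q \<longleftrightarrow> snd q \<le> snd p / 2 \<and> (\<forall>x. \<bar>fst q x - fst p x\<bar> \<le> snd p / 4) \<and>
      osc (?N L (snd q) (fst q)) (1 / Suc n)" for n :: nat and p q :: "('a \<Rightarrow> real) \<times> real"
    have "\<exists>p. \<forall>n. P n (p n) \<and> Q n (p n) (p (Suc n))"
    proof (rule dependent_nat_choice)
      show "\<exists>p. P 0 p" using r z0C by (intro exI[of _ "(z0, r)"]) (simp add: P_def)
      fix p n assume "P n p"
      then have "snd p > 0" "fst p \<in> cont_funs X" "?N L (snd p) (fst p) \<subseteq> ?N L r z0"
        by (auto simp: P_def)
      from refine[OF this, of "1 / Suc n"] obtain w' \<rho>' where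
        "\<rho>' > 0 \<and> \<rho>' \<le> snd p / 2 \<and> w' \<in> cont_funs X \<and> ?N L \<rho>' w' \<subseteq> ?N L r z0 \<and>
        (\<forall>x. \<bar>w' x - fst p x\<bar> \<le> snd p / 4) \<and> osc (?N L \<rho>' w') (1 / Suc n)" by auto
      then show "\<exists>q. P (Suc n) q \<and> Q n p q"
        by (intro exI[of _ "(w', \<rho>')"]) (simp add: P_def Q_def)
    qed
    then obtain p where p: "\<And>n. P n (p n)" "\<And>n. Q n (p n) (p (Suc n))" by blast
    define w where "w n = fst (p n)" for n
    define \<rho> where "\<rho> n = snd (p n)" for n
    have \<rho>0: "\<rho> n > 0" and wC: "w n \<in> cont_funs X" and wN: "?N L (\<rho> n) (w n) \<subseteq> ?N L r z0" for n
      using p(1)[of n] by (auto simp: P_def w_def \<rho>_def)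
    have \<rho>S: "\<rho> (Suc n) \<le> \<rho> n / 2" and wS: "\<bar>w (Suc n) x - w n x\<bar> \<le> \<rho> n / 4"
      and oscS: "osc (?N L (\<rho> (Suc n)) (w (Suc n))) (1 / Suc n)" for n x
      using p(2)[of n] by (auto simp: Q_def w_def \<rho>_def)
    have \<rho>n: "\<rho> n \<le> \<rho> 0 * (1/2) ^ n" for n
    proof (induction n)
      case (Suc n)
      then show ?case using \<rho>S[of n] by simp
    qed simp
    have "(\<lambda>n. \<rho> 0 * (1/2) ^ n) \<longlonglongrightarrow> 0"
      by (intro tendsto_mult_right_zero LIMSEQ_power_zero) simp
    then have \<rho>lim: "\<rho> \<longlonglongrightarrow> 0"
      by (rule tendsto_sandwich[OF _ _ tendsto_const, rotated 2]) (use \<rho>n \<rho>0 in \<open>auto intro!: always_eventually less_imp_le\<close>)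
    \<comment> \<open>Halving of the radii gives
      \<open>\<rho> n / 4 \<le> \<rho> n / 2 - \<rho> (Suc n) / 2\<close>, so the displacements
      telescope. The limit is then within \<open>\<rho> n / 2\<close> of \<open>w n\<close>,
      strictly inside the ball.\<close>
    have wm: "\<bar>w (n + m) x - w n x\<bar> \<le> \<rho> n / 2 - \<rho> (n + m) / 2" for n m x
    proof (induction m)
      case (Suc m)
      then show ?case using \<rho>S[of "n + m"] wS[of "n + m" x] unfolding add_Suc_right by linarith
    qed simp
    have wm': "\<bar>w m x - w n x\<bar> \<le> \<rho> n / 2" if "n \<le> m" for n m x
      using wm[of n "m - n" x] \<rho>0[of m] that by simp
    have "Cauchy (\<lambda>n. w n x)" for x
    proof (rule metric_CauchyI)
      fix e :: real assume "e > 0"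
      then obtain N where N: "\<rho> N < e"
        using order_tendstoD(2)[OF \<rho>lim, of e] by (auto simp: eventually_sequentially)
      show "\<exists>M. \<forall>m\<ge>M. \<forall>n\<ge>M. dist (w m x) (w n x) < e"
      proof (intro exI[of _ N] allI impI)
        fix m n assume mn: "N \<le> m" "N \<le> n"
        show "dist (w m x) (w n x) < e"
          using wm'[OF mn(1), of x] wm'[OF mn(2), of x] N unfolding dist_real_def by linarith
      qed
    qed
    then have conv: "(\<lambda>n. w n x) \<longlonglongrightarrow> lim (\<lambda>n. w n x)" for x
      by (simp add: Cauchy_convergent_iff convergent_LIMSEQ_iff)
    define z where "z x = lim (\<lambda>n. w n x)" for x
    have zw: "\<bar>z x - w n x\<bar> \<le> \<rho> n / 2" for x n
    proof -
      have "(\<lambda>m. \<bar>w m x - w n x\<bar>) \<longlonglongrightarrow> \<bar>z x - w n x\<bar>"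
        unfolding z_def by (intro tendsto_intros conv)
      then show ?thesis using wm'[of n] by (intro LIMSEQ_le_const2) auto
    qed
    have "(\<lambda>n. \<rho> n / 2) \<longlonglongrightarrow> 0" using tendsto_divide[OF \<rho>lim tendsto_const, of 2] by simp
    then have zC: "z \<in> cont_funs X" by (rule cont_funs_uniform_limit[OF wC _ zw])
    have zN: "z \<in> ?N L (\<rho> n) (w n)" for n
    proof -
      have "\<bar>z x - w n x\<bar> < \<rho> n" for x using zw[of x n] \<rho>0[of n] by linarith
      then show ?thesis using zC by (simp add: uniform_nhd_def)
    qed
    have "z \<in> G n" for n
    proof -
      let ?W = "?N L (\<rho> (Suc n)) (w (Suc n))"
      have "openin (Ck X) ?W" by (rule openin_uniform_nhd[OF wC cL])
      moreover have "?W \<subseteq> D" using wN ND by blast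
      ultimately show ?thesis using zN[of "Suc n"] oscS unfolding G_def by blast
    qed
    moreover have "z \<in> W0" using zN[of 0] wN N0(2) L1(3) by blast
    ultimately show ?thesis by blast
  qed
  let ?G = "\<Inter>n. G n"
  have "gdelta_in (subtopology (Ck X) D) ?G"
  proof (rule gdelta_in_Inter)
    fix T assume "T \<in> range G"
    then obtain n where "T = G n" by blast
    then show "gdelta_in (subtopology (Ck X) D) T"
      using G_open GD D by (auto intro!: open_imp_gdelta_in simp: openin_open_subtopology)
  qed auto
  moreover have "subtopology (Ck X) D closure_of ?G = D"
  proof
    show "subtopology (Ck X) D closure_of ?G \<subseteq> D"
      using closure_of_subset_topspace[of "subtopology (Ck X) D"] by simp
    show "D \<subseteq> subtopology (Ck X) D closure_of ?G"
    proof
      fix z0 assume z0: "z0 \<in> D"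
      show "z0 \<in> subtopology (Ck X) D closure_of ?G"
        unfolding in_closure_of
      proof (intro conjI allI impI; (elim conjE)?)
        show "z0 \<in> topspace (subtopology (Ck X) D)" using z0 DC by (auto simp: topspace_Ck)
        fix T assume T: "z0 \<in> T" "openin (subtopology (Ck X) D) T"
        have "openin (Ck X) T" using T(2) D by (rule openin_trans_full)
        from dense[OF this T(1) z0] obtain y where "y \<in> T" "\<forall>n. y \<in> G n" by blast
        then show "\<exists>y. y \<in> ?G \<and> y \<in> T" by blast
      qed
    qed
  qed
  moreover have "frechet_differentiable_at (Ck X) f z" if z: "z \<in> ?G" for z
  proof -
    have zG: "z \<in> G n" for n using z by blast
    have zD: "z \<in> D" using zG[of 0] GD by blast
    then have zC: "z \<in> cont_funs X" using DC by blast
    obtain L r C where L: "compactin X L" "r > 0" "?N L r z \<subseteq> D"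
      and dom: "\<And>w \<nu>. w \<in> ?N L r z \<Longrightarrow> \<nu> \<in> ?S w \<Longrightarrow> dominated X L C \<nu>"
      using subdifferential_locally_dominated[OF D cont zD] by blast
    have zN: "z \<in> ?N L r z" using zC L(2) by (simp add: uniform_nhd_def)
    obtain \<xi> where \<xi>: "\<xi> \<in> ?S z" using subdifferential_nonempty[OF D f zD] by blast
    have d\<xi>: "dominated X L C \<xi>" by (rule dom[OF zN \<xi>])
    have "\<xi> \<in> dual_space (Ck X)"
      by (rule dominated_in_dual[OF L(1) d\<xi>]) (use \<xi> in \<open>auto simp: subdifferential_def\<close>)
    moreover have "(\<lambda>t::real. SUP h\<in>M. f (z + t *\<^sub>R h) - f z - \<xi> (t *\<^sub>R h)) \<in> o[at 0](\<lambda>t. t)"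
      if M: "lcs_bounded (Ck X) M" "M \<noteq> {}" for M
    proof (rule landau_o.smallI)
      fix e :: real assume e: "e > 0"
      have MC: "M \<subseteq> cont_funs X" using M(1) by (simp add: lcs_bounded_def topspace_Ck)
      obtain c where c: "c > 0" "\<And>h x. h \<in> M \<Longrightarrow> x \<in> L \<Longrightarrow> \<bar>h x\<bar> \<le> c"
        using lcs_bounded_CkD[OF M(1) L(1)] by blast
      obtain n :: nat where n: "c / Suc n < e"
      proof -
        obtain n where "c / e < real n" using reals_Archimedean2 by blast
        then have "c / e < real (Suc n)" by simp
        then have "c < real (Suc n) * e" using e by (simp only: pos_divide_less_eq)
        then show thesis using that[of n] by (simp add: pos_divide_less_eq mult.commute)
      qed
      obtain W where W: "openin (Ck X) W" "W \<subseteq> D" "osc W (1 / Suc n)" "z \<in> W"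
        using zG[of n] by (auto simp: G_def)
      have "openin (Ck X) (W \<inter> ?N L r z)" using W(1) openin_uniform_nhd[OF zC L(1)] by blast
      moreover have "z \<in> W \<inter> ?N L r z" using W zN by blast
      ultimately obtain L' r' where L': "compactin X L'" "r' > 0" "?N L' r' z \<subseteq> W \<inter> ?N L r z"
        unfolding openin_Ck by blast
      obtain c' where c': "c' > 0" "\<And>h x. h \<in> M \<Longrightarrow> x \<in> L' \<Longrightarrow> \<bar>h x\<bar> \<le> c'"
        using lcs_bounded_CkD[OF M(1) L'(1)] by blast
      \<comment> \<open>The lower estimate uses the subgradient at \<open>z\<close>, the upper one a
        subgradient \<open>\<nu>\<close> at \<open>z + t h\<close>. The error is squeezed between 0
        and \<open>t (\<nu> h - \<xi> h)\<close>.\<close>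
      have bound: "0 \<le> f (z + t *\<^sub>R h) - f z - \<xi> (t *\<^sub>R h)" "f (z + t *\<^sub>R h) - f z - \<xi> (t *\<^sub>R h) \<le> e * \<bar>t\<bar>"
        if t: "\<bar>t\<bar> < r' / c'" and h: "h \<in> M" for t h
      proof -
        have hC: "h \<in> cont_funs X" using h MC by blast
        have thC: "t *\<^sub>R h \<in> cont_funs X" by (rule cont_funs_scaleR[OF hC])
        have ztC: "z + t *\<^sub>R h \<in> cont_funs X" by (rule cont_funs_add[OF zC thC])
        have "\<bar>(z + t *\<^sub>R h) x - z x\<bar> < r'" if x: "x \<in> L'" for x
        proof -
          have "\<bar>t\<bar> * \<bar>h x\<bar> \<le> \<bar>t\<bar> * c'" using c'(2)[OF h x] by (intro mult_left_mono) auto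
          also have "\<dots> < r'" using t c'(1) by (simp add: field_simps)
          finally show ?thesis by (simp add: abs_mult)
        qed
        then have "z + t *\<^sub>R h \<in> ?N L' r' z" using ztC by (simp add: uniform_nhd_def)
        then have zt: "z + t *\<^sub>R h \<in> W" "z + t *\<^sub>R h \<in> ?N L r z" using L'(3) by auto
        then have ztD: "z + t *\<^sub>R h \<in> D" using W(2) by blast
        obtain \<nu> where \<nu>: "\<nu> \<in> ?S (z + t *\<^sub>R h)" using subdifferential_nonempty[OF D f ztD] by blast
        have d\<nu>: "dominated X L C \<nu>" by (rule dom[OF zt(2) \<nu>])
        have "f z + \<xi> (z + t *\<^sub>R h - z) \<le> f (z + t *\<^sub>R h)"
          using \<xi> ztD unfolding subdifferential_def by blast
        then show "0 \<le> f (z + t *\<^sub>R h) - f z - \<xi> (t *\<^sub>R h)" by simp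
        have "f (z + t *\<^sub>R h) + \<nu> (z - (z + t *\<^sub>R h)) \<le> f z"
          using \<nu> zD unfolding subdifferential_def by blast
        moreover have "\<nu> (z - (z + t *\<^sub>R h)) = - \<nu> (t *\<^sub>R h)"
          using dominatedD(3)[OF d\<nu> thC] by simp
        ultimately have "f (z + t *\<^sub>R h) - f z \<le> \<nu> (t *\<^sub>R h)" by linarith
        then have 1: "f (z + t *\<^sub>R h) - f z - \<xi> (t *\<^sub>R h) \<le> t * (\<nu> h - \<xi> h)"
          using dominatedD(4)[OF d\<nu> hC] dominatedD(4)[OF d\<xi> hC] by (simp add: algebra_simps)
        \<comment> \<open>\<open>osc\<close> tests only functions bounded by 1 on all of
          \<open>X\<close>. Truncating \<open>h\<close> at its bound over \<open>L\<close> is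
          invisible to \<open>\<nu>\<close> and \<open>\<xi>\<close>, which depend only on values on
          \<open>L\<close>.\<close>
        define k where "k = (1 / c) *\<^sub>R truncation c h"
        have clC: "truncation c h \<in> cont_funs X" using hC c(1) by (simp add: cont_funs_truncation)
        have kC: "k \<in> cont_funs X" unfolding k_def by (rule cont_funs_scaleR[OF clC])
        have k1: "\<bar>k x\<bar> \<le> 1" for x
        proof -
          have "\<bar>truncation c h x\<bar> \<le> c" using c(1) by auto
          then show ?thesis unfolding k_def using c(1) by (simp add: abs_mult del: abs_le_iff)
        qed
        have agree: "\<mu> h = c * \<mu> k" if \<mu>: "dominated X L C \<mu>" for \<mu>
        proof -
          have "\<mu> h = \<mu> (truncation c h)"
          proof (rule dominated_agree[OF \<mu> hC clC])
            fix x assume "x \<in> L"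
            from c(2)[OF h this] show "h x = truncation c h x" by auto
          qed
          also have "\<dots> = c * \<mu> k" unfolding k_def using dominatedD(4)[OF \<mu> clC] c(1) by simp
          finally show ?thesis .
        qed
        have "\<bar>\<nu> k - \<xi> k\<bar> \<le> 1 / Suc n"
          using W(3) zt(1) W(4) \<nu> \<xi> kC k1 unfolding osc_def by blast
        then have "c * \<bar>\<nu> k - \<xi> k\<bar> \<le> c * (1 / Suc n)" using c(1) by (intro mult_left_mono) auto
        also have "\<dots> \<le> e" using n by simp
        finally have "\<bar>\<nu> h - \<xi> h\<bar> \<le> e"
          unfolding agree[OF d\<nu>] agree[OF d\<xi>] using c(1) by (simp add: abs_mult flip: right_diff_distrib)
        then have "\<bar>t\<bar> * \<bar>\<nu> h - \<xi> h\<bar> \<le> \<bar>t\<bar> * e" by (intro mult_left_mono) auto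
        then have "t * (\<nu> h - \<xi> h) \<le> e * \<bar>t\<bar>"
          by (metis abs_ge_self abs_mult mult.commute order_trans)
        then show "f (z + t *\<^sub>R h) - f z - \<xi> (t *\<^sub>R h) \<le> e * \<bar>t\<bar>" using 1 by linarith
      qed
      have "norm (SUP h\<in>M. f (z + t *\<^sub>R h) - f z - \<xi> (t *\<^sub>R h)) \<le> e * norm t" if t: "\<bar>t\<bar> < r' / c'" for t
      proof -
        have "(SUP h\<in>M. f (z + t *\<^sub>R h) - f z - \<xi> (t *\<^sub>R h)) \<le> e * \<bar>t\<bar>"
          by (rule cSUP_least[OF M(2) bound(2)[OF t]])
        moreover obtain h where h: "h \<in> M" using M(2) by blast
        have "bdd_above ((\<lambda>h. f (z + t *\<^sub>R h) - f z - \<xi> (t *\<^sub>R h)) ` M)"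
          using bound(2)[OF t] by (rule bdd_aboveI2)
        then have "0 \<le> (SUP h\<in>M. f (z + t *\<^sub>R h) - f z - \<xi> (t *\<^sub>R h))"
          using bound(1)[OF t h] by (rule cSUP_upper2[OF _ h])
        ultimately show ?thesis by simp
      qed
      then show "\<forall>\<^sub>F t in at 0. norm (SUP h\<in>M. f (z + t *\<^sub>R h) - f z - \<xi> (t *\<^sub>R h)) \<le> e * norm t"
        using L'(2) c'(1) unfolding eventually_at
        by (intro exI[of _ "r' / c'"]) (auto simp: dist_real_def)
    qed
    ultimately show ?thesis unfolding frechet_differentiable_at_def by blast
  qed
  ultimately show "\<exists>G. gdelta_in (subtopology (Ck X) D) G \<and> subtopology (Ck X) D closure_of G = D \<and>
    (\<forall>z\<in>G. frechet_differentiable_at (Ck X) f z)" by blast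
qed

section \<open>Strongly exposed points\<close>

lemma subspace_dual_space: "subspace (dual_space E)"
  unfolding subspace_def dual_space_def
proof (intro conjI ballI allI; clarsimp)
  show "linear_on_set (topspace E) (0 :: 'a \<Rightarrow> real) \<and> continuous_map E euclideanreal 0"
    by (simp add: linear_on_set_def zero_fun_def)
next
  fix \<xi> \<eta> :: "'a \<Rightarrow> real"
  assume "linear_on_set (topspace E) \<xi>" "linear_on_set (topspace E) \<eta>"
    "continuous_map E euclideanreal \<xi>" "continuous_map E euclideanreal \<eta>"
  then show "linear_on_set (topspace E) (\<xi> + \<eta>) \<and> continuous_map E euclideanreal (\<xi> + \<eta>)"
    by (auto simp: linear_on_set_def plus_fun_def algebra_simps intro!: continuous_map_add)
next
  fix c and \<xi> :: "'a \<Rightarrow> real"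
  assume "linear_on_set (topspace E) \<xi>" "continuous_map E euclideanreal \<xi>"
  then show "linear_on_set (topspace E) (c *\<^sub>R \<xi>) \<and> continuous_map E euclideanreal (c *\<^sub>R \<xi>)"
    by (auto simp: linear_on_set_def scaleR_fun_def algebra_simps intro!: continuous_map_real_mult_left)
qed

lemma dual_space_Ck_outside: "\<xi> \<in> dual_space (Ck X) \<Longrightarrow> h \<notin> cont_funs X \<Longrightarrow> \<xi> h = 0"
  by (simp add: dual_space_def topspace_Ck)

lemma dual_space_dominated:
  assumes "\<xi> \<in> dual_space (Ck X)"
  obtains L C where "compactin X L" "dominated X L C \<xi>"
proof -
  have "equicontinuous (Ck X) {\<xi>}"
    unfolding equicontinuous_def
  proof (intro ballI allI impI)
    fix x and e :: real assume x: "x \<in> topspace (Ck X)" and e: "e > 0"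
    have "continuous_map (Ck X) euclideanreal \<xi>" using assms by (simp add: dual_space_def)
    then have "openin (Ck X) {y \<in> topspace (Ck X). \<xi> y \<in> ball (\<xi> x) e}"
      by (rule openin_continuous_map_preimage) simp
    then show "\<exists>U. openin (Ck X) U \<and> x \<in> U \<and> (\<forall>\<xi>\<in>{\<xi>}. \<forall>y\<in>U. \<bar>\<xi> y - \<xi> x\<bar> < e)"
      using x e by (intro exI[of _ "{y \<in> topspace (Ck X). \<xi> y \<in> ball (\<xi> x) e}"])
        (auto simp: dist_real_def abs_minus_commute)
  qed
  then show thesis using equicontinuous_imp_dominated[of "{\<xi>}" X] assms that by blast
qed

lemma open_fun_contains_box:
  fixes U :: "('v \<Rightarrow> real) set"
  assumes "open U" "\<mu> \<in> U"
  obtains F e where "finite F" "e > 0" "\<And>\<nu>. (\<And>h. h \<in> F \<Longrightarrow> \<bar>\<nu> h - \<mu> h\<bar> < e) \<Longrightarrow> \<nu> \<in> U"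
proof -
  have "openin (product_topology (\<lambda>_. euclideanreal) UNIV) U"
    using assms(1) by (simp add: euclidean_product_topology)
  then obtain V where V: "finite {h. V h \<noteq> UNIV}" "\<And>h. open (V h)" "\<mu> \<in> Pi\<^sub>E UNIV V" "Pi\<^sub>E UNIV V \<subseteq> U"
    using assms(2) unfolding openin_product_topology_alt by fastforce
  have box: "\<exists>e>0. \<forall>h\<in>F. \<forall>r. \<bar>r - \<mu> h\<bar> < e \<longrightarrow> r \<in> V h" if "finite F" for F
    using that
  proof induction
    case empty
    show ?case by (auto intro: exI[of _ 1])
  next
    case (insert h F)
    then obtain e where e: "e > 0" "\<forall>h\<in>F. \<forall>r. \<bar>r - \<mu> h\<bar> < e \<longrightarrow> r \<in> V h" by blast
    have "\<mu> h \<in> V h" using V(3) by auto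
    then obtain d where d: "d > 0" "ball (\<mu> h) d \<subseteq> V h" using V(2) open_contains_ball by blast
    have dV: "r \<in> V h" if "\<bar>r - \<mu> h\<bar> < d" for r
      using d(2) that by (auto simp: dist_real_def abs_minus_commute)
    show ?case
    proof (intro exI[of _ "min e d"] conjI ballI allI impI)
      fix k r assume "k \<in> insert h F" "\<bar>r - \<mu> k\<bar> < min e d"
      then show "r \<in> V k" using e(2) dV[of r] by (cases "k = h") auto
    qed (use e d in simp)
  qed
  then obtain e where e: "e > 0" "\<And>h r. V h \<noteq> UNIV \<Longrightarrow> \<bar>r - \<mu> h\<bar> < e \<Longrightarrow> r \<in> V h"
    using box[OF V(1)] by blast
  have "\<nu> \<in> U" if "\<And>h. h \<in> {h. V h \<noteq> UNIV} \<Longrightarrow> \<bar>\<nu> h - \<mu> h\<bar> < e" for \<nu>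
  proof -
    have "\<nu> h \<in> V h" for h using e(2)[of h "\<nu> h"] that[of h] by (cases "V h = UNIV") auto
    then show ?thesis using V(4) by (auto simp: PiE_UNIV_domain)
  qed
  then show thesis using that V(1) e(1) by blast
qed

lemma lcs_bounded_finite:
  assumes "finite F" "F \<subseteq> cont_funs X"
  shows "lcs_bounded (Ck X) F"
proof (rule lcs_bounded_CkI[OF assms(2)])
  fix L assume L: "compactin X L"
  show "\<exists>c>0. \<forall>h\<in>F. \<forall>x\<in>L. \<bar>h x\<bar> \<le> c"
    using assms
  proof (induction F)
    case empty
    show ?case by (auto intro: exI[of _ 1])
  next
    case (insert h F)
    then obtain c where c: "c > 0" "\<forall>h\<in>F. \<forall>x\<in>L. \<bar>h x\<bar> \<le> c" by auto
    obtain M where "M > 0" "\<And>x. x \<in> L \<Longrightarrow> \<bar>h x\<bar> < M" using cont_fun_bounded[OF _ L] insert.prems by blast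
    then show ?case using c by (intro exI[of _ "max c M"]) (auto simp: le_max_iff_disj intro: less_imp_le)
  qed
qed

lemma in_strong_dual_closure:
  assumes S: "S \<subseteq> dual_space E"
  shows "\<mu> \<in> strong_dual E closure_of S \<longleftrightarrow> \<mu> \<in> dual_space E \<and>
    (\<forall>B e. lcs_bounded E B \<and> e > 0 \<longrightarrow> (\<exists>\<nu>\<in>S. \<forall>b\<in>B. \<bar>\<nu> b - \<mu> b\<bar> < e))" (is "?l \<longleftrightarrow> ?r")
proof -
  have "lcs_bounded E {}" by (auto simp: lcs_bounded_def intro: exI[of _ 1])
  then have "openin (strong_dual E) (dual_space E)"
    unfolding openin_strong_dual by (auto simp: uniform_nhd_def intro!: exI[of _ "{}"] exI[of _ 1])
  then have top: "topspace (strong_dual E) = dual_space E"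
    using openin_strong_dual[of E "topspace (strong_dual E)"]
    by (meson openin_subset openin_topspace subset_antisym)
  show ?thesis
  proof
    assume l: ?l
    then have \<mu>: "\<mu> \<in> dual_space E" using top by (auto simp: in_closure_of)
    have "\<exists>\<nu>\<in>S. \<forall>b\<in>B. \<bar>\<nu> b - \<mu> b\<bar> < e" if B: "lcs_bounded E B" and e: "e > 0" for B e
    proof -
      \<comment> \<open>A strict inequality at each \<open>b\<close> of an infinite \<open>B\<close>
        need not define an open set, since the supremum may equal \<open>e\<close>; a common bound
        \<open>d < e\<close> does.\<close>
      let ?N = "{\<xi> \<in> dual_space E. \<exists>d<e. \<forall>b\<in>B. \<bar>\<xi> b - \<mu> b\<bar> \<le> d}"
      have "openin (strong_dual E) ?N"
        unfolding openin_strong_dual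
      proof (intro conjI ballI)
        fix \<xi> assume "\<xi> \<in> ?N"
        then obtain d where d: "\<xi> \<in> dual_space E" "d < e" "\<And>b. b \<in> B \<Longrightarrow> \<bar>\<xi> b - \<mu> b\<bar> \<le> d" by blast
        have "\<zeta> \<in> ?N" if \<zeta>: "\<zeta> \<in> uniform_nhd (dual_space E) B ((e - d) / 2) \<xi>" for \<zeta>
        proof -
          have "\<bar>\<zeta> b - \<mu> b\<bar> \<le> (e + d) / 2" if b: "b \<in> B" for b
          proof -
            have "\<bar>\<zeta> b - \<xi> b\<bar> < (e - d) / 2" using \<zeta> b by (simp add: uniform_nhd_def)
            moreover have "\<bar>\<zeta> b - \<mu> b\<bar> \<le> \<bar>\<zeta> b - \<xi> b\<bar> + \<bar>\<xi> b - \<mu> b\<bar>"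
              by (rule order_trans[OF _ abs_triangle_ineq]) simp
            ultimately show ?thesis using d(3)[OF b] by (simp add: field_simps)
          qed
          moreover have "(e + d) / 2 < e" using d(2) by simp
          ultimately show ?thesis using \<zeta> unfolding uniform_nhd_def by blast
        qed
        then show "\<exists>B'. lcs_bounded E B' \<and> (\<exists>\<epsilon>>0. uniform_nhd (dual_space E) B' \<epsilon> \<xi> \<subseteq> ?N)"
          using B d(2) by (intro exI[of _ B] conjI exI[of _ "(e - d) / 2"]) auto
      qed auto
      moreover have "\<mu> \<in> ?N" using \<mu> e by (auto intro: exI[of _ "e / 2"])
      moreover have "\<forall>T. \<mu> \<in> T \<and> openin (strong_dual E) T \<longrightarrow> (\<exists>y. y \<in> S \<and> y \<in> T)"
        using l unfolding in_closure_of by (elim conjE)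
      ultimately have "\<exists>y. y \<in> S \<and> y \<in> ?N" by (elim allE[of _ ?N]) simp
      then obtain \<nu> d where "\<nu> \<in> S" "d < e" "\<And>b. b \<in> B \<Longrightarrow> \<bar>\<nu> b - \<mu> b\<bar> \<le> d" by blast
      then show ?thesis by (meson le_less_trans)
    qed
    then show ?r using \<mu> by blast
  next
    assume r: ?r
    have "\<exists>y. y \<in> S \<and> y \<in> T" if T: "\<mu> \<in> T" "openin (strong_dual E) T" for T
    proof -
      obtain B e where B: "lcs_bounded E B" "e > 0" "uniform_nhd (dual_space E) B e \<mu> \<subseteq> T"
        using T unfolding openin_strong_dual by blast
      then obtain \<nu> where "\<nu> \<in> S" "\<forall>b\<in>B. \<bar>\<nu> b - \<mu> b\<bar> < e" using r by blast
      then have "\<nu> \<in> T" using B(3) S by (auto simp: uniform_nhd_def)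
      then show ?thesis using \<open>\<nu> \<in> S\<close> by blast
    qed
    then show ?l using r top by (auto simp: in_closure_of)
  qed
qed

lemma compact_imp_closed_fun:
  fixes K :: "('v \<Rightarrow> real) set"
  assumes "compact K"
  shows "closed K"
proof -
  have "Hausdorff_space (product_topology (\<lambda>_::'v. euclideanreal) UNIV)"
    by (simp add: Hausdorff_space_product_topology)
  then show ?thesis
    using assms compactin_imp_closedin[of "product_topology (\<lambda>_::'v. euclideanreal) UNIV" K]
    unfolding euclidean_product_topology closed_closedin compactin_euclidean_iff by blast
qed

text \<open>Finite sets of functions are bounded, so a strong limit is also a pointwise limit, and
  \<open>K\<close>, being compact, is closed for pointwise convergence.\<close>

lemma weak_star_compact_strong_closed:
  assumes K: "compactin (weak_star (Ck X)) K" and \<mu>: "\<mu> \<in> strong_dual (Ck X) closure_of K"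
  shows "\<mu> \<in> K"
proof (rule ccontr)
  assume "\<mu> \<notin> K"
  have KD: "K \<subseteq> dual_space (Ck X)" using K by (simp add: compactin_weak_star)
  have "closed K" using K by (simp add: compactin_weak_star compact_imp_closed_fun)
  then obtain F e where F: "finite F" "e > 0" "\<And>\<nu>. (\<And>h. h \<in> F \<Longrightarrow> \<bar>\<nu> h - \<mu> h\<bar> < e) \<Longrightarrow> \<nu> \<in> - K"
    using open_fun_contains_box[of "- K" \<mu>] \<open>\<mu> \<notin> K\<close> by (metis ComplI open_Compl)
  have \<mu>D: "\<mu> \<in> dual_space (Ck X)" using \<mu> in_strong_dual_closure[OF KD] by blast
  have "lcs_bounded (Ck X) (F \<inter> cont_funs X)" using F(1) by (intro lcs_bounded_finite) auto
  then obtain \<nu> where \<nu>: "\<nu> \<in> K" "\<forall>b\<in>F \<inter> cont_funs X. \<bar>\<nu> b - \<mu> b\<bar> < e"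
    using \<mu> F(2) in_strong_dual_closure[OF KD] by blast
  have "\<bar>\<nu> h - \<mu> h\<bar> < e" if "h \<in> F" for h
    using \<nu> that F(2) KD dual_space_Ck_outside[OF \<mu>D, of h] dual_space_Ck_outside[of \<nu> X h]
    by (cases "h \<in> cont_funs X") auto
  then show False using F(3) \<nu>(1) by blast
qed

text \<open>The distance \<open>d\<close> to \<open>Cx\<close> in the seminorm \<open>s\<close>
  given by \<open>B\<close> is convex, vanishes on \<open>Cx\<close> and is at least
  \<open>e\<close> at \<open>\<mu>\<close>. A subgradient of \<open>d\<close> at
  \<open>\<mu>\<close> therefore separates with gap \<open>e\<close>, and it is bounded by
  \<open>s\<close> because \<open>d\<close> is nonexpansive.\<close>

lemma strong_dual_separation:
  fixes X :: "'a topology"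
  assumes B: "lcs_bounded (Ck X) B" and CD: "Cx \<subseteq> dual_space (Ck X)" and Cx: "convex Cx"
    and \<mu>: "\<mu> \<in> dual_space (Ck X)" and far: "\<And>\<nu>. \<nu> \<in> Cx \<Longrightarrow> \<exists>b\<in>B. e \<le> \<bar>\<nu> b - \<mu> b\<bar>"
  obtains F where "linear_on_set (dual_space (Ck X)) F"
    "\<And>\<zeta> c. \<zeta> \<in> dual_space (Ck X) \<Longrightarrow> 0 \<le> c \<Longrightarrow> (\<And>b. b \<in> B \<Longrightarrow> \<bar>\<zeta> b\<bar> \<le> c) \<Longrightarrow> \<bar>F \<zeta>\<bar> \<le> c"
    "\<And>\<nu>. \<nu> \<in> Cx \<Longrightarrow> F \<nu> + e \<le> F \<mu>"
proof (cases "Cx = {}")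
  case True
  then show thesis by (intro that[of "\<lambda>_. 0"]) (auto simp: linear_on_set_def)
next
  case False
  let ?V = "dual_space (Ck X)"
  note V = subspace_dual_space[of "Ck X"]
  \<comment> \<open>Every functional in the dual vanishes at 0; inserting 0 keeps the index set
    nonempty when \<open>B\<close> is empty.\<close>
  define s where "s \<zeta> = (SUP b\<in>insert 0 B. \<bar>\<zeta> b\<bar>)" for \<zeta> :: "('a \<Rightarrow> real) \<Rightarrow> real"
  have z0: "\<zeta> 0 = 0" if "\<zeta> \<in> ?V" for \<zeta>
  proof -
    have "linear_on_set (cont_funs X) \<zeta>" using that by (simp add: dual_space_def topspace_Ck)
    then show ?thesis using linear_on_set_0 subspace_cont_funs by blast
  qed
  have bdd: "bdd_above ((\<lambda>b. \<bar>\<zeta> b\<bar>) ` insert 0 B)" if \<zeta>: "\<zeta> \<in> ?V" for \<zeta>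
  proof -
    obtain L C where L: "compactin X L" "dominated X L C \<zeta>" using dual_space_dominated[OF \<zeta>] by blast
    obtain c where c: "c > 0" "\<And>h x. h \<in> B \<Longrightarrow> x \<in> L \<Longrightarrow> \<bar>h x\<bar> \<le> c"
      using lcs_bounded_CkD[OF B L(1)] by blast
    have "\<bar>\<zeta> b\<bar> \<le> C * c" if "b \<in> insert 0 B" for b
    proof (rule dominatedD(5)[OF L(2)])
      show "b \<in> cont_funs X" using that B cont_funs_0 by (auto simp: lcs_bounded_def topspace_Ck)
      show "\<And>x. x \<in> L \<Longrightarrow> \<bar>b x\<bar> \<le> c" using that c by auto
    qed (use c in auto)
    then show ?thesis by (rule bdd_aboveI2)
  qed
  have sge: "\<bar>\<zeta> b\<bar> \<le> s \<zeta>" if "\<zeta> \<in> ?V" "b \<in> insert 0 B" for \<zeta> b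
    unfolding s_def using cSUP_upper[OF that(2) bdd[OF that(1)]] .
  have sle: "s \<zeta> \<le> c" if "\<zeta> \<in> ?V" "0 \<le> c" "\<And>b. b \<in> B \<Longrightarrow> \<bar>\<zeta> b\<bar> \<le> c" for \<zeta> c
    unfolding s_def using that z0[OF that(1)] by (intro cSUP_least) auto
  have s0: "0 \<le> s \<zeta>" if "\<zeta> \<in> ?V" for \<zeta> using sge[OF that, of 0] by simp
  have scomb: "s (u *\<^sub>R \<zeta> + v *\<^sub>R \<eta>) \<le> u * s \<zeta> + v * s \<eta>"
    if "\<zeta> \<in> ?V" "\<eta> \<in> ?V" "0 \<le> u" "0 \<le> v" for \<zeta> \<eta> u v
  proof (rule sle)
    show "u *\<^sub>R \<zeta> + v *\<^sub>R \<eta> \<in> ?V" using that V by (simp add: subspace_add subspace_scale)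
    show "0 \<le> u * s \<zeta> + v * s \<eta>" using that s0 by simp
    fix b assume b: "b \<in> B"
    have "\<bar>u * \<zeta> b + v * \<eta> b\<bar> \<le> u * \<bar>\<zeta> b\<bar> + v * \<bar>\<eta> b\<bar>"
      using that abs_triangle_ineq[of "u * \<zeta> b" "v * \<eta> b"] by (simp add: abs_mult)
    also have "\<dots> \<le> u * s \<zeta> + v * s \<eta>"
      using that b sge by (intro add_mono mult_left_mono) auto
    finally show "\<bar>(u *\<^sub>R \<zeta> + v *\<^sub>R \<eta>) b\<bar> \<le> u * s \<zeta> + v * s \<eta>" by simp
  qed
  define d where "d \<zeta> = (INF \<nu>\<in>Cx. s (\<zeta> - \<nu>))" for \<zeta>
  have dle: "d \<zeta> \<le> s (\<zeta> - \<nu>)" if "\<zeta> \<in> ?V" "\<nu> \<in> Cx" for \<zeta> \<nu>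
    unfolding d_def
  proof (rule cINF_lower[OF _ that(2)])
    show "bdd_below ((\<lambda>\<nu>. s (\<zeta> - \<nu>)) ` Cx)"
      using s0 that(1) CD V by (intro bdd_belowI2[where m=0]) (auto simp: subspace_diff subset_iff)
  qed
  have dge: "r \<le> d \<zeta>" if "\<And>\<nu>. \<nu> \<in> Cx \<Longrightarrow> r \<le> s (\<zeta> - \<nu>)" for r \<zeta>
    unfolding d_def using that False by (intro cINF_greatest) auto
  have dlt: "\<exists>\<nu>\<in>Cx. s (\<zeta> - \<nu>) < d \<zeta> + r" if "r > 0" for \<zeta> r
    using dge[of "d \<zeta> + r" \<zeta>] that by (meson add_le_same_cancel1 leI not_le)
  have "convex_on ?V d"
    unfolding convex_on_def
  proof (intro conjI ballI allI impI)
    show "convex ?V" using V by (rule subspace_imp_convex)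
    fix \<zeta> \<eta> and u v :: real assume *: "\<zeta> \<in> ?V" "\<eta> \<in> ?V" "0 \<le> u" "0 \<le> v" "u + v = 1"
    show "d (u *\<^sub>R \<zeta> + v *\<^sub>R \<eta>) \<le> u * d \<zeta> + v * d \<eta>"
    proof (rule field_le_epsilon)
      fix r :: real assume r: "r > 0"
      obtain \<nu>1 where \<nu>1: "\<nu>1 \<in> Cx" "s (\<zeta> - \<nu>1) < d \<zeta> + r" using dlt[OF r] by blast
      obtain \<nu>2 where \<nu>2: "\<nu>2 \<in> Cx" "s (\<eta> - \<nu>2) < d \<eta> + r" using dlt[OF r] by blast
      have "u *\<^sub>R \<nu>1 + v *\<^sub>R \<nu>2 \<in> Cx" using Cx \<nu>1 \<nu>2 * by (simp add: convexD)
      then have "d (u *\<^sub>R \<zeta> + v *\<^sub>R \<eta>) \<le> s ((u *\<^sub>R \<zeta> + v *\<^sub>R \<eta>) - (u *\<^sub>R \<nu>1 + v *\<^sub>R \<nu>2))"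
        using * V by (intro dle) (auto simp: subspace_add subspace_scale)
      also have "(u *\<^sub>R \<zeta> + v *\<^sub>R \<eta>) - (u *\<^sub>R \<nu>1 + v *\<^sub>R \<nu>2) = u *\<^sub>R (\<zeta> - \<nu>1) + v *\<^sub>R (\<eta> - \<nu>2)"
        by (simp add: algebra_simps)
      also have "s \<dots> \<le> u * s (\<zeta> - \<nu>1) + v * s (\<eta> - \<nu>2)"
        using * \<nu>1 \<nu>2 CD V by (intro scomb) (auto simp: subspace_diff subset_iff)
      also have "\<dots> \<le> u * (d \<zeta> + r) + v * (d \<eta> + r)"
        using * \<nu>1 \<nu>2 by (intro add_mono mult_left_mono) auto
      also have "\<dots> = u * d \<zeta> + v * d \<eta> + (u + v) * r" by (simp add: algebra_simps)
      finally show "d (u *\<^sub>R \<zeta> + v *\<^sub>R \<eta>) \<le> u * d \<zeta> + v * d \<eta> + r" unfolding *(5) mult_1_left .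
    qed
  qed
  moreover have "\<exists>t>0. \<mu> + t *\<^sub>R h \<in> ?V" if "h \<in> ?V" for h
    using that \<mu> V by (intro exI[of _ 1]) (auto simp: subspace_add)
  ultimately obtain F where F: "linear_on_set ?V F" "\<And>y. y \<in> ?V \<Longrightarrow> d \<mu> + F (y - \<mu>) \<le> d y"
    using subgradient_exists[OF V subset_refl \<mu>, of d] by metis
  \<comment> \<open>Here a nearly nearest \<open>\<nu> \<in> Cx\<close> to \<open>\<mu>\<close>
    shows that \<open>d\<close> grows by at most \<open>s \<zeta>\<close> from \<open>\<mu>\<close>
    to \<open>\<mu> + \<zeta>\<close>.\<close>
  have Fs: "F \<zeta> \<le> s \<zeta>" if \<zeta>: "\<zeta> \<in> ?V" for \<zeta>
  proof (rule field_le_epsilon)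
    fix r :: real assume r: "r > 0"
    obtain \<nu> where \<nu>: "\<nu> \<in> Cx" "s (\<mu> - \<nu>) < d \<mu> + r" using dlt[OF r] by blast
    have "d \<mu> + F ((\<mu> + \<zeta>) - \<mu>) \<le> d (\<mu> + \<zeta>)" using \<mu> \<zeta> V by (intro F(2)) (simp add: subspace_add)
    also have "\<dots> \<le> s ((\<mu> + \<zeta>) - \<nu>)" using \<mu> \<zeta> V \<nu> by (intro dle) (auto simp: subspace_add)
    also have "(\<mu> + \<zeta>) - \<nu> = 1 *\<^sub>R (\<mu> - \<nu>) + 1 *\<^sub>R \<zeta>" by simp
    also have "s \<dots> \<le> 1 * s (\<mu> - \<nu>) + 1 * s \<zeta>"
      using \<mu> \<zeta> \<nu> CD V by (intro scomb) (auto simp: subspace_diff subset_iff)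
    finally show "F \<zeta> \<le> s \<zeta> + r" using \<nu>(2) by simp
  qed
  show thesis
  proof (rule that[OF F(1)])
    fix \<zeta> and c :: real assume *: "\<zeta> \<in> ?V" "0 \<le> c" "\<And>b. b \<in> B \<Longrightarrow> \<bar>\<zeta> b\<bar> \<le> c"
    have m: "- \<zeta> \<in> ?V" by (rule subspace_neg[OF V *(1)])
    have "s \<zeta> \<le> c" "s (- \<zeta>) \<le> c" using sle[of \<zeta> c] sle[OF m, of c] * by auto
    then show "\<bar>F \<zeta>\<bar> \<le> c"
      using Fs[OF *(1)] Fs[OF m] linear_on_set_uminus[OF F(1) *(1)] by simp
  next
    fix \<nu> assume \<nu>: "\<nu> \<in> Cx"
    have "e \<le> d \<mu>"
    proof (rule dge)
      fix \<nu> assume \<nu>: "\<nu> \<in> Cx"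
      then obtain b where b: "b \<in> B" "e \<le> \<bar>\<nu> b - \<mu> b\<bar>" using far by blast
      have "\<bar>(\<mu> - \<nu>) b\<bar> \<le> s (\<mu> - \<nu>)"
        using subspace_diff[OF V \<mu>] \<nu> CD b by (intro sge) blast+
      then show "e \<le> s (\<mu> - \<nu>)" using b by (simp add: abs_minus_commute)
    qed
    moreover have "d \<nu> \<le> s (\<nu> - \<nu>)" using \<nu> CD by (intro dle) auto
    moreover have "s (\<nu> - \<nu>) \<le> 0" using V by (intro sle) (auto simp: subspace_0)
    moreover have "d \<mu> + F (\<nu> - \<mu>) \<le> d \<nu>" using \<nu> CD by (intro F(2)) auto
    moreover have "F (\<nu> - \<mu>) = F \<nu> - F \<mu>" using \<nu> CD by (intro linear_on_set_diff[OF F(1) V _ \<mu>]) auto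
    ultimately show "F \<nu> + e \<le> F \<mu>" by linarith
  qed
qed

theorem asplund_imp_tame:
  fixes X :: "'a topology"
  assumes asp: "asplund_space (Ck X)"
  shows "tame_space (Ck X)"
  unfolding tame_space_def
proof (intro conjI locally_convex_space_Ck allI impI; elim conjE)
  fix K assume K: "compactin (weak_star (Ck X)) K" and eq: "equicontinuous (Ck X) K" and cv: "convex K"
  let ?V = "dual_space (Ck X)"
  let ?H = "convex hull {\<xi>. \<xi> extreme_point_of K}"
  have KV: "K \<subseteq> ?V" using K by (simp add: compactin_weak_star)
  have "{\<xi>. \<xi> extreme_point_of K} \<subseteq> K" by (auto simp: extreme_point_of_def)
  then have HK: "?H \<subseteq> K" using cv by (rule hull_minimal)
  then have HV: "?H \<subseteq> ?V" using KV by blast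
  show "K = strong_dual (Ck X) closure_of ?H"
  proof
    show "strong_dual (Ck X) closure_of ?H \<subseteq> K"
      using weak_star_compact_strong_closed[OF K] closure_of_mono[OF HK] by blast
    show "K \<subseteq> strong_dual (Ck X) closure_of ?H"
    proof
      fix \<mu> assume \<mu>: "\<mu> \<in> K"
      then have \<mu>V: "\<mu> \<in> ?V" using KV by blast
      show "\<mu> \<in> strong_dual (Ck X) closure_of ?H"
      proof (rule ccontr)
        assume "\<mu> \<notin> strong_dual (Ck X) closure_of ?H"
        then obtain B e where B: "lcs_bounded (Ck X) B" and e: "e > 0"
          and far: "\<And>\<nu>. \<nu> \<in> ?H \<Longrightarrow> \<exists>b\<in>B. e \<le> \<bar>\<nu> b - \<mu> b\<bar>"
          using in_strong_dual_closure[OF HV, of \<mu>] \<mu>V by (meson not_le)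
        obtain F where F: "linear_on_set ?V F"
          and Fle: "\<And>\<zeta> c. \<zeta> \<in> ?V \<Longrightarrow> 0 \<le> c \<Longrightarrow> (\<And>b. b \<in> B \<Longrightarrow> \<bar>\<zeta> b\<bar> \<le> c) \<Longrightarrow> \<bar>F \<zeta>\<bar> \<le> c"
          and Fsep: "\<And>\<nu>. \<nu> \<in> ?H \<Longrightarrow> F \<nu> + e \<le> F \<mu>"
          using strong_dual_separation[OF B HV convex_convex_hull \<mu>V far] by metis
        obtain L C where L: "compactin X L" and dom: "\<And>\<nu>. \<nu> \<in> K \<Longrightarrow> dominated X L C \<nu>"
          using equicontinuous_imp_dominated[OF KV eq] by blast
        have C0: "0 \<le> C" using dominated_nonneg[OF dom[OF \<mu>]] .
        obtain cB where cB: "cB > 0" "\<And>b x. b \<in> B \<Longrightarrow> x \<in> L \<Longrightarrow> \<bar>b x\<bar> \<le> cB"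
          using lcs_bounded_CkD[OF B L] by blast
        have BC: "B \<subseteq> cont_funs X" using B by (simp add: lcs_bounded_def topspace_Ck)
        have FK: "\<bar>F \<nu>\<bar> \<le> C * cB" if \<nu>: "\<nu> \<in> K" for \<nu>
        proof (rule Fle)
          show "\<nu> \<in> ?V" using \<nu> KV by blast
          show "0 \<le> C * cB" using C0 cB by simp
          fix b assume "b \<in> B"
          then show "\<bar>\<nu> b\<bar> \<le> C * cB" using cB BC by (intro dominatedD(5)[OF dom[OF \<nu>]]) auto
        qed
        \<comment> \<open>A supremum of affine functions of \<open>h\<close> with linear parts in
          \<open>K\<close>. The constant \<open>F \<nu>\<close> makes those \<open>\<nu>\<close>
          with large \<open>F\<close> dominate near \<open>h = 0\<close>.\<close>
        define f where "f h = (SUP \<nu>\<in>K. F \<nu> + \<nu> h)" for h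
        have bdd: "bdd_above ((\<lambda>\<nu>. F \<nu> + \<nu> h) ` K)" if h: "h \<in> cont_funs X" for h
        proof -
          obtain M where M: "M > 0" "\<And>x. x \<in> L \<Longrightarrow> \<bar>h x\<bar> < M" using cont_fun_bounded[OF h L] by blast
          have "F \<nu> + \<nu> h \<le> C * cB + C * M" if \<nu>: "\<nu> \<in> K" for \<nu>
          proof -
            have "\<bar>\<nu> h\<bar> \<le> C * M" using M by (intro dominatedD(5)[OF dom[OF \<nu>] h]) (auto intro: less_imp_le)
            then show ?thesis using FK[OF \<nu>] by linarith
          qed
          then show ?thesis by (rule bdd_aboveI2)
        qed
        have fge: "F \<nu> + \<nu> h \<le> f h" if "h \<in> cont_funs X" "\<nu> \<in> K" for \<nu> h
          unfolding f_def using cSUP_upper[OF that(2) bdd[OF that(1)]] .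
        have fle: "f h \<le> r" if "\<And>\<nu>. \<nu> \<in> K \<Longrightarrow> F \<nu> + \<nu> h \<le> r" for h r
          unfolding f_def using \<mu> that by (intro cSUP_least) auto
        have fslice: "\<exists>\<nu>\<in>K. f h - r < F \<nu> + \<nu> h" if "h \<in> cont_funs X" "r > 0" for h r
        proof (rule ccontr)
          assume "\<not> ?thesis"
          then have "f h \<le> f h - r" by (intro fle) (auto simp: not_less)
          then show False using that by simp
        qed
        have lip1: "f g \<le> f h + C * c"
          if gh: "g \<in> cont_funs X" "h \<in> cont_funs X" "0 \<le> c" "\<And>x. x \<in> L \<Longrightarrow> \<bar>g x - h x\<bar> \<le> c" for g h c
        proof (rule fle)
          fix \<nu> assume \<nu>: "\<nu> \<in> K"
          have "\<bar>\<nu> (g - h)\<bar> \<le> C * c"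
            using gh by (intro dominatedD(5)[OF dom[OF \<nu>] cont_funs_diff]) auto
          then show "F \<nu> + \<nu> g \<le> f h + C * c"
            using fge[OF gh(2) \<nu>] dominatedD(2)[OF dom[OF \<nu>] gh(1,2)] by linarith
        qed
        have lip: "\<bar>f g - f h\<bar> \<le> C * c"
          if gh: "g \<in> cont_funs X" "h \<in> cont_funs X" "0 \<le> c" "\<And>x. x \<in> L \<Longrightarrow> \<bar>g x - h x\<bar> \<le> c" for g h c
        proof -
          have "f h \<le> f g + C * c"
          proof (rule lip1[OF gh(2,1,3)])
            show "\<And>x. x \<in> L \<Longrightarrow> \<bar>h x - g x\<bar> \<le> c" using gh(4) by (simp add: abs_minus_commute)
          qed
          then show ?thesis using lip1[OF gh] by linarith
        qed
        have cont: "continuous_map (Ck X) euclideanreal f"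
          by (rule lipschitz_continuous_map_Ck[OF L C0 lip])
        have conv: "convex_on (cont_funs X) f"
          unfolding convex_on_def
        proof (intro conjI ballI allI impI)
          show "convex (cont_funs X)" by (rule subspace_imp_convex[OF subspace_cont_funs])
          fix g h and u v :: real
          assume *: "g \<in> cont_funs X" "h \<in> cont_funs X" "0 \<le> u" "0 \<le> v" "u + v = 1"
          show "f (u *\<^sub>R g + v *\<^sub>R h) \<le> u * f g + v * f h"
          proof (rule fle)
            fix \<nu> assume \<nu>: "\<nu> \<in> K"
            have "\<nu> (u *\<^sub>R g + v *\<^sub>R h) = u * \<nu> g + v * \<nu> h"
              using * dominatedD(1,4)[OF dom[OF \<nu>]] by (simp add: cont_funs_scaleR)
            then have "F \<nu> + \<nu> (u *\<^sub>R g + v *\<^sub>R h) = (u + v) * F \<nu> + u * \<nu> g + v * \<nu> h" using * by simp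
            also have "\<dots> = u * (F \<nu> + \<nu> g) + v * (F \<nu> + \<nu> h)" by (simp add: algebra_simps)
            also have "\<dots> \<le> u * f g + v * f h"
              using * fge \<nu> by (intro add_mono mult_left_mono) auto
            finally show "F \<nu> + \<nu> (u *\<^sub>R g + v *\<^sub>R h) \<le> u * f g + v * f h" .
          qed
        qed
        have openT: "openin (Ck X) (cont_funs X)" using openin_topspace[of "Ck X"] by (simp add: topspace_Ck)
        have subT: "subtopology (Ck X) (cont_funs X) = Ck X"
          using subtopology_topspace[of "Ck X"] by (simp add: topspace_Ck)
        have "\<exists>G. gdelta_in (subtopology (Ck X) (cont_funs X)) G \<and>
            subtopology (Ck X) (cont_funs X) closure_of G = cont_funs X \<and>
            (\<forall>z\<in>G. frechet_differentiable_at (Ck X) f z)"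
          using asp[unfolded asplund_space_def, THEN conjunct2, rule_format, of "cont_funs X" f]
            openT cont conv cont_funs_0[of X] subspace_imp_convex[OF subspace_cont_funs] subT by auto
        then obtain G where G: "Ck X closure_of G = cont_funs X"
          "\<And>z. z \<in> G \<Longrightarrow> frechet_differentiable_at (Ck X) f z" unfolding subT by blast
        \<comment> \<open>Passing from \<open>F \<nu>\<close> to \<open>F \<nu> + \<nu> h0\<close>
          costs at most \<open>C \<eta>\<close> for each of \<open>\<mu>\<close> and
          \<open>\<xi>\<close>; \<open>\<eta>\<close> is chosen so that both together stay below the
          separation gap \<open>e\<close>.\<close>
        define D where "D = 2 * C + 1"
        have D0: "D > 0" using C0 by (simp add: D_def)
        define \<eta> where "\<eta> = e / 2 / D"
        have \<eta>: "\<eta> > 0" using e D0 by (simp add: \<eta>_def)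
        have \<eta>e: "2 * C * \<eta> < e"
        proof -
          have "D * \<eta> = e / 2" using D0 by (simp add: \<eta>_def)
          then have "2 * C * \<eta> \<le> e / 2" using \<eta> unfolding D_def by (simp add: distrib_right)
          then show ?thesis using e by linarith
        qed
        obtain h0 where h0: "h0 \<in> G" "h0 \<in> uniform_nhd (cont_funs X) L \<eta> 0"
        proof -
          have "0 \<in> Ck X closure_of G" using G(1) cont_funs_0 by blast
          then have "\<forall>T. 0 \<in> T \<and> openin (Ck X) T \<longrightarrow> (\<exists>y. y \<in> G \<and> y \<in> T)"
            unfolding in_closure_of by (elim conjE)
          then show thesis
            using openin_uniform_nhd[OF cont_funs_0 L, of \<eta>] \<eta> cont_funs_0 that
            by (elim allE[of _ "uniform_nhd (cont_funs X) L \<eta> 0"]) (auto simp: uniform_nhd_def)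
        qed
        then have h0C: "h0 \<in> cont_funs X" and h0b: "\<And>x. x \<in> L \<Longrightarrow> \<bar>h0 x\<bar> < \<eta>"
          by (auto simp: uniform_nhd_def)
        obtain \<xi> where \<xi>: "\<xi> \<in> ?V" and fr: "\<And>M. lcs_bounded (Ck X) M \<Longrightarrow> M \<noteq> {} \<Longrightarrow>
            (\<lambda>t::real. SUP h\<in>M. f (h0 + t *\<^sub>R h) - f h0 - \<xi> (t *\<^sub>R h)) \<in> o[at 0](\<lambda>t. t)"
          using G(2)[OF h0(1)] unfolding frechet_differentiable_at_def by blast
        obtain L2 C2 where L2: "compactin X L2" and d\<xi>: "dominated X L2 C2 \<xi>"
          using dual_space_dominated[OF \<xi>] by blast
        \<comment> \<open>Smulian's criterion: if \<open>\<nu>\<close> is within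
          \<open>\<alpha>\<close> of the supremum at \<open>h0\<close>, then
          \<open>t (\<nu> h - \<xi> h)\<close> is at most the differentiability error at
          \<open>t h\<close> plus \<open>\<alpha>\<close>. With \<open>\<alpha> = (r / 2) t\<close>
          and error at most \<open>(r / 2) t\<close>, division by \<open>t\<close> gives
          \<open>r\<close>.\<close>
        have shrink: "\<exists>\<alpha>>0. \<forall>\<nu>\<in>K. f h0 - \<alpha> < F \<nu> + \<nu> h0 \<longrightarrow> (\<forall>h\<in>M. \<bar>\<nu> h - \<xi> h\<bar> \<le> r)"
          if M: "lcs_bounded (Ck X) M" "M \<noteq> {}" and r: "r > 0" for M r
        proof -
          have MC: "M \<subseteq> cont_funs X" using M(1) by (simp add: lcs_bounded_def topspace_Ck)
          \<comment> \<open>The symmetric set turns the one-sided estimate into one for the absolute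
            value.\<close>
          let ?M = "M \<union> uminus ` M"
          have M'C: "?M \<subseteq> cont_funs X" using MC by (auto intro: cont_funs_uminus)
          have M'b: "lcs_bounded (Ck X) ?M"
          proof (rule lcs_bounded_CkI[OF M'C])
            fix L assume "compactin X L"
            then obtain c where "c > 0" "\<And>h x. h \<in> M \<Longrightarrow> x \<in> L \<Longrightarrow> \<bar>h x\<bar> \<le> c"
              using lcs_bounded_CkD[OF M(1)] by blast
            then show "\<exists>c>0. \<forall>h\<in>?M. \<forall>x\<in>L. \<bar>h x\<bar> \<le> c" by (intro exI[of _ c]) auto
          qed
          have "\<forall>\<^sub>F t in at 0. norm (SUP h\<in>?M. f (h0 + t *\<^sub>R h) - f h0 - \<xi> (t *\<^sub>R h)) \<le> (r / 2) * norm t"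
            using fr[OF M'b] M(2) r by (intro landau_o.smallD) auto
          then obtain d where d: "d > 0" and small: "\<And>t. t \<noteq> 0 \<Longrightarrow> \<bar>t\<bar> < d \<Longrightarrow>
              norm (SUP h\<in>?M. f (h0 + t *\<^sub>R h) - f h0 - \<xi> (t *\<^sub>R h)) \<le> (r / 2) * norm t"
            unfolding eventually_at by (auto simp: dist_real_def)
          define t where "t = d / 2"
          have t: "t > 0" "t < d" using d by (auto simp: t_def)
          let ?q = "\<lambda>h. f (h0 + t *\<^sub>R h) - f h0 - \<xi> (t *\<^sub>R h)"
          \<comment> \<open>Only for a set bounded above does smallness of the real supremum bound
            each of its members.\<close>
          have bddq: "bdd_above (?q ` ?M)"
          proof -
            obtain c where c: "c > 0" "\<And>h x. h \<in> ?M \<Longrightarrow> x \<in> L \<Longrightarrow> \<bar>h x\<bar> \<le> c"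
              using lcs_bounded_CkD[OF M'b L] by blast
            obtain c2 where c2: "c2 > 0" "\<And>h x. h \<in> ?M \<Longrightarrow> x \<in> L2 \<Longrightarrow> \<bar>h x\<bar> \<le> c2"
              using lcs_bounded_CkD[OF M'b L2] by blast
            have "?q h \<le> C * (t * c) + C2 * (t * c2)" if h: "h \<in> ?M" for h
            proof -
              have hC: "h \<in> cont_funs X" using h M'C by blast
              have thC: "t *\<^sub>R h \<in> cont_funs X" by (rule cont_funs_scaleR[OF hC])
              have tb: "\<bar>t * h x\<bar> \<le> t * b" if "\<bar>h x\<bar> \<le> b" for x b
                using that t by (simp add: abs_mult mult_left_mono)
              have "\<bar>f (h0 + t *\<^sub>R h) - f h0\<bar> \<le> C * (t * c)"
                using t c tb c(2)[OF h] by (intro lip cont_funs_add[OF h0C thC] h0C) auto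
              moreover have "\<bar>\<xi> (t *\<^sub>R h)\<bar> \<le> C2 * (t * c2)"
                using t c2 tb c2(2)[OF h] by (intro dominatedD(5)[OF d\<xi> thC]) auto
              ultimately show ?thesis by linarith
            qed
            then show ?thesis by (rule bdd_aboveI2)
          qed
          have qle: "?q h \<le> (r / 2) * t" if h: "h \<in> ?M" for h
          proof -
            have "?q h \<le> (SUP h\<in>?M. ?q h)" by (rule cSUP_upper[OF h bddq])
            also have "\<dots> \<le> (r / 2) * t" using small[of t] t by simp
            finally show ?thesis .
          qed
          have one: "\<nu> h - \<xi> h \<le> r"
            if \<nu>: "\<nu> \<in> K" "f h0 - (r / 2) * t < F \<nu> + \<nu> h0" and h: "h \<in> ?M" for \<nu> h
          proof -
            have hC: "h \<in> cont_funs X" using h M'C by blast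
            have thC: "t *\<^sub>R h \<in> cont_funs X" by (rule cont_funs_scaleR[OF hC])
            have "F \<nu> + \<nu> (h0 + t *\<^sub>R h) \<le> f (h0 + t *\<^sub>R h)"
              by (rule fge[OF cont_funs_add[OF h0C thC] \<nu>(1)])
            moreover have "\<nu> (h0 + t *\<^sub>R h) = \<nu> h0 + t * \<nu> h"
              using dominatedD(1)[OF dom[OF \<nu>(1)] h0C thC] dominatedD(4)[OF dom[OF \<nu>(1)] hC] by simp
            moreover have "\<xi> (t *\<^sub>R h) = t * \<xi> h" using dominatedD(4)[OF d\<xi> hC] .
            ultimately have "t * \<nu> h - t * \<xi> h \<le> (r / 2) * t + (r / 2) * t"
              using qle[OF h] \<nu>(2) by linarith
            then have "t * (\<nu> h - \<xi> h) \<le> t * r" by (simp add: algebra_simps)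
            then show ?thesis using t by simp
          qed
          have "\<bar>\<nu> h - \<xi> h\<bar> \<le> r" if \<nu>: "\<nu> \<in> K" "f h0 - (r / 2) * t < F \<nu> + \<nu> h0" and h: "h \<in> M" for \<nu> h
          proof -
            have hC: "h \<in> cont_funs X" using h MC by blast
            have "\<nu> (- h) - \<xi> (- h) \<le> r" using one[OF \<nu>, of "- h"] h by blast
            then show ?thesis
              using one[OF \<nu>, of h] h dominatedD(3)[OF dom[OF \<nu>(1)] hC] dominatedD(3)[OF d\<xi> hC] by auto
          qed
          moreover have "(r / 2) * t > 0" using r t by simp
          ultimately show ?thesis by blast
        qed
        \<comment> \<open>Functionals nearly attaining the supremum exist in \<open>K\<close> and
          converge strongly to \<open>\<xi>\<close>.\<close>
        have \<xi>K: "\<xi> \<in> K"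
        proof (rule weak_star_compact_strong_closed[OF K])
          have "\<exists>\<nu>\<in>K. \<forall>b\<in>M. \<bar>\<nu> b - \<xi> b\<bar> < r" if M: "lcs_bounded (Ck X) M" and r: "r > 0" for M r
          proof (cases "M = {}")
            case False
            obtain \<alpha> where \<alpha>: "\<alpha> > 0" "\<forall>\<nu>\<in>K. f h0 - \<alpha> < F \<nu> + \<nu> h0 \<longrightarrow> (\<forall>h\<in>M. \<bar>\<nu> h - \<xi> h\<bar> \<le> r / 2)"
              using shrink[OF M False, of "r / 2"] r by auto
            obtain \<nu> where "\<nu> \<in> K" "f h0 - \<alpha> < F \<nu> + \<nu> h0" using fslice[OF h0C \<alpha>(1)] by blast
            then have "\<forall>h\<in>M. \<bar>\<nu> h - \<xi> h\<bar> \<le> r / 2" using \<alpha>(2) by blast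
            then have "\<forall>h\<in>M. \<bar>\<nu> h - \<xi> h\<bar> < r" using r by fastforce
            then show ?thesis using \<open>\<nu> \<in> K\<close> by blast
          qed (use \<mu> in auto)
          then show "\<xi> \<in> strong_dual (Ck X) closure_of K"
            using in_strong_dual_closure[OF KV, of \<xi>] \<xi> by blast
        qed
        have Fdiff: "F (\<nu> - \<nu>') = F \<nu> - F \<nu>'" if "\<nu> \<in> ?V" "\<nu>' \<in> ?V" for \<nu> \<nu>'
          by (rule linear_on_set_diff[OF F subspace_dual_space that])
        have max: "f h0 \<le> F \<xi> + \<xi> h0"
        proof (rule field_le_epsilon)
          fix r :: real assume r: "r > 0"
          \<comment> \<open>Closeness on \<open>B\<close> controls \<open>F\<close>, and closeness
            at \<open>h0\<close> controls the evaluation, so the value of the supremum passes to the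
            limit \<open>\<xi>\<close>.\<close>
          let ?M = "insert h0 B"
          have "lcs_bounded (Ck X) ?M"
          proof (rule lcs_bounded_CkI)
            show "?M \<subseteq> cont_funs X" using BC h0C by blast
            fix L assume L: "compactin X L"
            obtain c where c: "c > 0" "\<And>h x. h \<in> B \<Longrightarrow> x \<in> L \<Longrightarrow> \<bar>h x\<bar> \<le> c"
              using lcs_bounded_CkD[OF B L] by blast
            obtain M where "M > 0" "\<And>x. x \<in> L \<Longrightarrow> \<bar>h0 x\<bar> < M" using cont_fun_bounded[OF h0C L] by blast
            then show "\<exists>c>0. \<forall>h\<in>?M. \<forall>x\<in>L. \<bar>h x\<bar> \<le> c"
              using c by (intro exI[of _ "max c M"]) (auto simp: le_max_iff_disj intro: less_imp_le)
          qed
          from shrink[OF this _, of "r / 3"] r obtain \<alpha> where \<alpha>: "\<alpha> > 0"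
            "\<forall>\<nu>\<in>K. f h0 - \<alpha> < F \<nu> + \<nu> h0 \<longrightarrow> (\<forall>h\<in>?M. \<bar>\<nu> h - \<xi> h\<bar> \<le> r / 3)" by auto
          obtain \<nu> where \<nu>: "\<nu> \<in> K" "f h0 - min \<alpha> (r / 3) < F \<nu> + \<nu> h0"
            using fslice[OF h0C, of "min \<alpha> (r / 3)"] \<alpha>(1) r by auto
          then have near: "\<And>h. h \<in> ?M \<Longrightarrow> \<bar>\<nu> h - \<xi> h\<bar> \<le> r / 3" using \<alpha>(2) by auto
          have \<nu>V: "\<nu> \<in> ?V" using \<nu> KV by blast
          have "\<bar>F (\<nu> - \<xi>)\<bar> \<le> r / 3"
            using near r by (intro Fle subspace_diff[OF subspace_dual_space \<nu>V \<xi>]) auto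
          then have "\<bar>F \<nu> - F \<xi>\<bar> \<le> r / 3" using Fdiff[OF \<nu>V \<xi>] by simp
          moreover have "\<bar>\<nu> h0 - \<xi> h0\<bar> \<le> r / 3" using near by blast
          moreover have "f h0 - r / 3 < F \<nu> + \<nu> h0" using \<nu>(2) by linarith
          ultimately show "f h0 \<le> F \<xi> + \<xi> h0 + r" by linarith
        qed
        \<comment> \<open>A functional attaining the supremum lies in all slices, and these shrink
          to \<open>\<xi>\<close> at every \<open>h\<close>.\<close>
        have unique: "a = \<xi>" if a: "a \<in> K" "f h0 \<le> F a + a h0" for a
        proof
          fix h
          show "a h = \<xi> h"
          proof (cases "h \<in> cont_funs X")
            case True
            have "\<bar>a h - \<xi> h\<bar> \<le> r" if r: "r > 0" for r
            proof -
              have "lcs_bounded (Ck X) {h}" using True by (intro lcs_bounded_finite) auto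
              from shrink[OF this _ r] obtain \<alpha> where "\<alpha> > 0"
                "\<forall>\<nu>\<in>K. f h0 - \<alpha> < F \<nu> + \<nu> h0 \<longrightarrow> \<bar>\<nu> h - \<xi> h\<bar> \<le> r" by auto
              then show ?thesis using a by auto
            qed
            then show ?thesis using field_le_epsilon[of "\<bar>a h - \<xi> h\<bar>" 0] by auto
          next
            case False
            then show ?thesis using dual_space_Ck_outside[of a X h] dual_space_Ck_outside[OF \<xi>] a(1) KV by auto
          qed
        qed
        \<comment> \<open>If \<open>\<xi>\<close> lies strictly between \<open>a\<close> and
          \<open>b\<close>, both must attain the maximum of the affine function
          \<open>\<nu> \<mapsto> F \<nu> + \<nu> h0\<close>, so both equal
          \<open>\<xi>\<close>.\<close>
        have "\<xi> extreme_point_of K"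
          unfolding extreme_point_of_def
        proof (intro conjI ballI \<xi>K notI)
          fix a b assume ab: "a \<in> K" "b \<in> K" "\<xi> \<in> open_segment a b"
          then obtain u where u: "0 < u" "u < 1" "\<xi> = (1 - u) *\<^sub>R a + u *\<^sub>R b" and "a \<noteq> b"
            by (auto simp: in_segment)
          have aV: "a \<in> ?V" and bV: "b \<in> ?V" using ab KV by auto
          have "F ((1 - u) *\<^sub>R a + u *\<^sub>R b) = F ((1 - u) *\<^sub>R a) + F (u *\<^sub>R b)"
            using F subspace_scale[OF subspace_dual_space aV] subspace_scale[OF subspace_dual_space bV]
            unfolding linear_on_set_def by blast
          also have "\<dots> = (1 - u) * F a + u * F b"
            using F aV bV unfolding linear_on_set_def by simp
          finally have "F ((1 - u) *\<^sub>R a + u *\<^sub>R b) = (1 - u) * F a + u * F b" .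
          then have val: "F \<xi> + \<xi> h0 = (1 - u) * (F a + a h0) + u * (F b + b h0)"
            unfolding u(3) by (simp add: algebra_simps)
          have le: "F a + a h0 \<le> f h0" "F b + b h0 \<le> f h0" using fge[OF h0C] ab by auto
          have "f h0 \<le> F a + a h0"
          proof (rule ccontr)
            assume "\<not> ?thesis"
            then have "(1 - u) * (F a + a h0) < (1 - u) * f h0" using u by simp
            moreover have "u * (F b + b h0) \<le> u * f h0" using u le by (intro mult_left_mono) auto
            ultimately have "F \<xi> + \<xi> h0 < (1 - u) * f h0 + u * f h0" using val by linarith
            then show False using max by (simp add: algebra_simps)
          qed
          moreover have "f h0 \<le> F b + b h0"
          proof (rule ccontr)
            assume "\<not> ?thesis"
            then have "u * (F b + b h0) < u * f h0" using u by simp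
            moreover have "(1 - u) * (F a + a h0) \<le> (1 - u) * f h0" using u le by (intro mult_left_mono) auto
            ultimately have "F \<xi> + \<xi> h0 < (1 - u) * f h0 + u * f h0" using val by linarith
            then show False using max by (simp add: algebra_simps)
          qed
          ultimately have "a = b" using unique ab by metis
          then show False using \<open>a \<noteq> b\<close> by blast
        qed
        then have "\<xi> \<in> ?H" by (simp add: hull_inc)
        then have "F \<xi> + e \<le> F \<mu>" by (rule Fsep)
        moreover have "F \<mu> + \<mu> h0 \<le> F \<xi> + \<xi> h0" using fge[OF h0C \<mu>] max by linarith
        moreover have "\<bar>\<xi> h0\<bar> \<le> C * \<eta>" "\<bar>\<mu> h0\<bar> \<le> C * \<eta>"
          using \<eta> h0b dominatedD(5)[OF dom[OF \<xi>K] h0C, of \<eta>] dominatedD(5)[OF dom[OF \<mu>] h0C, of \<eta>]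
          by (auto intro: less_imp_le)
        ultimately show False using \<eta>e by linarith
      qed
    qed
  qed
qed

section \<open>Compact sets that are not scattered\<close>

lemma cont_funs_interpolation:
  assumes X: "tychonoff_space X" and F: "finite F" "F \<subseteq> topspace X"
  shows "\<exists>g\<in>cont_funs X. \<forall>x\<in>F. g x = v x"
  using F
proof (induction F)
  case empty
  show ?case using cont_funs_0 by blast
next
  case (insert x F)
  then obtain g where g: "g \<in> cont_funs X" "\<forall>x\<in>F. g x = v x" by auto
  have cr: "completely_regular_space X" and H: "Hausdorff_space X"
    using X by (simp_all add: tychonoff_space_def)
  have F: "x \<in> topspace X" "F \<subseteq> topspace X" using insert.prems by auto
  obtain b where b: "b \<in> cont_funs X" "b x = 1" "\<And>y. y \<in> F \<Longrightarrow> b y = 0"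
    by (rule cont_funs_bump[OF cr closedin_Hausdorff_finite[OF H F(2) insert.hyps(1)] F(1) insert.hyps(2)]) (rule that)
  let ?g = "g + (v x - g x) *\<^sub>R b"
  have "?g \<in> cont_funs X" using g b by (simp add: cont_funs_add cont_funs_scaleR)
  moreover have "\<forall>y\<in>insert x F. ?g y = v y" using g b insert.hyps by auto
  ultimately show ?case by blast
qed

definition dense_in_itself :: "'a topology \<Rightarrow> 'a set \<Rightarrow> bool"
  where "dense_in_itself X P \<longleftrightarrow>
    (\<forall>U. openin X U \<longrightarrow> U \<inter> P \<noteq> {} \<longrightarrow> (\<exists>p\<in>U \<inter> P. \<exists>q\<in>U \<inter> P. p \<noteq> q))"

lemma not_scattered_dense_in_itself:
  assumes K: "compactin X K" and ns: "\<not> scattered_space (subtopology X K)"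
  obtains P where "P \<subseteq> K" "P \<noteq> {}" "dense_in_itself X P"
proof -
  have "topspace (subtopology X K) = K" using compactin_subset_topspace[OF K] by auto
  then obtain P where P: "P \<subseteq> K" "P \<noteq> {}"
    and iso: "\<And>x. x \<in> P \<Longrightarrow> \<not> openin (subtopology (subtopology X K) P) {x}"
    using ns unfolding scattered_space_def by auto
  have "dense_in_itself X P"
    unfolding dense_in_itself_def
  proof (intro allI impI)
    fix U assume U: "openin X U" "U \<inter> P \<noteq> {}"
    then obtain p where p: "p \<in> U \<inter> P" by blast
    have "U \<inter> P \<noteq> {p}"
    proof
      assume "U \<inter> P = {p}"
      then have "openin (subtopology X P) {p}" using U(1) by (metis openin_subtopology)
      moreover have "subtopology (subtopology X K) P = subtopology X P"
        using P(1) by (simp add: subtopology_subtopology Int_absorb1)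
      ultimately show False using iso p by auto
    qed
    then show "\<exists>p\<in>U \<inter> P. \<exists>q\<in>U \<inter> P. p \<noteq> q" using p by blast
  qed
  then show thesis using that P by blast
qed

definition point_eval :: "'a topology \<Rightarrow> 'a \<Rightarrow> ('a \<Rightarrow> real) \<Rightarrow> real"
  where "point_eval X t = (\<lambda>f. if f \<in> cont_funs X then f t else 0)"

lemma point_eval_dominated:
  assumes "t \<in> L"
  shows "dominated X L 1 (point_eval X t)"
  using assms
  by (simp add: dominated_def linear_on_set_def point_eval_def cont_funs_add cont_funs_scaleR)

lemma dominated_equicontinuous:
  assumes L: "compactin X L" and dom: "\<And>\<nu>. \<nu> \<in> K \<Longrightarrow> dominated X L C \<nu>"
  shows "equicontinuous (Ck X) K"
  unfolding equicontinuous_def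
proof (intro ballI allI impI)
  fix h and e :: real assume h: "h \<in> topspace (Ck X)" and e: "e > 0"
  define C' where "C' = \<bar>C\<bar> + 1"
  have C': "C' > 0" "C \<le> C'" "C < C'" by (auto simp: C'_def)
  have hC: "h \<in> cont_funs X" using h by (simp add: topspace_Ck)
  have "\<bar>\<nu> g - \<nu> h\<bar> < e" if \<nu>: "\<nu> \<in> K" and g: "g \<in> uniform_nhd (cont_funs X) L (e / C') h" for \<nu> g
  proof -
    have gC: "g \<in> cont_funs X" using g by (simp add: uniform_nhd_def)
    have "\<bar>\<nu> (g - h)\<bar> \<le> C * (e / C')"
      using g e C' by (intro dominatedD(5)[OF dom[OF \<nu>] cont_funs_diff[OF gC hC]])
        (auto simp: uniform_nhd_def intro: less_imp_le)
    also have "\<dots> < C' * (e / C')" using C' e by (intro mult_strict_right_mono) auto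
    also have "\<dots> = e" using C' by simp
    finally show ?thesis using dominatedD(2)[OF dom[OF \<nu>] gC hC] by simp
  qed
  then show "\<exists>U. openin (Ck X) U \<and> h \<in> U \<and> (\<forall>\<nu>\<in>K. \<forall>g\<in>U. \<bar>\<nu> g - \<nu> h\<bar> < e)"
    using openin_uniform_nhd[OF hC L] hC e C'
    by (intro exI[of _ "uniform_nhd (cont_funs X) L (e / C') h"]) (auto simp: uniform_nhd_def)
qed

lemma unit_ball_bounded: "lcs_bounded (Ck X) {f \<in> cont_funs X. \<forall>x. \<bar>f x\<bar> \<le> 1}"
  by (rule lcs_bounded_CkI) (auto intro: exI[of _ 1])

text \<open>Each sign pattern of the first \<open>n\<close> functions defines an open set meeting
  \<open>P\<close>, which contains two points of \<open>P\<close>; the next function takes the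
  values 2 and -2 at them. Strict inequalities keep the sets open, compactness of \<open>K\<close>
  passes to infinite patterns, and truncation makes the values exactly 1 and -1.\<close>

lemma independent_sequence:
  fixes X :: "'a topology"
  assumes X: "tychonoff_space X" and K: "compactin X K" and ns: "\<not> scattered_space (subtopology X K)"
  obtains f :: "nat \<Rightarrow> 'a \<Rightarrow> real" where "\<And>n. f n \<in> cont_funs X" "\<And>n x. \<bar>f n x\<bar> \<le> 1"
    "\<And>S. \<exists>t\<in>K. \<forall>n. f n t = (if n \<in> S then 1 else - 1)"
proof -
  obtain P where P: "P \<subseteq> K" "P \<noteq> {}" "dense_in_itself X P"
    using not_scattered_dense_in_itself[OF K ns] by blast
  have KX: "K \<subseteq> topspace X" by (rule compactin_subset_topspace[OF K])
  define sg where "sg S i = (if i \<in> S then 1 else - 1 :: real)" for S and i :: nat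
  define Q where "Q g n r \<longleftrightarrow> r \<in> cont_funs X \<and>
    (\<forall>S. \<exists>t\<in>P. (\<forall>i<n. 1 < sg S i * g i t) \<and> 1 < sg S n * r t)" for g :: "nat \<Rightarrow> 'a \<Rightarrow> real" and n r
  have "\<exists>g. \<forall>n. Q g n (g n)"
  proof (rule dependent_wellorder_choice)
    fix r and f g :: "nat \<Rightarrow> 'a \<Rightarrow> real" and n assume "\<And>m. m < n \<Longrightarrow> f m = g m"
    then show "Q f n r = Q g n r" by (simp add: Q_def)
  next
    fix n and g :: "nat \<Rightarrow> 'a \<Rightarrow> real" assume IH: "\<And>m. m < n \<Longrightarrow> Q g m (g m)"
    have gC: "g i \<in> cont_funs X" if "i < n" for i using IH[OF that] by (simp add: Q_def)
    define U where "U S = {t \<in> topspace X. \<forall>i\<in>{..<n}. 1 < sg S i * g i t}" for S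
    have U_open: "openin X (U S)" for S
      unfolding U_def
    proof (cases "n = 0")
      case False
      have "openin X (\<Inter>i\<in>{..<n}. {t \<in> topspace X. sg S i * g i t \<in> {1<..}})"
        using gC False by (intro openin_INT2 openin_continuous_map_preimage[of _ euclideanreal])
          (auto simp: cont_funs_def intro!: continuous_intros)
      moreover have "(\<Inter>i\<in>{..<n}. {t \<in> topspace X. sg S i * g i t \<in> {1<..}}) =
          {t \<in> topspace X. \<forall>i\<in>{..<n}. 1 < sg S i * g i t}" using False by auto
      ultimately show "openin X {t \<in> topspace X. \<forall>i\<in>{..<n}. 1 < sg S i * g i t}" by simp
    qed simp
    have UP: "U S \<inter> P \<noteq> {}" for S
    proof (cases n)
      case 0
      then show ?thesis using P KX by (auto simp: U_def)
    next
      case (Suc m)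
      then obtain t where "t \<in> P" "\<forall>i<m. 1 < sg S i * g i t" "1 < sg S m * g m t"
        using IH[of m] unfolding Q_def by blast
      then have "t \<in> U S \<inter> P" using P(1) KX Suc by (auto simp: U_def less_Suc_eq)
      then show ?thesis by blast
    qed
    have "\<forall>S. \<exists>p q. p \<in> U S \<inter> P \<and> q \<in> U S \<inter> P \<and> p \<noteq> q"
      using P(3) U_open UP unfolding dense_in_itself_def by meson
    then obtain a b where ab: "\<And>S. a S \<in> U S \<inter> P" "\<And>S. b S \<in> U S \<inter> P" "\<And>S. a S \<noteq> b S"
      by metis
    \<comment> \<open>The open sets belonging to different patterns on \<open>{..<n}\<close> are
      disjoint, so the values prescribed at the points \<open>a S\<close> and \<open>b S\<close> do
      not conflict.\<close>
    have disj: "S = S'" if "S \<subseteq> {..<n}" "S' \<subseteq> {..<n}" "t \<in> U S" "t \<in> U S'" for S S' t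
    proof -
      have "i \<in> S \<longleftrightarrow> i \<in> S'" if "i < n" for i
      proof -
        have "1 < sg S i * g i t" "1 < sg S' i * g i t" using \<open>t \<in> U S\<close> \<open>t \<in> U S'\<close> that by (auto simp: U_def)
        then show ?thesis by (auto simp: sg_def split: if_splits)
      qed
      then show ?thesis using that by auto
    qed
    let ?F = "a ` Pow {..<n} \<union> b ` Pow {..<n}"
    have "a S \<in> topspace X" "b S \<in> topspace X" for S
      using ab(1,2)[of S] by (auto simp: U_def)
    then have "?F \<subseteq> topspace X" by blast
    then obtain r where r: "r \<in> cont_funs X" "\<forall>x\<in>?F. r x = (if x \<in> a ` Pow {..<n} then 2 else - 2)"
      using cont_funs_interpolation[OF X, of ?F "\<lambda>x. if x \<in> a ` Pow {..<n} then 2 else - 2"] by auto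
    have ra: "r (a S) = 2" if "S \<subseteq> {..<n}" for S using r(2) that by auto
    have rb: "r (b S) = - 2" if S: "S \<subseteq> {..<n}" for S
    proof -
      have "b S \<notin> a ` Pow {..<n}"
      proof
        assume "b S \<in> a ` Pow {..<n}"
        then obtain S' where S': "S' \<subseteq> {..<n}" "b S = a S'" by auto
        then have "S = S'" using disj[OF S S'(1), of "b S"] ab(1)[of S'] ab(2)[of S] by simp
        then show False using S'(2) ab(3) by metis
      qed
      then show ?thesis using r(2) S by auto
    qed
    have "\<exists>t\<in>P. (\<forall>i<n. 1 < sg S i * g i t) \<and> 1 < sg S n * r t" for S
    proof -
      let ?S = "S \<inter> {..<n}"
      have sgS: "sg ?S i = sg S i" if "i < n" for i using that by (simp add: sg_def)
      have pat: "\<forall>i<n. 1 < sg S i * g i t" if "t \<in> U ?S" for t using that sgS by (auto simp: U_def)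
      show ?thesis
      proof (cases "n \<in> S")
        case True
        then show ?thesis using ab(1)[of ?S] pat[of "a ?S"] ra[of ?S] by (intro bexI[of _ "a ?S"]) (auto simp: sg_def)
      next
        case False
        then show ?thesis using ab(2)[of ?S] pat[of "b ?S"] rb[of ?S] by (intro bexI[of _ "b ?S"]) (auto simp: sg_def)
      qed
    qed
    then show "\<exists>r. Q g n r" using r(1) unfolding Q_def by blast
  qed
  then obtain g where g: "\<And>n. Q g n (g n)" by blast
  have gC: "g n \<in> cont_funs X" for n using g[of n] by (simp add: Q_def)
  have fin: "\<exists>t\<in>K. \<forall>i\<le>n. 1 \<le> sg S i * g i t" for S n
  proof -
    obtain t where "t \<in> P" "\<forall>i<n. 1 < sg S i * g i t" "1 < sg S n * g n t" using g[of n] unfolding Q_def by blast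
    then show ?thesis using P(1) by (intro bexI[of _ t]) (auto simp: le_less)
  qed
  have inf: "\<exists>t\<in>K. \<forall>i. 1 \<le> sg S i * g i t" for S
  proof -
    define C where "C n = K \<inter> (\<Inter>i\<in>{..n}. {t \<in> topspace X. sg S i * g i t \<in> {1..}})" for n
    have "closedin (subtopology X K) (C n)" for n
    proof -
      have "closedin X (\<Inter>i\<in>{..n}. {t \<in> topspace X. sg S i * g i t \<in> {1..}})"
        using gC by (intro closedin_INT closedin_continuous_map_preimage[of _ euclideanreal])
          (auto simp: cont_funs_def intro!: continuous_intros)
      then show ?thesis unfolding C_def closedin_subtopology by blast
    qed
    moreover have "C n \<noteq> {}" for n using fin[of n S] KX by (fastforce simp: C_def)
    moreover have "C n \<subseteq> C m" if "m \<le> n" for m n using that by (auto simp: C_def)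
    moreover have "compact_space (subtopology X K)" using K by (simp add: compact_space_subtopology)
    ultimately have "(\<Inter>n. C n) \<noteq> {}" by (intro compact_space_imp_nest) (auto simp: antimono_def)
    then obtain t where "\<And>n. t \<in> C n" by blast
    then show ?thesis by (intro bexI[of _ t]) (auto simp: C_def)
  qed
  show thesis
  proof (rule that[of "\<lambda>n. truncation 1 (g n)"])
    show "truncation 1 (g n) \<in> cont_funs X" for n using gC by (simp add: cont_funs_truncation)
    show "\<bar>truncation 1 (g n) x\<bar> \<le> 1" for n x by (rule truncation_real) simp
    fix S
    obtain t where t: "t \<in> K" "\<And>i. 1 \<le> sg S i * g i t" using inf by blast
    have "truncation 1 (g n) t = (if n \<in> S then 1 else - 1)" for n
      using t(2)[of n] by (auto simp: sg_def)
    then show "\<exists>t\<in>K. \<forall>n. truncation 1 (g n) t = (if n \<in> S then 1 else - 1)" using t(1) by blast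
  qed
qed

lemma sum_fun_apply: "(\<Sum>a\<in>A. f a) x = (\<Sum>a\<in>A. f a x)"
  by (induction A rule: infinite_finite_induct) auto

lemma dominated_sum:
  assumes d: "dominated X L C \<nu>" and "finite T" "\<And>t. t \<in> T \<Longrightarrow> h t \<in> cont_funs X"
  shows "\<nu> (\<Sum>t\<in>T. h t) = (\<Sum>t\<in>T. \<nu> (h t))"
  using assms(2,3)
proof (induction T)
  case empty
  have "\<nu> 0 = 0" using d by (intro linear_on_set_0[OF _ subspace_cont_funs[of X]]) (simp add: dominated_def)
  then show ?case by (simp only: sum.empty)
next
  case (insert t T)
  have "(\<Sum>t\<in>T. h t) \<in> cont_funs X"
    using insert.prems by (intro subspace_sum[OF subspace_cont_funs]) auto
  then have 1: "\<nu> (h t + (\<Sum>t\<in>T. h t)) = \<nu> (h t) + \<nu> (\<Sum>t\<in>T. h t)"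
    using insert.prems by (intro dominatedD(1)[OF d]) auto
  have 2: "\<nu> (\<Sum>t\<in>T. h t) = (\<Sum>t\<in>T. \<nu> (h t))" using insert.prems by (intro insert.IH) auto
  show ?case unfolding sum.insert[OF insert.hyps] 1 2 ..
qed

text \<open>The Banach-Alaoglu argument: a closed subset of a product of compact intervals. Since
  \<open>b h = 0\<close> for \<open>h\<close> outside \<open>cont_funs X\<close>, those factors
  reduce to the point 0.\<close>

lemma compact_dominated:
  fixes X :: "'a topology"
  assumes L: "compactin X L"
  shows "compact {\<nu>. dominated X L C \<nu> \<and> (\<forall>h. h \<notin> cont_funs X \<longrightarrow> \<nu> h = 0)}" (is "compact ?D")
proof -
  define b where "b h = (if h \<in> cont_funs X then SOME M. M > 0 \<and> (\<forall>x\<in>L. \<bar>h x\<bar> < M) else 0)" for h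
  have b: "b h > 0" "\<And>x. x \<in> L \<Longrightarrow> \<bar>h x\<bar> < b h" if "h \<in> cont_funs X" for h
  proof -
    have "\<exists>M. M > 0 \<and> (\<forall>x\<in>L. \<bar>h x\<bar> < M)" by (rule cont_fun_bounded[OF that L]) blast
    from someI_ex[OF this] show "b h > 0" "\<And>x. x \<in> L \<Longrightarrow> \<bar>h x\<bar> < b h" using that by (auto simp: b_def)
  qed
  have "compactin (product_topology (\<lambda>_. euclideanreal) UNIV) (PiE UNIV (\<lambda>h. {- C * b h..C * b h}))"
    by (subst compactin_PiE) auto
  then have comp: "compact (PiE UNIV (\<lambda>h. {- C * b h..C * b h}))" by (simp add: euclidean_product_topology)
  have sub: "?D \<subseteq> PiE UNIV (\<lambda>h. {- C * b h..C * b h})"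
  proof
    fix \<nu> assume \<nu>: "\<nu> \<in> ?D"
    have "\<nu> h \<in> {- C * b h..C * b h}" for h
    proof (cases "h \<in> cont_funs X")
      case True
      have "\<bar>\<nu> h\<bar> \<le> C * b h"
        using \<nu> b[OF True] by (intro dominatedD(5)[OF _ True]) (auto intro: less_imp_le)
      then show ?thesis by auto
    qed (use \<nu> in \<open>simp add: b_def\<close>)
    then show "\<nu> \<in> PiE UNIV (\<lambda>h. {- C * b h..C * b h})" by auto
  qed
  have eq: "?D = (\<Inter>f\<in>cont_funs X. \<Inter>g\<in>cont_funs X. {\<nu>. \<nu> (f + g) = \<nu> f + \<nu> g}) \<inter>
      (\<Inter>c. \<Inter>f\<in>cont_funs X. {\<nu>. \<nu> (c *\<^sub>R f) = c *\<^sub>R \<nu> f}) \<inter>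
      (\<Inter>h\<in>cont_funs X. \<Inter>c\<in>{c. 0 \<le> c \<and> (\<forall>x\<in>L. \<bar>h x\<bar> \<le> c)}. {\<nu>. \<bar>\<nu> h\<bar> \<le> C * c}) \<inter>
      (\<Inter>h\<in>- cont_funs X. {\<nu>. \<nu> h = 0})"
    unfolding dominated_def linear_on_set_def by auto
  have "closed ?D"
    unfolding eq
    by (intro closed_Int closed_INT ballI closed_Collect_eq closed_Collect_le continuous_intros continuous_on_eval)
  then have "compact (PiE UNIV (\<lambda>h. {- C * b h..C * b h}) \<inter> ?D)" using comp by (rule compact_Int_closed[rotated])
  then show ?thesis using sub by (simp add: Int_absorb1)
qed

section \<open>States and their extreme points\<close>

abbreviation unit_fun :: "'a topology \<Rightarrow> 'a \<Rightarrow> real"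
  where "unit_fun X \<equiv> \<lambda>x. if x \<in> topspace X then 1 else 0"

lemma unit_fun_cont: "unit_fun X \<in> cont_funs X"
  by (rule cont_funs_cutoff) simp

text \<open>These play the role of the probability measures on \<open>K\<close>. For nonempty
  \<open>K\<close>, the inequality \<open>\<mu> f \<le> sup f\<close> over \<open>K\<close> contains
  positivity, norm at most 1 and, with \<open>- 1\<close> in place of \<open>f\<close>,
  normalisation, and it is stable under convex combinations and pointwise limits.\<close>

definition states :: "'a topology \<Rightarrow> 'a set \<Rightarrow> (('a \<Rightarrow> real) \<Rightarrow> real) set"
  where "states X K = {\<mu>. linear_on_set (cont_funs X) \<mu> \<and> (\<forall>h. h \<notin> cont_funs X \<longrightarrow> \<mu> h = 0) \<and>
    (\<forall>f\<in>cont_funs X. \<forall>c. (\<forall>x\<in>K. f x \<le> c) \<longrightarrow> \<mu> f \<le> c)}"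

lemma states_dominated:
  assumes "\<mu> \<in> states X K"
  shows "dominated X K 1 \<mu>"
  unfolding dominated_def
proof (intro conjI ballI allI impI)
  show lin: "linear_on_set (cont_funs X) \<mu>" using assms by (simp add: states_def)
  fix h and c :: real assume h: "h \<in> cont_funs X" and c: "\<forall>x\<in>K. \<bar>h x\<bar> \<le> c"
  have "\<forall>x\<in>K. h x \<le> c" "\<forall>x\<in>K. (- h) x \<le> c" using c by (auto simp: abs_le_iff)
  then have "\<mu> h \<le> c" "\<mu> (- h) \<le> c" using assms h cont_funs_uminus[OF h] unfolding states_def by blast+
  then show "\<bar>\<mu> h\<bar> \<le> 1 * c" using linear_on_set_uminus[OF lin h] by simp
qed

lemma states_le: "\<mu> \<in> states X K \<Longrightarrow> f \<in> cont_funs X \<Longrightarrow> (\<And>x. x \<in> K \<Longrightarrow> f x \<le> c) \<Longrightarrow> \<mu> f \<le> c"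
  by (simp add: states_def)

lemma states_unit:
  assumes "\<mu> \<in> states X K" "K \<subseteq> topspace X"
  shows "\<mu> (unit_fun X) = 1"
proof -
  have d: "dominated X K 1 \<mu>" by (rule states_dominated[OF assms(1)])
  have "\<mu> (unit_fun X) \<le> 1" using assms by (intro states_le[OF assms(1) unit_fun_cont]) auto
  moreover have "\<mu> (- unit_fun X) \<le> - 1"
    using assms(2) by (intro states_le[OF assms(1) cont_funs_uminus[OF unit_fun_cont]]) auto
  ultimately show ?thesis using dominatedD(3)[OF d unit_fun_cont] by simp
qed

lemma convex_states: "convex (states X K)"
proof (rule convexI)
  fix \<mu> \<nu> and u v :: real
  assume *: "\<mu> \<in> states X K" "\<nu> \<in> states X K" "0 \<le> u" "0 \<le> v" "u + v = 1"
  have "u * \<mu> f + v * \<nu> f \<le> c" if "f \<in> cont_funs X" "\<forall>x\<in>K. f x \<le> c" for f c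
  proof -
    have "u * \<mu> f + v * \<nu> f \<le> u * c + v * c"
      using * that states_le[OF *(1), of f c] states_le[OF *(2), of f c]
      by (intro add_mono mult_left_mono) auto
    also have "\<dots> = (u + v) * c" by (simp add: algebra_simps)
    finally show ?thesis using *(5) by simp
  qed
  then show "u *\<^sub>R \<mu> + v *\<^sub>R \<nu> \<in> states X K"
    using *(1,2) by (auto simp: states_def linear_on_set_def algebra_simps)
qed

lemma compactin_states:
  assumes K: "compactin X K"
  shows "compactin (weak_star (Ck X)) (states X K)"
proof -
  let ?D = "{\<nu>. dominated X K 1 \<nu> \<and> (\<forall>h. h \<notin> cont_funs X \<longrightarrow> \<nu> h = 0)}"
  let ?S = "\<Inter>f\<in>cont_funs X. \<Inter>c\<in>{c. \<forall>x\<in>K. f x \<le> c}. {\<mu>. \<mu> f \<le> c}"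
  have out: "\<mu> h = 0" if "\<mu> \<in> states X K" "h \<notin> cont_funs X" for \<mu> h using that by (simp add: states_def)
  have "closed ?S" by (intro closed_INT ballI closed_Collect_le continuous_intros continuous_on_eval)
  then have "compact (?D \<inter> ?S)" using compact_dominated[OF K] by (rule compact_Int_closed[rotated])
  moreover have "?D \<inter> ?S = states X K"
  proof
    show "?D \<inter> ?S \<subseteq> states X K" by (auto simp: states_def dominated_def)
    show "states X K \<subseteq> ?D \<inter> ?S" using states_dominated out states_le by blast
  qed
  moreover have "states X K \<subseteq> dual_space (Ck X)"
    using dominated_in_dual[OF K states_dominated] out by blast
  ultimately show ?thesis by (simp add: compactin_weak_star)
qed

lemma point_eval_states: "t \<in> K \<Longrightarrow> point_eval X t \<in> states X K"
  using point_eval_dominated[of t K X] unfolding states_def dominated_def by (auto simp: point_eval_def)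

text \<open>Extremality forces zero variance: \<open>\<mu> k = 0\<close> implies that
  \<open>\<mu>\<close> vanishes at the square of \<open>k\<close>. If \<open>\<mu>\<close> were no
  evaluation, each point of \<open>K\<close> would have some \<open>k\<close> in the kernel of
  \<open>\<mu>\<close> not vanishing there; finitely many squares then sum to a function positive on
  \<open>K\<close> that \<open>\<mu>\<close> annihilates.\<close>

lemma extreme_state_imp_point_eval:
  fixes X :: "'a topology"
  assumes K: "compactin X K" "K \<noteq> {}" and \<mu>: "\<mu> extreme_point_of (states X K)"
  obtains t where "t \<in> K" "\<mu> = point_eval X t"
proof -
  have KX: "K \<subseteq> topspace X" by (rule compactin_subset_topspace[OF K(1)])
  have \<mu>S: "\<mu> \<in> states X K" using \<mu> by (simp add: extreme_point_of_def)
  have d: "dominated X K 1 \<mu>" by (rule states_dominated[OF \<mu>S])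
  have unit: "\<mu> (unit_fun X) = 1" by (rule states_unit[OF \<mu>S KX])
  have sq: "\<mu> (\<lambda>x. k x * k x) = 0" if k: "k \<in> cont_funs X" "\<mu> k = 0" for k
  proof -
    obtain M where M: "M > 0" "\<And>x. x \<in> K \<Longrightarrow> \<bar>k x\<bar> < M" using cont_fun_bounded[OF k(1) K(1)] by blast
    \<comment> \<open>On \<open>K\<close> one has \<open>0 \<le> g \<le> 1\<close> and \<open>\<mu> g = 1 / 2\<close>, so \<open>\<mu>\<close> is the midpoint of the states
      \<open>2 \<mu> (g \<cdot>)\<close> and \<open>2 \<mu> ((1 - g) \<cdot>)\<close>.\<close>
    define g where "g = (1 / (2 * M)) *\<^sub>R k + (1 / 2) *\<^sub>R unit_fun X"
    have gC: "g \<in> cont_funs X" unfolding g_def by (intro cont_funs_add cont_funs_scaleR k unit_fun_cont)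
    have g01: "0 \<le> g x" "g x \<le> 1" if "x \<in> K" for x
      using M(1) M(2)[OF that] KX that by (auto simp: g_def field_simps)
    have gf: "(\<lambda>x. g x * f x) \<in> cont_funs X" if "f \<in> cont_funs X" for f by (rule cont_funs_mult[OF gC that])
    have \<mu>g: "\<mu> g = 1 / 2"
    proof -
      have "\<mu> g = \<mu> ((1 / (2 * M)) *\<^sub>R k) + \<mu> ((1 / 2) *\<^sub>R unit_fun X)" unfolding g_def
        by (intro dominatedD(1)[OF d] cont_funs_scaleR k unit_fun_cont)
      then show ?thesis using k dominatedD(4)[OF d k(1)] dominatedD(4)[OF d unit_fun_cont] unit by simp
    qed
    define \<mu>1 where "\<mu>1 f = (if f \<in> cont_funs X then 2 * \<mu> (\<lambda>x. g x * f x) else 0)" for f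
    define \<mu>2 where "\<mu>2 = 2 *\<^sub>R \<mu> - \<mu>1"
    have lin1: "linear_on_set (cont_funs X) \<mu>1"
      unfolding linear_on_set_def
    proof (intro conjI ballI allI)
      fix f h assume fh: "f \<in> cont_funs X" "h \<in> cont_funs X"
      have "\<mu> (\<lambda>x. g x * (f + h) x) = \<mu> ((\<lambda>x. g x * f x) + (\<lambda>x. g x * h x))"
        by (rule arg_cong[of _ _ \<mu>]) (simp add: fun_eq_iff distrib_left)
      then show "\<mu>1 (f + h) = \<mu>1 f + \<mu>1 h"
        using fh cont_funs_add[OF fh] dominatedD(1)[OF d gf[OF fh(1)] gf[OF fh(2)]] by (simp add: \<mu>1_def)
    next
      fix c f assume f: "f \<in> cont_funs X"
      have "\<mu> (\<lambda>x. g x * (c *\<^sub>R f) x) = \<mu> (c *\<^sub>R (\<lambda>x. g x * f x))"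
        by (rule arg_cong[of _ _ \<mu>]) (simp add: fun_eq_iff)
      then show "\<mu>1 (c *\<^sub>R f) = c *\<^sub>R \<mu>1 f"
        using f cont_funs_scaleR[OF f] dominatedD(4)[OF d gf[OF f]] by (simp add: \<mu>1_def)
    qed
    have S1: "\<mu>1 \<in> states X K"
    proof -
      have "\<mu>1 f \<le> c" if f: "f \<in> cont_funs X" "\<forall>x\<in>K. f x \<le> c" for f c
      proof -
        have "\<mu> ((\<lambda>x. g x * f x) - c *\<^sub>R g) \<le> 0"
        proof (rule states_le[OF \<mu>S])
          show "(\<lambda>x. g x * f x) - c *\<^sub>R g \<in> cont_funs X" by (intro cont_funs_diff gf f cont_funs_scaleR gC)
          fix x assume x: "x \<in> K"
          have "g x * f x \<le> g x * c" using x f g01 by (intro mult_left_mono) auto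
          then show "((\<lambda>x. g x * f x) - c *\<^sub>R g) x \<le> 0" by (simp add: mult.commute)
        qed
        then have "\<mu> (\<lambda>x. g x * f x) \<le> c * (1 / 2)"
          using dominatedD(2)[OF d gf[OF f(1)] cont_funs_scaleR[OF gC, of c]] dominatedD(4)[OF d gC] \<mu>g by simp
        then show ?thesis using f by (simp add: \<mu>1_def)
      qed
      then show ?thesis using lin1 by (auto simp: states_def \<mu>1_def)
    qed
    have S2: "\<mu>2 \<in> states X K"
    proof -
      have "linear_on_set (cont_funs X) \<mu>2"
        using lin1 d unfolding dominated_def linear_on_set_def by (auto simp: \<mu>2_def algebra_simps)
      moreover have "\<mu>2 f \<le> c" if f: "f \<in> cont_funs X" "\<forall>x\<in>K. f x \<le> c" for f c
      proof -
        have "\<mu> ((f - (\<lambda>x. g x * f x)) - c *\<^sub>R (unit_fun X - g)) \<le> 0"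
        proof (rule states_le[OF \<mu>S])
          show "(f - (\<lambda>x. g x * f x)) - c *\<^sub>R (unit_fun X - g) \<in> cont_funs X"
            by (intro cont_funs_diff gf f cont_funs_scaleR gC unit_fun_cont)
          fix x assume x: "x \<in> K"
          have "(1 - g x) * f x \<le> (1 - g x) * c" using x f g01 by (intro mult_left_mono) auto
          then show "((f - (\<lambda>x. g x * f x)) - c *\<^sub>R (unit_fun X - g)) x \<le> 0"
            using x KX by (auto simp: algebra_simps)
        qed
        moreover have "\<mu> ((f - (\<lambda>x. g x * f x)) - c *\<^sub>R (unit_fun X - g)) =
            \<mu> (f - (\<lambda>x. g x * f x)) - \<mu> (c *\<^sub>R (unit_fun X - g))"
          by (intro dominatedD(2)[OF d] cont_funs_diff gf f cont_funs_scaleR gC unit_fun_cont)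
        moreover have "\<mu> (f - (\<lambda>x. g x * f x)) = \<mu> f - \<mu> (\<lambda>x. g x * f x)"
          by (intro dominatedD(2)[OF d] gf f)
        moreover have "\<mu> (c *\<^sub>R (unit_fun X - g)) = c * \<mu> (unit_fun X - g)"
          by (intro dominatedD(4)[OF d] cont_funs_diff gC unit_fun_cont)
        moreover have "\<mu> (unit_fun X - g) = 1 / 2"
          using dominatedD(2)[OF d unit_fun_cont gC] unit \<mu>g by simp
        ultimately have "\<mu> f - \<mu> (\<lambda>x. g x * f x) \<le> c * (1 / 2)" by simp
        then show ?thesis using f by (simp add: \<mu>1_def \<mu>2_def)
      qed
      ultimately show ?thesis using \<mu>S by (auto simp: states_def \<mu>1_def \<mu>2_def)
    qed
    have mid: "\<mu> = (1 - 1 / 2) *\<^sub>R \<mu>1 + (1 / 2) *\<^sub>R \<mu>2" by (rule ext) (simp add: \<mu>2_def field_simps)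
    have "\<mu>1 = \<mu>2"
    proof (rule ccontr)
      assume "\<mu>1 \<noteq> \<mu>2"
      then have "\<mu> \<in> open_segment \<mu>1 \<mu>2"
        unfolding in_segment using mid by (intro conjI exI[of _ "1 / 2"]) auto
      then show False using \<mu> S1 S2 unfolding extreme_point_of_def by blast
    qed
    \<comment> \<open>Equal halves mean that \<open>\<mu>\<close> is multiplicative against
      \<open>g\<close>; at \<open>k\<close> this gives \<open>\<mu> (g k) = 0\<close>, and
      \<open>g k\<close> is a multiple of the square of \<open>k\<close> plus
      \<open>k / 2\<close>.\<close>
    then have "\<mu>1 k = \<mu> k" by (simp add: \<mu>2_def fun_eq_iff)
    then have 0: "\<mu> (\<lambda>x. g x * k x) = 0" using k by (simp add: \<mu>1_def)
    have kk: "(\<lambda>x. k x * k x) \<in> cont_funs X" by (rule cont_funs_mult[OF k(1) k(1)])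
    have "(\<lambda>x. g x * k x) = (1 / (2 * M)) *\<^sub>R (\<lambda>x. k x * k x) + (1 / 2) *\<^sub>R k"
      using cont_funs_outside[OF k(1)] by (auto simp: g_def fun_eq_iff algebra_simps)
    then have "\<mu> (\<lambda>x. g x * k x) = (1 / (2 * M)) * \<mu> (\<lambda>x. k x * k x) + (1 / 2) * \<mu> k"
      using dominatedD(1)[OF d cont_funs_scaleR[OF kk] cont_funs_scaleR[OF k(1)]]
        dominatedD(4)[OF d kk] dominatedD(4)[OF d k(1)] by simp
    then show ?thesis using 0 k M(1) by simp
  qed
  have "\<exists>t\<in>K. \<mu> = point_eval X t"
  proof (rule ccontr)
    assume no: "\<not> ?thesis"
    have "\<exists>k\<in>cont_funs X. \<mu> k = 0 \<and> k t \<noteq> 0" if t: "t \<in> K" for t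
    proof -
      obtain f where f: "\<mu> f \<noteq> point_eval X t f" using no t by (metis ext)
      have fC: "f \<in> cont_funs X"
      proof (rule ccontr)
        assume "f \<notin> cont_funs X"
        then have "\<mu> f = 0" "point_eval X t f = 0" using \<mu>S by (simp_all add: states_def point_eval_def)
        then show False using f by simp
      qed
      have ft: "\<mu> f \<noteq> f t" using f fC by (simp add: point_eval_def)
      \<comment> \<open>Subtracting the mean puts \<open>f\<close> into the kernel of
        \<open>\<mu>\<close>; at \<open>t\<close> the result is
        \<open>f t - \<mu> f\<close>.\<close>
      let ?k = "f - (\<mu> f) *\<^sub>R unit_fun X"
      have "?k \<in> cont_funs X" by (intro cont_funs_diff fC cont_funs_scaleR unit_fun_cont)
      moreover have "\<mu> ?k = 0"
        using dominatedD(2)[OF d fC cont_funs_scaleR[OF unit_fun_cont]] dominatedD(4)[OF d unit_fun_cont] unit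
        by simp
      moreover have "?k t \<noteq> 0" using ft t KX by auto
      ultimately show ?thesis by blast
    qed
    then obtain k where k: "\<And>t. t \<in> K \<Longrightarrow> k t \<in> cont_funs X" "\<And>t. t \<in> K \<Longrightarrow> \<mu> (k t) = 0"
      "\<And>t. t \<in> K \<Longrightarrow> k t t \<noteq> 0" by metis
    define U where "U t = {x \<in> topspace X. k t x \<in> - {0}}" for t
    have Uo: "openin X (U t)" if "t \<in> K" for t
      unfolding U_def using k(1)[OF that]
      by (intro openin_continuous_map_preimage[of _ euclideanreal]) (auto simp: cont_funs_def)
    have "K \<subseteq> \<Union>(U ` K)" using k(3) KX by (auto simp: U_def)
    then obtain \<F> where \<F>: "finite \<F>" "\<F> \<subseteq> U ` K" "K \<subseteq> \<Union>\<F>"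
      using compactinD[OF K(1), of "U ` K"] Uo by blast
    then obtain T where T: "T \<subseteq> K" "finite T" "\<F> = U ` T" by (meson finite_subset_image)
    define s where "s = (\<Sum>t\<in>T. (\<lambda>x. k t x * k t x))"
    have kk: "(\<lambda>x. k t x * k t x) \<in> cont_funs X" if "t \<in> T" for t
      using k(1) T(1) that by (intro cont_funs_mult) auto
    have sC: "s \<in> cont_funs X" unfolding s_def by (rule subspace_sum[OF subspace_cont_funs kk])
    have "\<mu> s = (\<Sum>t\<in>T. \<mu> (\<lambda>x. k t x * k t x))"
      unfolding s_def by (rule dominated_sum[OF d T(2) kk])
    also have "\<dots> = 0" using sq k(1,2) T(1) by (intro sum.neutral) blast
    finally have \<mu>s: "\<mu> s = 0" .
    have sx: "s x = (\<Sum>t\<in>T. k t x * k t x)" for x by (simp add: s_def sum_fun_apply)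
    have spos: "0 < s x" if x: "x \<in> K" for x
    proof -
      obtain t where t: "t \<in> T" "x \<in> U t" using \<F>(3) T(3) x by auto
      then have "k t x \<noteq> 0" by (simp add: U_def)
      then have "0 < k t x * k t x" using not_real_square_gt_zero by blast
      then show ?thesis unfolding sx using t(1) T(2) by (intro sum_pos2[of _ t]) auto
    qed
    have "compact (s ` K)" using image_compactin[OF K(1) cont_funs_continuous[OF sC]] by simp
    from compact_attains_inf[OF this] K(2) obtain x where x: "x \<in> K" "\<And>y. y \<in> K \<Longrightarrow> s x \<le> s y" by auto
    have "\<mu> (- s) \<le> - s x" using x by (intro states_le[OF \<mu>S cont_funs_uminus[OF sC]]) auto
    then show False using dominatedD(3)[OF d sC] \<mu>s spos[OF x(1)] by simp
  qed
  then show thesis using that by blast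
qed

text \<open>\<open>\<tau>\<close> imitates the coin-tossing measure on the Cantor set of sign
  patterns. \<open>avg N\<close> averages the evaluations at one point for each pattern of length
  \<open>N\<close>, and the bump \<open>H n t\<close> sees only patterns compatible with
  \<open>t\<close> in the first \<open>n\<close> places, a fraction of at most
  \<open>(1/2) ^ n\<close>.\<close>

lemma diffuse_state:
  fixes X :: "'a topology"
  assumes K: "compactin X K" and f: "\<And>n::nat. f n \<in> cont_funs X"
    and ind: "\<And>S. \<exists>t\<in>K. \<forall>n. f n t = (if n \<in> S then 1 else - 1)"
  obtains \<tau> where "\<tau> \<in> states X K" "\<And>n t. t \<in> K \<Longrightarrow> \<exists>h\<in>cont_funs X. h t = 1 \<and> (\<forall>x. 0 \<le> h x) \<and> \<tau> h \<le> (1/2) ^ n"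
proof -
  have KX: "K \<subseteq> topspace X" by (rule compactin_subset_topspace[OF K])
  define H where "H n t = (\<lambda>u. if u \<in> topspace X then (\<Prod>i<n. max 0 (1 - \<bar>f i u - f i t\<bar>)) else 0)"
    for n :: nat and t
  have HC: "H n t \<in> cont_funs X" for n t
    unfolding H_def using f
    by (intro cont_funs_cutoff continuous_map_prod) (auto simp: cont_funs_def intro!: continuous_intros)
  have H0: "0 \<le> H n t u" for n t u by (auto simp: H_def intro!: prod_nonneg)
  have H1: "H n t u \<le> 1" for n t u by (auto simp: H_def intro!: prod_le_1)
  have Ht: "H n t t = 1" if "t \<in> K" for n t using that KX by (auto simp: H_def)
  obtain p where p: "\<And>S. p S \<in> K" "\<And>S n. f n (p S) = (if n \<in> S then 1 else - 1)" using ind by metis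
  define avg where "avg N = (1/2) ^ N *\<^sub>R (\<Sum>S\<in>Pow {..<N}. point_eval X (p S))" for N
  have avgf: "avg N h = (1/2) ^ N * (\<Sum>S\<in>Pow {..<N}. h (p S))" if "h \<in> cont_funs X" for N h
    using that by (simp add: avg_def sum_fun_apply point_eval_def)
  have cardP: "(1/2) ^ N * real (card (Pow {..<N})) = 1" for N
    by (simp add: card_Pow power_divide)
  have avgS: "avg N \<in> states X K" for N
  proof -
    have "avg N = (\<Sum>S\<in>Pow {..<N}. (1/2) ^ N *\<^sub>R point_eval X (p S))" by (simp add: avg_def scaleR_sum_right)
    also have "\<dots> \<in> states X K"
      using point_eval_states[OF p(1)] cardP
      by (intro convex_sum convex_states) (auto simp: mult.commute)
    finally show ?thesis .
  qed
  have small: "avg N (H n t) \<le> (1/2) ^ n" if nN: "n \<le> N" for n N t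
  proof -
    \<comment> \<open>The values of \<open>f\<close> at \<open>t\<close> need not be 1 or -1. If the
      sign of \<open>f i (p S)\<close> disagrees with \<open>S0\<close>, the two values are still at
      least 1 apart, and the corresponding factor of \<open>H n t\<close> vanishes.\<close>
    define S0 where "S0 = {i. i < n \<and> 0 < f i t}"
    let ?R = "(\<lambda>R. S0 \<union> R) ` Pow {n..<N}"
    have zero: "H n t (p S) = 0" if S: "S \<in> Pow {..<N} - ?R" for S
    proof -
      have "S = S0 \<union> (S \<inter> {n..<N})" if "\<And>i. i < n \<Longrightarrow> i \<in> S \<longleftrightarrow> i \<in> S0"
        using S that by (auto simp: S0_def)
      then obtain i where i: "i < n" "i \<in> S \<longleftrightarrow> i \<notin> S0" using S by blast
      then have "1 - \<bar>f i (p S) - f i t\<bar> \<le> 0" using p(2)[of i S] by (auto simp: S0_def split: if_splits)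
      then have "max 0 (1 - \<bar>f i (p S) - f i t\<bar>) = 0" by simp
      then have "(\<Prod>i<n. max 0 (1 - \<bar>f i (p S) - f i t\<bar>)) = 0" using i(1) by (intro prod_zero) auto
      then show ?thesis by (simp add: H_def)
    qed
    have "(\<Sum>S\<in>Pow {..<N}. H n t (p S)) \<le> (\<Sum>S\<in>Pow {..<N}. if S \<in> ?R then 1 else 0)"
      using zero H1 by (intro sum_mono) auto
    also have "\<dots> = real (card (Pow {..<N} \<inter> ?R))" by (simp add: sum.If_cases)
    also have "\<dots> \<le> real (card ?R)" by (intro of_nat_mono card_mono) auto
    also have "\<dots> \<le> real (card (Pow {n..<N}))" by (intro of_nat_mono card_image_le) auto
    also have "\<dots> = 2 ^ (N - n)" by (simp add: card_Pow)
    finally have "avg N (H n t) \<le> (1/2) ^ N * 2 ^ (N - n)"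
      unfolding avgf[OF HC] by (intro mult_left_mono) auto
    also have "\<dots> = (1/2) ^ n"
    proof -
      have "(1/2::real) ^ N = (1/2) ^ n * (1/2) ^ (N - n)" using nN by (simp flip: power_add)
      then show ?thesis by (simp add: power_divide)
    qed
    finally show ?thesis .
  qed
  \<comment> \<open>\<open>avg N\<close> satisfies the estimates only for \<open>n \<le> N\<close>;
    the nested closed sets replace the choice of a limit point.\<close>
  define A where "A N = states X K \<inter> (\<Inter>n\<in>{..N}. \<Inter>t. {\<mu>. \<mu> (H n t) \<le> (1/2) ^ n})" for N :: nat
  have "(\<Inter>N. A N) \<noteq> {}"
  proof (rule compact_space_imp_nest)
    have "compact (states X K)" using compactin_states[OF K] by (simp add: compactin_weak_star)
    then show "compact_space (top_of_set (states X K))" by (simp add: compact_space_subtopology)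
    fix N
    have "closed (\<Inter>n\<in>{..N}. \<Inter>t. {\<mu>. \<mu> (H n t) \<le> (1/2 :: real) ^ n})"
      by (intro closed_INT ballI closed_Collect_le continuous_intros continuous_on_eval)
    then show "closedin (top_of_set (states X K)) (A N)" unfolding A_def by (rule closedin_closed_Int)
    have "avg N \<in> A N" using avgS small by (auto simp: A_def)
    then show "A N \<noteq> {}" by blast
  qed (auto simp: A_def antimono_def)
  then obtain \<tau> where \<tau>: "\<And>N. \<tau> \<in> A N" by blast
  show thesis
  proof (rule that)
    show "\<tau> \<in> states X K" using \<tau>[of 0] by (simp add: A_def)
    fix n t assume "t \<in> K"
    then show "\<exists>h\<in>cont_funs X. h t = 1 \<and> (\<forall>x. 0 \<le> h x) \<and> \<tau> h \<le> (1/2) ^ n"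
      using \<tau>[of n] HC[of n t] H0 Ht by (intro bexI[of _ "H n t"]) (auto simp: A_def)
  qed
qed

text \<open>A convex combination of extreme states lives on a finite set \<open>T\<close>. Bumps
  around the points of \<open>T\<close> have small \<open>\<tau>\<close>-mass, so a function in the
  unit ball equal to 1 on \<open>T\<close> separates the two by more than
  \<open>1/2\<close>.\<close>

theorem tame_imp_scattered:
  fixes X :: "'a topology"
  assumes X: "tychonoff_space X" and tame: "tame_space (Ck X)" and K: "compactin X K"
  shows "scattered_space (subtopology X K)"
proof (rule ccontr)
  assume ns: "\<not> scattered_space (subtopology X K)"
  obtain f :: "nat \<Rightarrow> 'a \<Rightarrow> real" where f: "\<And>n. f n \<in> cont_funs X"
    "\<And>S. \<exists>t\<in>K. \<forall>n. f n t = (if n \<in> S then 1 else - 1)"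
    using independent_sequence[OF X K ns] by metis
  obtain \<tau> where \<tau>: "\<tau> \<in> states X K"
    and small: "\<And>n t. t \<in> K \<Longrightarrow> \<exists>h\<in>cont_funs X. h t = 1 \<and> (\<forall>x. 0 \<le> h x) \<and> \<tau> h \<le> (1/2) ^ n"
    using diffuse_state[OF K f] by blast
  have KX: "K \<subseteq> topspace X" by (rule compactin_subset_topspace[OF K])
  have Kne: "K \<noteq> {}" using f(2) by blast
  let ?E = "{\<xi>. \<xi> extreme_point_of (states X K)}"
  let ?B = "{f \<in> cont_funs X. \<forall>x. \<bar>f x\<bar> \<le> 1}"
  have "equicontinuous (Ck X) (states X K)"
    using states_dominated by (intro dominated_equicontinuous[OF K]) auto
  then have eq: "states X K = strong_dual (Ck X) closure_of (convex hull ?E)"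
    using tame compactin_states[OF K] convex_states unfolding tame_space_def by blast
  have "?E \<subseteq> point_eval X ` K" using extreme_state_imp_point_eval[OF K Kne] by blast
  then have hull: "convex hull ?E \<subseteq> convex hull (point_eval X ` K)" by (rule hull_mono)
  have "convex hull ?E \<subseteq> states X K"
  proof -
    have "?E \<subseteq> states X K" by (auto simp: extreme_point_of_def)
    then show ?thesis using convex_states by (rule hull_minimal)
  qed
  then have HV: "convex hull ?E \<subseteq> dual_space (Ck X)"
    by (rule order_trans) (use compactin_states[OF K] in \<open>simp add: compactin_weak_star\<close>)
  have "\<tau> \<in> strong_dual (Ck X) closure_of (convex hull ?E)" using \<tau> eq by simp
  moreover have "(0::real) < 1/2" by simp
  ultimately obtain \<nu> where \<nu>: "\<nu> \<in> convex hull ?E" "\<And>b. b \<in> ?B \<Longrightarrow> \<bar>\<nu> b - \<tau> b\<bar> < 1/2"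
    using in_strong_dual_closure[OF HV, of \<tau>] unit_ball_bounded by blast
  have "\<nu> \<in> convex hull (point_eval X ` K)" using \<nu>(1) hull by blast
  then obtain S u where S: "finite S" "S \<subseteq> point_eval X ` K" "\<And>v. v \<in> S \<Longrightarrow> 0 \<le> u v" "sum u S = 1"
    "(\<Sum>v\<in>S. u v *\<^sub>R v) = \<nu>" unfolding convex_hull_explicit by blast
  obtain T where T: "T \<subseteq> K" "finite T" "S = point_eval X ` T" using S(1,2) by (meson finite_subset_image)
  \<comment> \<open>\<open>n\<close> is chosen after \<open>T\<close>, so that the bumps around all
    points of \<open>T\<close> together have \<open>\<tau>\<close>-mass below
    \<open>1/2\<close>.\<close>
  obtain n where n: "real (card T) * (1/2) ^ n < 1/2"
  proof -
    have "(\<lambda>n. real (card T) * (1/2) ^ n) \<longlonglongrightarrow> real (card T) * 0"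
      by (intro tendsto_mult_left LIMSEQ_power_zero) simp
    then have "\<forall>\<^sub>F n in sequentially. real (card T) * (1/2) ^ n < 1/2"
      by (rule order_tendstoD) simp
    then show thesis using that by (auto simp: eventually_sequentially)
  qed
  obtain h where h: "\<And>t. t \<in> K \<Longrightarrow> h t \<in> cont_funs X" "\<And>t. t \<in> K \<Longrightarrow> h t t = 1"
    "\<And>t x. t \<in> K \<Longrightarrow> 0 \<le> h t x" "\<And>t. t \<in> K \<Longrightarrow> \<tau> (h t) \<le> (1/2) ^ n"
    using small[of _ n] by metis
  define s where "s = (\<Sum>t\<in>T. h t)"
  have sx: "s x = (\<Sum>t\<in>T. h t x)" for x by (simp add: s_def sum_fun_apply)
  have hC: "h t \<in> cont_funs X" if "t \<in> T" for t using h(1) T(1) that by blast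
  have sC: "s \<in> cont_funs X" unfolding s_def by (rule subspace_sum[OF subspace_cont_funs hC])
  have s0: "0 \<le> s x" for x unfolding sx using h(3) T(1) by (intro sum_nonneg) auto
  \<comment> \<open>Overlapping bumps may add up to more than 1; the cap returns to the bounded set
    \<open>?B\<close> and keeps the value 1 on \<open>T\<close>.\<close>
  define b where "b x = min 1 (s x)" for x
  have bC: "b \<in> cont_funs X"
    unfolding b_def using cont_funs_compose[OF sC, of "\<lambda>y. min 1 y"] by (simp add: continuous_on_min)
  have bB: "b \<in> ?B" using bC s0 by (simp add: b_def)
  have d: "dominated X K 1 \<tau>" by (rule states_dominated[OF \<tau>])
  have "\<tau> s \<le> real (card T) * (1/2) ^ n"
  proof -
    have "\<tau> s = (\<Sum>t\<in>T. \<tau> (h t))" unfolding s_def by (rule dominated_sum[OF d T(2) hC])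
    also have "\<dots> \<le> (\<Sum>t\<in>T. (1/2) ^ n)" using h(4) T(1) by (intro sum_mono) auto
    finally show ?thesis by simp
  qed
  moreover have "\<tau> (b - s) \<le> 0"
    by (intro states_le[OF \<tau> cont_funs_diff[OF bC sC]]) (simp add: b_def)
  ultimately have "\<tau> b < 1/2" using dominatedD(2)[OF d bC sC] n by simp
  moreover have "\<nu> b = 1"
  proof -
    have vb: "v b = 1" if v: "v \<in> S" for v
    proof -
      obtain t where t: "t \<in> T" "v = point_eval X t" using v T(3) by blast
      have "1 \<le> s t"
      proof -
        have "h t t \<le> s t" unfolding sx using t(1) T h(3) by (intro member_le_sum) auto
        then show ?thesis using h(2) T(1) t(1) by auto
      qed
      then show ?thesis using t bC by (simp add: point_eval_def b_def)
    qed
    have "(\<Sum>v\<in>S. u v * v b) = sum u S"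
    proof (rule sum.cong[OF refl])
      fix v assume "v \<in> S"
      then show "u v * v b = u v" using vb[of v] by simp
    qed
    then have "(\<Sum>v\<in>S. u v * v b) = 1" using S(4) by simp
    then show ?thesis unfolding S(5)[symmetric] by (simp add: sum_fun_apply)
  qed
  ultimately show False using \<nu>(2)[OF bB] by simp
qed

section \<open>Copies of \<open>\<ell>\<^sub>1\<close>\<close>

lemma norm_onD:
  assumes "norm_on V n"
  shows "subspace V" and "x \<in> V \<Longrightarrow> 0 \<le> n x" and "x \<in> V \<Longrightarrow> n x = 0 \<longleftrightarrow> x = 0"
    and "x \<in> V \<Longrightarrow> n (c *\<^sub>R x) = \<bar>c\<bar> * n x"
    and "x \<in> V \<Longrightarrow> y \<in> V \<Longrightarrow> n (x + y) \<le> n x + n y"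
  using assms unfolding norm_on_def by blast+

lemma norm_on_minus_commute:
  assumes "norm_on V n" "x \<in> V" "y \<in> V"
  shows "n (x - y) = n (y - x)"
  using norm_onD(4)[OF assms(1), of "y - x" "- 1"] subspace_diff[OF norm_onD(1)[OF assms(1)] assms(3,2)] by simp

lemma openin_norm_topology:
  assumes n: "norm_on V n"
  shows "openin (norm_topology V n) U \<longleftrightarrow>
    U \<subseteq> V \<and> (\<forall>x\<in>U. \<exists>r>0. \<forall>y\<in>V. n (y - x) < r \<longrightarrow> y \<in> U)"
proof -
  interpret Metric_space V "norm_dist V n" by (rule Metric_space_norm_dist[OF n])
  have mb: "(mball x r \<subseteq> U) = (\<forall>y\<in>V. n (y - x) < r \<longrightarrow> y \<in> U)" if "x \<in> V" for x r
    using that norm_on_minus_commute[OF n that] by (auto simp: mball_def norm_dist_def subset_iff)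
  then have "(\<forall>x\<in>U. \<exists>r>0. mball x r \<subseteq> U) = (\<forall>x\<in>U. \<exists>r>0. \<forall>y\<in>V. n (y - x) < r \<longrightarrow> y \<in> U)"
    if "U \<subseteq> V" using that mb by (meson subsetD)
  then show ?thesis unfolding norm_topology_def openin_mtopology by blast
qed

lemma topspace_norm_topology: "norm_on V n \<Longrightarrow> topspace (norm_topology V n) = V"
  unfolding norm_topology_def by (rule Metric_space.topspace_mtopology[OF Metric_space_norm_dist])

lemma openin_norm_ball:
  assumes n: "norm_on V n" and x: "x \<in> V"
  shows "openin (norm_topology V n) {y \<in> V. n (y - x) < r}"
  unfolding openin_norm_topology[OF n]
proof (intro conjI ballI)
  fix y assume y: "y \<in> {y \<in> V. n (y - x) < r}"
  have "n (z - x) < r" if z: "z \<in> V" "n (z - y) < r - n (y - x)" for z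
  proof -
    have "n ((z - y) + (y - x)) \<le> n (z - y) + n (y - x)"
      using norm_onD(1)[OF n] x y z by (intro norm_onD(5)[OF n]) (auto intro: subspace_diff)
    then show ?thesis using z(2) by simp
  qed
  then show "\<exists>s>0. \<forall>z\<in>V. n (z - y) < s \<longrightarrow> z \<in> {y \<in> V. n (y - x) < r}"
    using y by (intro exI[of _ "r - n (y - x)"]) auto
qed auto

lemma norm_topology_dense:
  assumes n: "norm_on V n"
  shows "norm_topology V n closure_of C = V \<longleftrightarrow> (\<forall>x\<in>V. \<forall>r>0. \<exists>c\<in>C \<inter> V. n (c - x) < r)" (is "?l \<longleftrightarrow> ?r")
proof
  assume l: ?l
  show ?r
  proof (intro ballI allI impI)
    fix x and r :: real assume x: "x \<in> V" and r: "r > 0"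
    have "x \<in> norm_topology V n closure_of C" using l x by simp
    then have "\<forall>T. x \<in> T \<and> openin (norm_topology V n) T \<longrightarrow> (\<exists>y. y \<in> C \<and> y \<in> T)"
      unfolding in_closure_of by (elim conjE)
    moreover have "x \<in> {y \<in> V. n (y - x) < r}"
      using x r norm_onD(3)[OF n, of 0] norm_onD(1)[OF n] by (simp add: subspace_0)
    ultimately have "\<exists>y. y \<in> C \<and> y \<in> {y \<in> V. n (y - x) < r}" using openin_norm_ball[OF n x, of r]
      by (elim allE[of _ "{y \<in> V. n (y - x) < r}"]) simp
    then show "\<exists>c\<in>C \<inter> V. n (c - x) < r" by blast
  qed
next
  assume r: ?r
  have "x \<in> norm_topology V n closure_of C" if x: "x \<in> V" for x
    unfolding in_closure_of
  proof (intro conjI allI impI; (elim conjE)?)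
    show "x \<in> topspace (norm_topology V n)" using x topspace_norm_topology[OF n] by simp
    fix T assume "x \<in> T" "openin (norm_topology V n) T"
    then obtain s where "s > 0" "\<forall>y\<in>V. n (y - x) < s \<longrightarrow> y \<in> T"
      unfolding openin_norm_topology[OF n] by blast
    moreover then obtain c where "c \<in> C \<inter> V" "n (c - x) < s" using r x by blast
    ultimately show "\<exists>y. y \<in> C \<and> y \<in> T" by blast
  qed
  then show ?l using closure_of_subset_topspace[of "norm_topology V n" C] topspace_norm_topology[OF n] by blast
qed

lemma separable_norm_topology:
  assumes n: "norm_on V n"
  shows "separable_space (norm_topology V n) \<longleftrightarrow>
    (\<exists>C. countable C \<and> C \<subseteq> V \<and> (\<forall>x\<in>V. \<forall>r>0. \<exists>c\<in>C. n (c - x) < r))"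
  unfolding separable_space_def topspace_norm_topology[OF n] norm_topology_dense[OF n]
  by (metis Int_absorb2)

lemma complete_norm_onI:
  assumes n: "norm_on V n"
    and conv: "\<And>\<sigma>::nat \<Rightarrow> _. (\<And>k. \<sigma> k \<in> V) \<Longrightarrow>
      (\<And>e. e > 0 \<Longrightarrow> \<exists>N. \<forall>m\<ge>N. \<forall>k\<ge>N. n (\<sigma> m - \<sigma> k) < e) \<Longrightarrow>
      \<exists>x\<in>V. \<forall>e>0. \<exists>N. \<forall>m\<ge>N. n (\<sigma> m - x) < e"
  shows "complete_norm_on V n"
  unfolding complete_norm_on_def
proof
  interpret Metric_space V "norm_dist V n" by (rule Metric_space_norm_dist[OF n])
  show "mcomplete"
    unfolding mcomplete_def
  proof (intro allI impI)
    fix \<sigma> assume \<sigma>: "MCauchy \<sigma>"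
    then have \<sigma>V: "\<sigma> k \<in> V" for k by (auto simp: MCauchy_def)
    have cau: "\<exists>N. \<forall>m\<ge>N. \<forall>k\<ge>N. n (\<sigma> m - \<sigma> k) < e" if "e > 0" for e
      using \<sigma> that \<sigma>V unfolding MCauchy_def by (simp add: norm_dist_def)
    obtain x where x: "x \<in> V" "\<And>e. e > 0 \<Longrightarrow> \<exists>N. \<forall>m\<ge>N. n (\<sigma> m - x) < e"
      using conv[of \<sigma>, OF \<sigma>V cau] by blast
    have "limitin mtopology \<sigma> x sequentially"
      unfolding limit_metric_sequentially using x \<sigma>V by (simp add: norm_dist_def)
    then show "\<exists>x. limitin mtopology \<sigma> x sequentially" by blast
  qed
qed (rule n)

section \<open>Completeness and separability of \<open>l1\<close>\<close>

lemma l1_complete: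
  assumes \<sigma>: "\<And>k::nat. \<sigma> k \<in> l1_seqs"
    and C: "\<And>e. e > 0 \<Longrightarrow> \<exists>N. \<forall>m\<ge>N. \<forall>k\<ge>N. l1_norm (\<sigma> m - \<sigma> k) < e"
  shows "\<exists>x\<in>l1_seqs. \<forall>e>0. \<exists>N. \<forall>m\<ge>N. l1_norm (\<sigma> m - x) < e"
proof -
  note sub = norm_onD(1)[OF norm_on_l1]
  have d: "summable (\<lambda>i. \<bar>\<sigma> m i - \<sigma> k i\<bar>)" for m k
    using subspace_diff[OF sub \<sigma> \<sigma>, of m k] by (simp add: l1_seqs_def)
  have part: "(\<Sum>i<p. \<bar>\<sigma> m i - \<sigma> k i\<bar>) \<le> l1_norm (\<sigma> m - \<sigma> k)" for p m k
    unfolding l1_norm_def using sum_le_suminf[OF d, of "{..<p}" m k] by simp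
  have coord: "\<bar>\<sigma> m i - \<sigma> k i\<bar> \<le> l1_norm (\<sigma> m - \<sigma> k)" for i m k
  proof -
    have "\<bar>\<sigma> m i - \<sigma> k i\<bar> \<le> (\<Sum>i<Suc i. \<bar>\<sigma> m i - \<sigma> k i\<bar>)" by (rule member_le_sum) auto
    then show ?thesis using part[where p="Suc i" and m=m and k=k] by linarith
  qed
  have "Cauchy (\<lambda>m. \<sigma> m i)" for i
  proof (rule metric_CauchyI)
    fix e :: real assume "e > 0"
    then obtain N where "\<forall>m\<ge>N. \<forall>k\<ge>N. l1_norm (\<sigma> m - \<sigma> k) < e" using C by blast
    then show "\<exists>M. \<forall>m\<ge>M. \<forall>k\<ge>M. dist (\<sigma> m i) (\<sigma> k i) < e"
      using coord[of _ i] unfolding dist_real_def by (meson le_less_trans)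
  qed
  then have conv: "(\<lambda>m. \<sigma> m i) \<longlonglongrightarrow> lim (\<lambda>m. \<sigma> m i)" for i
    by (simp add: Cauchy_convergent_iff convergent_LIMSEQ_iff)
  define x where "x i = lim (\<lambda>m. \<sigma> m i)" for i
  \<comment> \<open>In each finite partial sum the second index tends to infinity; the bound
    \<open>e\<close> does not depend on the number of terms.\<close>
  have key: "summable (\<lambda>i. \<bar>\<sigma> m i - x i\<bar>) \<and> (\<Sum>i. \<bar>\<sigma> m i - x i\<bar>) \<le> e"
    if N: "\<forall>m\<ge>N. \<forall>k\<ge>N. l1_norm (\<sigma> m - \<sigma> k) < e" and m: "m \<ge> N" for N m e
  proof -
    have le: "(\<Sum>i<p. \<bar>\<sigma> m i - x i\<bar>) \<le> e" for p
    proof -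
      have "(\<lambda>k. \<Sum>i<p. \<bar>\<sigma> m i - \<sigma> k i\<bar>) \<longlonglongrightarrow> (\<Sum>i<p. \<bar>\<sigma> m i - x i\<bar>)"
        unfolding x_def by (intro tendsto_intros conv)
      moreover have "\<exists>M. \<forall>k\<ge>M. (\<Sum>i<p. \<bar>\<sigma> m i - \<sigma> k i\<bar>) \<le> e"
        using N m part[of m _ p] by (meson less_imp_le order_trans)
      ultimately show ?thesis by (rule LIMSEQ_le_const2)
    qed
    have s: "summable (\<lambda>i. \<bar>\<sigma> m i - x i\<bar>)" by (rule summableI_nonneg_bounded[OF _ le]) simp
    then show ?thesis using suminf_le_const[OF s le] by blast
  qed
  obtain N where N: "\<forall>m\<ge>N. \<forall>k\<ge>N. l1_norm (\<sigma> m - \<sigma> k) < 1" using C[of 1] by auto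
  have "\<sigma> N - x \<in> l1_seqs" using key[OF N order_refl] by (simp add: l1_seqs_def)
  then have "\<sigma> N - (\<sigma> N - x) \<in> l1_seqs" by (rule subspace_diff[OF sub \<sigma>])
  then have "x \<in> l1_seqs" by simp
  moreover have "\<exists>N. \<forall>m\<ge>N. l1_norm (\<sigma> m - x) < e" if e: "e > 0" for e
  proof -
    obtain N where N: "\<forall>m\<ge>N. \<forall>k\<ge>N. l1_norm (\<sigma> m - \<sigma> k) < e / 2" using C[of "e / 2"] e by auto
    have "l1_norm (\<sigma> m - x) < e" if "m \<ge> N" for m
    proof -
      have "l1_norm (\<sigma> m - x) \<le> e / 2" using key[OF N that] by (simp add: l1_norm_def)
      then show ?thesis using e by linarith
    qed
    then show ?thesis by blast
  qed
  ultimately show ?thesis by blast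
qed

lemma l1_separable: "separable_space (norm_topology l1_seqs l1_norm)"
  unfolding separable_norm_topology[OF norm_on_l1]
proof (intro exI conjI ballI allI impI)
  define q where "q l = (\<lambda>k. if k < length l then of_rat (l ! k) else 0 :: real)" for l :: "rat list"
  show "countable (range q)" by simp
  have qs: "summable (\<lambda>k. \<bar>q l k\<bar>)" for l
    by (rule summable_finite[of "{..<length l}"]) (auto simp: q_def)
  then show "range q \<subseteq> l1_seqs" by (auto simp: l1_seqs_def)
  fix x and r :: real assume x: "x \<in> l1_seqs" and r: "r > 0"
  then have sx: "summable (\<lambda>k. \<bar>x k\<bar>)" by (simp add: l1_seqs_def)
  obtain N where "norm (\<Sum>k. \<bar>x (k + N)\<bar>) < r / 2"
    using suminf_exist_split[OF _ sx, of "r / 2"] r by auto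
  then have N: "(\<Sum>k. \<bar>x (k + N)\<bar>) < r / 2" by simp
  \<comment> \<open>The \<open>N\<close> approximated coordinates contribute less than
    \<open>r / 2\<close> in total; adding 1 covers \<open>N = 0\<close>.\<close>
  define d where "d = r / 2 / (real N + 1)"
  have d: "d > 0" "real N * d < r / 2" using r by (auto simp: d_def field_simps)
  have "\<exists>p::rat. \<bar>of_rat p - x k\<bar> < d" for k
  proof -
    obtain p :: rat where "x k < of_rat p" "of_rat p < x k + d" using of_rat_dense[of "x k" "x k + d"] d(1) by auto
    then show ?thesis by (intro exI[of _ p]) auto
  qed
  then obtain p :: "nat \<Rightarrow> rat" where p: "\<And>k. \<bar>of_rat (p k) - x k\<bar> < d" by metis
  let ?q = "q (map p [0..<N])"
  have s: "summable (\<lambda>k. \<bar>?q k - x k\<bar>)"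
    by (rule summable_comparison_test'[OF summable_add[OF qs[of "map p [0..<N]"] sx], of 0]) auto
  have 1: "l1_norm (?q - x) = (\<Sum>k. \<bar>?q (k + N) - x (k + N)\<bar>) + (\<Sum>k<N. \<bar>?q k - x k\<bar>)"
    unfolding l1_norm_def using suminf_split_initial_segment[OF s, of N] by simp
  have 2: "(\<Sum>k. \<bar>?q (k + N) - x (k + N)\<bar>) = (\<Sum>k. \<bar>x (k + N)\<bar>)" by (simp add: q_def)
  have "(\<Sum>k<N. \<bar>?q k - x k\<bar>) \<le> (\<Sum>k<N. d)"
    using p by (intro sum_mono) (auto simp: q_def intro: less_imp_le)
  then have "(\<Sum>k<N. \<bar>?q k - x k\<bar>) \<le> real N * d" by simp
  then have "l1_norm (?q - x) < r" using N d(2) 1 2 by linarith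
  then show "\<exists>c\<in>range q. l1_norm (c - x) < r" by blast
qed

section \<open>Dual norms and bounded multipliers on \<open>l1\<close>\<close>

lemma dual_norm_props:
  fixes V :: "'v::real_vector set"
  assumes n: "norm_on V n"
  defines "D \<equiv> dual_space (norm_topology V n)"
  shows "norm_on D (dual_norm V n)"
    and "\<And>\<xi> x. \<xi> \<in> D \<Longrightarrow> x \<in> V \<Longrightarrow> \<bar>\<xi> x\<bar> \<le> dual_norm V n \<xi> * n x"
proof -
  note top = topspace_norm_topology[OF n] and V = norm_onD(1)[OF n]
  have DD: "D = {\<xi>. linear_on_set V \<xi> \<and> continuous_map (norm_topology V n) euclideanreal \<xi> \<and> (\<forall>x. x \<notin> V \<longrightarrow> \<xi> x = 0)}"
    by (simp add: D_def dual_space_def top)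
  let ?B = "{x \<in> V. n x \<le> 1}"
  have B0: "0 \<in> ?B" using V norm_onD(3)[OF n, of 0] by (simp add: subspace_0)
  have bdd: "bdd_above ((\<lambda>x. \<bar>\<xi> x\<bar>) ` ?B)" if \<xi>: "\<xi> \<in> D" for \<xi>
  proof -
    have lin: "linear_on_set V \<xi>" and cont: "continuous_map (norm_topology V n) euclideanreal \<xi>"
      using \<xi> by (auto simp: DD)
    have "openin (norm_topology V n) {x \<in> topspace (norm_topology V n). \<xi> x \<in> ball 0 1}"
      by (rule openin_continuous_map_preimage[OF cont]) simp
    moreover have "0 \<in> {x \<in> topspace (norm_topology V n). \<xi> x \<in> ball 0 1}"
      using linear_on_set_0[OF lin V] V by (simp add: top subspace_0)
    ultimately obtain r where r: "r > 0" "\<forall>y\<in>V. n (y - 0) < r \<longrightarrow> \<xi> y \<in> ball 0 1"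
      unfolding openin_norm_topology[OF n] top by blast
    have "\<bar>\<xi> x\<bar> \<le> 2 / r" if x: "x \<in> ?B" for x
    proof -
      have "n ((r / 2) *\<^sub>R x) = r / 2 * n x" using norm_onD(4)[OF n] x r by simp
      also have "\<dots> \<le> r / 2 * 1" using x r by (intro mult_left_mono) auto
      also have "\<dots> < r" using r by simp
      finally have "\<xi> ((r / 2) *\<^sub>R x) \<in> ball 0 1" using r(2) x V by (simp add: subspace_scale)
      then have "r / 2 * \<bar>\<xi> x\<bar> < 1" using lin x r by (simp add: linear_on_set_def abs_mult)
      then show ?thesis using r by (simp add: field_simps)
    qed
    then show ?thesis by (rule bdd_aboveI2)
  qed
  have up: "\<bar>\<xi> x\<bar> \<le> dual_norm V n \<xi>" if "\<xi> \<in> D" "x \<in> ?B" for \<xi> x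
    unfolding dual_norm_def by (rule cSUP_upper[OF that(2) bdd[OF that(1)]])
  have least: "dual_norm V n \<xi> \<le> c" if "\<And>x. x \<in> ?B \<Longrightarrow> \<bar>\<xi> x\<bar> \<le> c" for \<xi> c
    unfolding dual_norm_def using B0 that by (intro cSUP_least) auto
  show le: "\<bar>\<xi> x\<bar> \<le> dual_norm V n \<xi> * n x" if \<xi>: "\<xi> \<in> D" and x: "x \<in> V" for \<xi> x
  proof (cases "n x = 0")
    case True
    then have "x = 0" using norm_onD(3)[OF n x] by simp
    then show ?thesis using linear_on_set_0[OF _ V, of \<xi>] \<xi> True by (simp add: DD)
  next
    case False
    then have nx: "n x > 0" using norm_onD(2)[OF n x] by simp
    have "(1 / n x) *\<^sub>R x \<in> ?B" using norm_onD(4)[OF n x] V x nx by (simp add: subspace_scale)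
    then have "\<bar>\<xi> ((1 / n x) *\<^sub>R x)\<bar> \<le> dual_norm V n \<xi>" by (rule up[OF \<xi>])
    moreover have "\<xi> ((1 / n x) *\<^sub>R x) = \<xi> x / n x" using \<xi> x by (simp add: DD linear_on_set_def)
    ultimately show ?thesis using nx by (simp add: abs_divide field_simps)
  qed
  have sub: "subspace D" unfolding D_def by (rule subspace_dual_space)
  have pos: "0 \<le> dual_norm V n \<xi>" if "\<xi> \<in> D" for \<xi> using up[OF that B0] by linarith
  have scale_le: "dual_norm V n (c *\<^sub>R \<xi>) \<le> \<bar>c\<bar> * dual_norm V n \<xi>" if "\<xi> \<in> D" for c \<xi>
    using up[OF that] by (intro least) (simp add: abs_mult mult_left_mono)
  show "norm_on D (dual_norm V n)"
    unfolding norm_on_def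
  proof (intro conjI ballI allI sub)
    fix \<xi> assume \<xi>: "\<xi> \<in> D"
    show "0 \<le> dual_norm V n \<xi>" by (rule pos[OF \<xi>])
    show "dual_norm V n \<xi> = 0 \<longleftrightarrow> \<xi> = 0"
    proof
      assume z: "dual_norm V n \<xi> = 0"
      show "\<xi> = 0"
      proof
        fix x show "\<xi> x = 0 x"
          using le[OF \<xi>, of x] z \<xi> by (cases "x \<in> V") (auto simp: DD)
      qed
    next
      assume "\<xi> = 0"
      then have "dual_norm V n \<xi> \<le> 0" by (intro least) simp
      then show "dual_norm V n \<xi> = 0" using pos[OF \<xi>] by simp
    qed
  next
    fix c \<xi> assume \<xi>: "\<xi> \<in> D"
    show "dual_norm V n (c *\<^sub>R \<xi>) = \<bar>c\<bar> * dual_norm V n \<xi>"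
    proof (cases "c = 0")
      case True
      have "dual_norm V n (0 :: 'v \<Rightarrow> real) \<le> 0" by (intro least) simp
      then show ?thesis using True pos[OF subspace_0[OF sub]] by simp
    next
      case False
      have "dual_norm V n ((1 / c) *\<^sub>R (c *\<^sub>R \<xi>)) \<le> \<bar>1 / c\<bar> * dual_norm V n (c *\<^sub>R \<xi>)"
        by (rule scale_le[OF subspace_scale[OF sub \<xi>]])
      then have "\<bar>c\<bar> * dual_norm V n \<xi> \<le> dual_norm V n (c *\<^sub>R \<xi>)"
        using False by (simp add: field_simps)
      then show ?thesis using scale_le[OF \<xi>, of c] by simp
    qed
  next
    fix \<xi> \<eta> assume *: "\<xi> \<in> D" "\<eta> \<in> D"
    show "dual_norm V n (\<xi> + \<eta>) \<le> dual_norm V n \<xi> + dual_norm V n \<eta>"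
    proof (rule least)
      fix x assume "x \<in> ?B"
      then show "\<bar>(\<xi> + \<eta>) x\<bar> \<le> dual_norm V n \<xi> + dual_norm V n \<eta>"
        using up[OF *(1)] up[OF *(2)] abs_triangle_ineq[of "\<xi> x" "\<eta> x"] by fastforce
    qed
  qed
qed

lemma norm_dual_spaceI:
  assumes n: "norm_on V n" and lin: "linear_on_set V \<xi>" and out: "\<And>x. x \<notin> V \<Longrightarrow> \<xi> x = 0"
    and C: "\<And>x. x \<in> V \<Longrightarrow> \<bar>\<xi> x\<bar> \<le> C * n x"
  shows "\<xi> \<in> dual_space (norm_topology V n)"
proof -
  note top = topspace_norm_topology[OF n] and V = norm_onD(1)[OF n]
  have "continuous_map (norm_topology V n) euclideanreal \<xi>"
    unfolding continuous_map_def
  proof (intro conjI allI impI)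
    fix U :: "real set" assume "openin euclideanreal U"
    then have U: "open U" by simp
    show "openin (norm_topology V n) {x \<in> topspace (norm_topology V n). \<xi> x \<in> U}"
      unfolding openin_norm_topology[OF n] top
    proof (intro conjI ballI)
      fix x assume x: "x \<in> {x \<in> V. \<xi> x \<in> U}"
      then obtain e where e: "e > 0" "ball (\<xi> x) e \<subseteq> U" using U open_contains_ball by blast
      have "\<xi> y \<in> U" if y: "y \<in> V" "n (y - x) < e / (\<bar>C\<bar> + 1)" for y
      proof -
        have yx: "y - x \<in> V" using V x y by (simp add: subspace_diff)
        have "\<bar>\<xi> y - \<xi> x\<bar> = \<bar>\<xi> (y - x)\<bar>" using linear_on_set_diff[OF lin V y(1)] x by simp
        also have "\<dots> \<le> C * n (y - x)" by (rule C[OF yx])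
        also have "\<dots> \<le> (\<bar>C\<bar> + 1) * n (y - x)"
          using norm_onD(2)[OF n yx] by (intro mult_right_mono) auto
        also have "\<dots> < e" using y(2) by (simp add: field_simps)
        finally have "\<xi> y \<in> ball (\<xi> x) e" by (simp add: dist_real_def)
        then show ?thesis using e by blast
      qed
      then show "\<exists>r>0. \<forall>y\<in>V. n (y - x) < r \<longrightarrow> y \<in> {x \<in> V. \<xi> x \<in> U}"
        using e(1) by (intro exI[of _ "e / (\<bar>C\<bar> + 1)"]) auto
    qed auto
  qed auto
  then show ?thesis using lin out by (simp add: dual_space_def top)
qed

text \<open>The third bound is the tail of the series for the norm and does not involve
  \<open>f\<close>; it makes series of functions with coefficients in \<open>l1\<close> converge
  uniformly.\<close>

lemma l1_pairing:
  assumes x: "x \<in> l1_seqs" and f: "\<And>k. \<bar>f k\<bar> \<le> 1"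
  shows "summable (\<lambda>k. x k * f k)" and "\<bar>\<Sum>k. x k * f k\<bar> \<le> l1_norm x"
    and "\<bar>(\<Sum>k. x k * f k) - (\<Sum>k<N. x k * f k)\<bar> \<le> l1_norm x - (\<Sum>k<N. \<bar>x k\<bar>)"
proof -
  have sx: "summable (\<lambda>k. \<bar>x k\<bar>)" using x by (simp add: l1_seqs_def)
  have le: "norm (x k * f k) \<le> \<bar>x k\<bar>" for k
    using mult_left_mono[OF f, of "\<bar>x k\<bar>" k] by (simp add: abs_mult)
  show s: "summable (\<lambda>k. x k * f k)" by (rule summable_comparison_test'[OF sx, of 0]) (rule le)
  have tail: "\<bar>\<Sum>k. x (k + N) * f (k + N)\<bar> \<le> (\<Sum>k. \<bar>x (k + N)\<bar>)" for N
  proof -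
    have sN: "summable (\<lambda>k. \<bar>x (k + N)\<bar>)" by (rule summable_ignore_initial_segment[OF sx])
    have "norm (\<Sum>k. x (k + N) * f (k + N)) \<le> (\<Sum>k. \<bar>x (k + N)\<bar>)"
      by (rule norm_suminf_le[OF le sN])
    then show ?thesis by simp
  qed
  show "\<bar>\<Sum>k. x k * f k\<bar> \<le> l1_norm x" using tail[of 0] by (simp add: l1_norm_def)
  show "\<bar>(\<Sum>k. x k * f k) - (\<Sum>k<N. x k * f k)\<bar> \<le> l1_norm x - (\<Sum>k<N. \<bar>x k\<bar>)"
    using tail[of N] suminf_split_initial_segment[OF s, of N] suminf_split_initial_segment[OF sx, of N]
    unfolding l1_norm_def by simp
qed

text \<open>The sign pattern of \<open>x\<close> is attained at some \<open>t \<in> K\<close>, where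
  \<open>T x\<close> takes the value \<open>l1_norm x\<close>, and nowhere is
  \<open>\<bar>T x\<bar>\<close> larger. So convergence uniform on \<open>K\<close> alone already
  recovers the norm, and \<open>T\<close> is an embedding.\<close>

theorem not_scattered_imp_l1_copy:
  fixes X :: "'a topology"
  assumes X: "tychonoff_space X" and K: "compactin X K" and ns: "\<not> scattered_space (subtopology X K)"
  shows "contains_isomorphic_copy (Ck X) (norm_topology l1_seqs l1_norm)"
proof -
  obtain f :: "nat \<Rightarrow> 'a \<Rightarrow> real" where fC: "\<And>n. f n \<in> cont_funs X" and f1: "\<And>n x. \<bar>f n x\<bar> \<le> 1"
    and ind: "\<And>S. \<exists>t\<in>K. \<forall>n. f n t = (if n \<in> S then 1 else - 1)"
    using independent_sequence[OF X K ns] by metis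
  let ?Y = "norm_topology l1_seqs l1_norm"
  note n = norm_on_l1 and V = norm_onD(1)[OF norm_on_l1]
  note top = topspace_norm_topology[OF n]
  define T where "T x = (\<lambda>t. \<Sum>k. x k * f k t)" for x
  have TC: "T x \<in> cont_funs X" if x: "x \<in> l1_seqs" for x
  proof (rule cont_funs_uniform_limit)
    fix N
    have "(\<lambda>t. \<Sum>k<N. x k * f k t) = (\<Sum>k<N. x k *\<^sub>R f k)" by (simp add: fun_eq_iff sum_fun_apply)
    also have "\<dots> \<in> cont_funs X" by (intro subspace_sum[OF subspace_cont_funs] cont_funs_scaleR fC)
    finally show "(\<lambda>t. \<Sum>k<N. x k * f k t) \<in> cont_funs X" .
    show "\<bar>T x t - (\<Sum>k<N. x k * f k t)\<bar> \<le> l1_norm x - (\<Sum>k<N. \<bar>x k\<bar>)" for t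
      unfolding T_def by (rule l1_pairing(3)[OF x f1])
  next
    have "summable (\<lambda>k. \<bar>x k\<bar>)" using x by (simp add: l1_seqs_def)
    then have "(\<lambda>N. \<Sum>k<N. \<bar>x k\<bar>) \<longlonglongrightarrow> l1_norm x" unfolding l1_norm_def by (rule summable_LIMSEQ)
    from tendsto_diff[OF tendsto_const this, of "l1_norm x"]
    show "(\<lambda>N. l1_norm x - (\<Sum>k<N. \<bar>x k\<bar>)) \<longlonglongrightarrow> 0" by simp
  qed
  have Tadd: "T (x + y) = T x + T y" if "x \<in> l1_seqs" "y \<in> l1_seqs" for x y
    using suminf_add[OF l1_pairing(1)[OF that(1) f1] l1_pairing(1)[OF that(2) f1]]
    by (simp add: T_def fun_eq_iff distrib_right)
  have Tscale: "T (c *\<^sub>R x) = c *\<^sub>R T x" if "x \<in> l1_seqs" for c x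
    using suminf_mult[OF l1_pairing(1)[OF that f1], of c] by (simp add: T_def fun_eq_iff mult.assoc)
  have lin: "linear_on_set l1_seqs T" using Tadd Tscale by (simp add: linear_on_set_def)
  have Tdiff: "T (x - y) = T x - T y" if "x \<in> l1_seqs" "y \<in> l1_seqs" for x y
    by (rule linear_on_set_diff[OF lin V that])
  have up: "\<bar>T x t\<bar> \<le> l1_norm x" if "x \<in> l1_seqs" for x t
    unfolding T_def by (rule l1_pairing(2)[OF that f1])
  have low: "\<exists>t\<in>K. T x t = l1_norm x" for x
  proof -
    obtain t where t: "t \<in> K" "\<forall>n. f n t = (if n \<in> {k. 0 \<le> x k} then 1 else - 1)"
      using ind[of "{k. 0 \<le> x k}"] by blast
    have "x k * f k t = \<bar>x k\<bar>" for k using t(2) by auto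
    then have "T x t = l1_norm x" by (simp add: T_def l1_norm_def)
    then show ?thesis using t(1) by blast
  qed
  have inj: "inj_on T l1_seqs"
  proof (rule inj_onI)
    fix x y assume xy: "x \<in> l1_seqs" "y \<in> l1_seqs" "T x = T y"
    have d: "x - y \<in> l1_seqs" by (rule subspace_diff[OF V xy(1,2)])
    obtain t where "T (x - y) t = l1_norm (x - y)" using low by blast
    then have "l1_norm (x - y) = 0" using Tdiff[OF xy(1,2)] xy(3) by simp
    then show "x = y" using norm_onD(3)[OF n d] by simp
  qed
  have "homeomorphic_map ?Y (subtopology (Ck X) (T ` l1_seqs)) T"
  proof (rule bijective_open_imp_homeomorphic_map)
    have "continuous_map ?Y (Ck X) T"
    proof (rule continuous_map_into_Ck)
      show "T p \<in> cont_funs X" if "p \<in> topspace ?Y" for p using TC that by (simp add: top)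
      fix p L and e :: real assume p: "p \<in> topspace ?Y" and e: "e > 0"
      have pV: "p \<in> l1_seqs" using p by (simp add: top)
      let ?W = "{q \<in> l1_seqs. l1_norm (q - p) < e}"
      have "openin ?Y ?W" by (rule openin_norm_ball[OF n pV])
      moreover have "p \<in> ?W" using pV e by (simp add: l1_norm_def)
      moreover have "\<bar>T q t - T p t\<bar> < e" if q: "q \<in> ?W" for q t
        using up[OF subspace_diff[OF V _ pV], of q t] Tdiff[OF _ pV, of q] q by auto
      ultimately show "\<exists>W. openin ?Y W \<and> p \<in> W \<and> (\<forall>q\<in>W. \<forall>t\<in>L. \<bar>T q t - T p t\<bar> < e)" by blast
    qed
    then show "continuous_map ?Y (subtopology (Ck X) (T ` l1_seqs)) T"
      by (simp add: continuous_map_in_subtopology top)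
    show "open_map ?Y (subtopology (Ck X) (T ` l1_seqs)) T"
      unfolding open_map_def
    proof (intro allI impI)
      fix U assume U: "openin ?Y U"
      have UV: "U \<subseteq> l1_seqs" using openin_subset[OF U] by (simp add: top)
      show "openin (subtopology (Ck X) (T ` l1_seqs)) (T ` U)"
      proof (subst openin_subopen, intro ballI)
        fix g assume "g \<in> T ` U"
        then obtain x where x: "x \<in> U" "g = T x" by blast
        have xV: "x \<in> l1_seqs" using x UV by blast
        obtain r where r: "r > 0" "\<forall>y\<in>l1_seqs. l1_norm (y - x) < r \<longrightarrow> y \<in> U"
          using U x(1) unfolding openin_norm_topology[OF n] by blast
        let ?N = "uniform_nhd (cont_funs X) K r (T x)"
        have "?N \<inter> T ` l1_seqs \<subseteq> T ` U"
        proof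
          fix h assume "h \<in> ?N \<inter> T ` l1_seqs"
          then obtain y where y: "y \<in> l1_seqs" "h = T y" "T y \<in> ?N" by blast
          obtain t where t: "t \<in> K" "T (y - x) t = l1_norm (y - x)" using low by blast
          have "\<bar>T y t - T x t\<bar> < r" using y(3) t(1) by (simp add: uniform_nhd_def)
          then have "l1_norm (y - x) < r" using t(2) Tdiff[OF y(1) xV] by simp
          then show "h \<in> T ` U" using r(2) y by blast
        qed
        moreover have "openin (subtopology (Ck X) (T ` l1_seqs)) (?N \<inter> T ` l1_seqs)"
          by (rule openin_subtopology_Int[OF openin_uniform_nhd[OF TC[OF xV] K]])
        moreover have "g \<in> ?N \<inter> T ` l1_seqs" using x(2) xV TC[OF xV] r(1) by (simp add: uniform_nhd_def)
        ultimately show "\<exists>W. openin (subtopology (Ck X) (T ` l1_seqs)) W \<and> g \<in> W \<and> W \<subseteq> T ` U" by blast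
      qed
    qed
    show "T ` topspace ?Y = topspace (subtopology (Ck X) (T ` l1_seqs))"
      using TC by (auto simp: top topspace_Ck)
    show "inj_on T (topspace ?Y)" using inj by (simp add: top)
  qed
  then have "embedding_map ?Y (Ck X) T" by (simp add: embedding_map_def top)
  then show ?thesis unfolding contains_isomorphic_copy_def using lin by (auto simp: top)
qed

text \<open>The norm of \<open>l1\<close> is transported to \<open>V\<close> along the inverse
  \<open>R\<close> of the embedding. The sequences of zeros and ones define functionals on
  \<open>V\<close> at mutual distance at least 1, one for each set of natural numbers.\<close>

theorem l1_copy_imp_nonseparable_dual:
  fixes E :: "'v::real_vector topology"
  assumes "contains_isomorphic_copy E (norm_topology l1_seqs l1_norm)"
  shows "\<exists>V n. banach_subspace E V n \<and> separable_space (subtopology E V) \<and>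
    \<not> separable_space (norm_topology (dual_space (subtopology E V)) (dual_norm V n))"
proof -
  let ?Y = "norm_topology l1_seqs l1_norm"
  note nl = norm_on_l1 and Vl = norm_onD(1)[OF norm_on_l1]
  have top: "topspace ?Y = l1_seqs" by (rule topspace_norm_topology[OF nl])
  obtain T where lin: "linear_on_set l1_seqs T" and emb: "embedding_map ?Y E T"
    using assms unfolding contains_isomorphic_copy_def top by blast
  define V where "V = T ` l1_seqs"
  have hom: "homeomorphic_map ?Y (subtopology E V) T"
    using emb by (simp add: embedding_map_def top V_def)
  have inj: "inj_on T l1_seqs" using homeomorphic_imp_injective_map[OF hom] by (simp add: top)
  have topV: "topspace (subtopology E V) = V"
    using homeomorphic_imp_surjective_map[OF hom] unfolding top V_def[symmetric] by (rule sym)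
  define R where "R = inv_into l1_seqs T"
  have RT: "R (T x) = x" if "x \<in> l1_seqs" for x using inj that by (simp add: R_def)
  have Rl: "R y \<in> l1_seqs" and TR: "T (R y) = y" if "y \<in> V" for y
    using that by (auto simp: R_def V_def inv_into_into f_inv_into_f)
  have Tadd: "T (x + y) = T x + T y" if "x \<in> l1_seqs" "y \<in> l1_seqs" for x y
    using lin that by (simp add: linear_on_set_def)
  have Tscale: "T (c *\<^sub>R x) = c *\<^sub>R T x" if "x \<in> l1_seqs" for c x
    using lin that by (simp add: linear_on_set_def)
  have T0: "T 0 = 0" by (rule linear_on_set_0[OF lin Vl])
  have TV: "T x \<in> V" if "x \<in> l1_seqs" for x using that by (simp add: V_def)
  have subV: "subspace V"
    unfolding subspace_def
  proof (intro conjI ballI allI)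
    show "0 \<in> V" using TV[OF subspace_0[OF Vl]] T0 by simp
    fix x y assume xy: "x \<in> V" "y \<in> V"
    show "x + y \<in> V" using TV[OF subspace_add[OF Vl Rl[OF xy(1)] Rl[OF xy(2)]]] Tadd[OF Rl[OF xy(1)] Rl[OF xy(2)]] TR xy by simp
  next
    fix c x assume x: "x \<in> V"
    show "c *\<^sub>R x \<in> V" using TV[OF subspace_scale[OF Vl Rl[OF x]]] Tscale[OF Rl[OF x]] TR[OF x] by simp
  qed
  have Radd: "R (x + y) = R x + R y" if "x \<in> V" "y \<in> V" for x y
    using RT[OF subspace_add[OF Vl Rl[OF that(1)] Rl[OF that(2)]]] Tadd[OF Rl[OF that(1)] Rl[OF that(2)]] TR that by simp
  have Rscale: "R (c *\<^sub>R x) = c *\<^sub>R R x" if "x \<in> V" for c x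
    using RT[OF subspace_scale[OF Vl Rl[OF that]]] Tscale[OF Rl[OF that]] TR[OF that] by simp
  have linR: "linear_on_set V R" using Radd Rscale by (simp add: linear_on_set_def)
  have Rdiff: "R (x - y) = R x - R y" if "x \<in> V" "y \<in> V" for x y by (rule linear_on_set_diff[OF linR subV that])
  have R0: "R x = 0 \<longleftrightarrow> x = 0" if "x \<in> V" for x using TR[OF that] T0 RT[OF subspace_0[OF Vl]] by metis
  define n where "n y = l1_norm (R y)" for y
  have nV: "norm_on V n"
    unfolding norm_on_def n_def
    using subV norm_onD(2-5)[OF nl] Rl Radd Rscale R0 by simp
  have topeq: "subtopology E V = norm_topology V n"
  proof -
    have "openin (subtopology E V) W \<longleftrightarrow> openin (norm_topology V n) W" if W: "W \<subseteq> V" for W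
    proof -
      define U where "U = R ` W"
      have UV: "U \<subseteq> l1_seqs" using Rl W by (auto simp: U_def)
      have TU: "T ` U = W" using TR W by (force simp: U_def image_image)
      have "openin (subtopology E V) W \<longleftrightarrow> openin ?Y U"
        using homeomorphic_map_openness[OF hom, of U] UV by (simp add: top TU)
      also have "\<dots> \<longleftrightarrow> openin (norm_topology V n) W"
        unfolding openin_norm_topology[OF nl] openin_norm_topology[OF nV]
      proof (intro iffI conjI ballI UV W; elim conjE)
        fix y assume a: "\<forall>x\<in>U. \<exists>r>0. \<forall>z\<in>l1_seqs. l1_norm (z - x) < r \<longrightarrow> z \<in> U" and y: "y \<in> W"
        then obtain r where r: "r > 0" "\<forall>z\<in>l1_seqs. l1_norm (z - R y) < r \<longrightarrow> z \<in> U" by (auto simp: U_def)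
        have "z \<in> W" if z: "z \<in> V" "n (z - y) < r" for z
        proof -
          have "R z \<in> U" using r(2) Rl[OF z(1)] z(2) Rdiff[OF z(1), of y] y W by (auto simp: n_def)
          then show ?thesis using TU TR[OF z(1)] by force
        qed
        then show "\<exists>r>0. \<forall>z\<in>V. n (z - y) < r \<longrightarrow> z \<in> W" using r(1) by blast
      next
        fix x assume a: "\<forall>y\<in>W. \<exists>r>0. \<forall>z\<in>V. n (z - y) < r \<longrightarrow> z \<in> W" and x: "x \<in> U"
        then obtain y where y: "y \<in> W" "x = R y" by (auto simp: U_def)
        obtain r where r: "r > 0" "\<forall>z\<in>V. n (z - y) < r \<longrightarrow> z \<in> W" using a y by blast
        have "z \<in> U" if z: "z \<in> l1_seqs" "l1_norm (z - x) < r" for z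
        proof -
          have "R (T z - y) = z - x" using Rdiff[OF TV[OF z(1)], of y] y W RT[OF z(1)] by auto
          then have "T z \<in> W" using r(2) TV[OF z(1)] z(2) by (simp add: n_def)
          then show ?thesis using RT[OF z(1)] by (force simp: U_def)
        qed
        then show "\<exists>r>0. \<forall>z\<in>l1_seqs. l1_norm (z - x) < r \<longrightarrow> z \<in> U" using r(1) by blast
      qed
      finally show ?thesis .
    qed
    then show ?thesis unfolding topology_eq
      by (metis openin_subset topV topspace_norm_topology[OF nV])
  qed
  have "complete_norm_on V n"
  proof (rule complete_norm_onI[OF nV])
    fix \<sigma> :: "nat \<Rightarrow> 'v" assume \<sigma>: "\<And>k. \<sigma> k \<in> V"
      and C: "\<And>e. e > 0 \<Longrightarrow> \<exists>N. \<forall>m\<ge>N. \<forall>k\<ge>N. n (\<sigma> m - \<sigma> k) < e"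
    have "\<exists>x\<in>l1_seqs. \<forall>e>0. \<exists>N. \<forall>m\<ge>N. l1_norm (R (\<sigma> m) - x) < e"
    proof (rule l1_complete)
      show "R (\<sigma> k) \<in> l1_seqs" for k by (rule Rl[OF \<sigma>])
      show "\<exists>N. \<forall>m\<ge>N. \<forall>k\<ge>N. l1_norm (R (\<sigma> m) - R (\<sigma> k)) < e" if "e > 0" for e
        using C[OF that] Rdiff[OF \<sigma> \<sigma>] by (simp add: n_def)
    qed
    then obtain x where x: "x \<in> l1_seqs" "\<And>e. e > 0 \<Longrightarrow> \<exists>N. \<forall>m\<ge>N. l1_norm (R (\<sigma> m) - x) < e" by blast
    have "n (\<sigma> m - T x) = l1_norm (R (\<sigma> m) - x)" for m
      using Rdiff[OF \<sigma> TV[OF x(1)], of m] RT[OF x(1)] by (simp add: n_def)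
    then show "\<exists>x\<in>V. \<forall>e>0. \<exists>N. \<forall>m\<ge>N. n (\<sigma> m - x) < e"
      using x TV[OF x(1)] by (intro bexI[of _ "T x"]) auto
  qed
  then have "banach_subspace E V n"
    unfolding banach_subspace_def using subV topeq topV by (metis inf.cobounded1 topspace_subtopology)
  moreover have "separable_space (subtopology E V)"
    using separable_space_continuous_map_image[OF l1_separable homeomorphic_imp_continuous_map[OF hom]]
      homeomorphic_imp_surjective_map[OF hom] by blast
  moreover have "\<not> separable_space (norm_topology (dual_space (subtopology E V)) (dual_norm V n))"
  proof
    assume sep: "separable_space (norm_topology (dual_space (subtopology E V)) (dual_norm V n))"
    let ?D = "dual_space (norm_topology V n)"
    note dn = dual_norm_props[OF nV]
    have subD: "subspace ?D" using norm_onD(1)[OF dn(1)] .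
    obtain C where C: "countable C" "C \<subseteq> ?D" "\<And>x r. x \<in> ?D \<Longrightarrow> r > 0 \<Longrightarrow> \<exists>c\<in>C. dual_norm V n (c - x) < r"
      using sep[unfolded topeq separable_norm_topology[OF dn(1)]] by (elim exE conjE) (rule that, auto)
    define \<xi> where "\<xi> S y = (if y \<in> V then \<Sum>k. R y k * (if k \<in> S then 1 else 0) else 0)" for S :: "nat set" and y
    have b1: "\<bar>if k \<in> S then 1 else 0 :: real\<bar> \<le> 1" for k :: nat and S by simp
    have \<xi>D: "\<xi> S \<in> ?D" for S
    proof (rule norm_dual_spaceI[OF nV, where C=1])
      show "linear_on_set V (\<xi> S)"
        unfolding linear_on_set_def
      proof (intro conjI ballI allI)
        fix x y assume xy: "x \<in> V" "y \<in> V"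
        show "\<xi> S (x + y) = \<xi> S x + \<xi> S y"
          using suminf_add[OF l1_pairing(1)[OF Rl[OF xy(1)] b1[of _ S]] l1_pairing(1)[OF Rl[OF xy(2)] b1[of _ S]]]
            xy subspace_add[OF subV xy] Radd[OF xy] by (simp add: \<xi>_def distrib_right)
      next
        fix c x assume x: "x \<in> V"
        show "\<xi> S (c *\<^sub>R x) = c *\<^sub>R \<xi> S x"
          using suminf_mult[OF l1_pairing(1)[OF Rl[OF x] b1[of _ S]], of c] x subspace_scale[OF subV x] Rscale[OF x]
          by (simp add: \<xi>_def mult.assoc)
      qed
      show "\<xi> S x = 0" if "x \<notin> V" for x using that by (simp add: \<xi>_def)
      show "\<bar>\<xi> S x\<bar> \<le> 1 * n x" if "x \<in> V" for x
        using l1_pairing(2)[OF Rl[OF that] b1[of _ S]] that by (simp add: \<xi>_def n_def)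
    qed
    \<comment> \<open>The two functionals differ by 1 at the image of the \<open>k\<close>-th unit
      vector, which has norm 1.\<close>
    have apart: "1 \<le> dual_norm V n (\<xi> S - \<xi> S')" if k: "k \<in> S" "k \<notin> S'" for S S' k
    proof -
      define x where "x = (\<lambda>i. if i = k then 1 else 0 :: real)"
      have sx: "(\<lambda>i. \<bar>x i\<bar>) sums 1" using sums_single[of k "\<lambda>_. 1 :: real"] by (simp add: x_def if_distrib cong: if_cong)
      then have x: "x \<in> l1_seqs" "l1_norm x = 1" by (auto simp: l1_seqs_def l1_norm_def sums_iff)
      have val: "(\<Sum>i. x i * (if i \<in> S then 1 else 0)) = (if k \<in> S then 1 else 0)" for S
      proof -
        have "(\<lambda>i. x i * (if i \<in> S then 1 else 0)) = (\<lambda>i. if i = k then (if k \<in> S then 1 else 0) else 0)"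
          by (auto simp: x_def)
        then show ?thesis using sums_single[of k "\<lambda>_. if k \<in> S then 1 else 0 :: real"] by (simp add: sums_iff)
      qed
      have "\<bar>(\<xi> S - \<xi> S') (T x)\<bar> \<le> dual_norm V n (\<xi> S - \<xi> S') * n (T x)"
        by (rule dn(2)[OF subspace_diff[OF subD \<xi>D \<xi>D] TV[OF x(1)]])
      then show ?thesis using x k TV[OF x(1)] RT[OF x(1)] val by (simp add: \<xi>_def n_def)
    qed
    have "\<forall>S. \<exists>c\<in>C. dual_norm V n (c - \<xi> S) < 1/2"
    proof
      show "\<exists>c\<in>C. dual_norm V n (c - \<xi> S) < 1/2" for S by (rule C(3)[OF \<xi>D]) simp
    qed
    \<comment> \<open>Points of a dense set closer than \<open>1/2\<close> to functionals at
      distance at least 1 are distinct, so a countable dense set would make the power set of the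
      natural numbers countable.\<close>
    then obtain c where c: "\<And>S. c S \<in> C" "\<And>S. dual_norm V n (c S - \<xi> S) < 1/2" by metis
    have "inj c"
    proof (rule injI)
      fix S S' assume eq: "c S = c S'"
      have lt: "dual_norm V n (\<xi> S - \<xi> S') < 1" if "c S = c S'" for S S'
      proof -
        have d: "c S - \<xi> S' \<in> ?D" "\<xi> S - c S \<in> ?D" using c(1) C(2) \<xi>D by (auto intro: subspace_diff[OF subD])
        have "dual_norm V n ((\<xi> S - c S) + (c S - \<xi> S')) \<le> dual_norm V n (\<xi> S - c S) + dual_norm V n (c S - \<xi> S')"
          by (rule norm_onD(5)[OF dn(1) d(2,1)])
        moreover have "dual_norm V n (\<xi> S - c S) = dual_norm V n (c S - \<xi> S)"
          using c(1) C(2) by (intro norm_on_minus_commute[OF dn(1) \<xi>D]) auto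
        moreover have "(\<xi> S - c S) + (c S - \<xi> S') = \<xi> S - \<xi> S'" by simp
        ultimately show ?thesis using c(2)[of S] c(2)[of S'] that by (simp only:)
      qed
      show "S = S'"
      proof (rule ccontr)
        assume "S \<noteq> S'"
        then obtain k where "k \<in> S \<and> k \<notin> S' \<or> k \<in> S' \<and> k \<notin> S" by blast
        then show False using apart lt[OF eq] lt[OF eq[symmetric]] by fastforce
      qed
    qed
    moreover have "countable (range c)" using countable_subset[OF _ C(1)] c(1) by blast
    ultimately have "countable (UNIV :: nat set set)" by (metis countable_image_inj_on)
    then have "range (from_nat_into (UNIV :: nat set set)) = UNIV" by (intro range_from_nat_into) auto
    then show False using Cantors_theorem[of "UNIV :: nat set"] by auto
  qed
  ultimately show ?thesis by blast
qed

section \<open>Separable Banach subspaces\<close>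

text \<open>Reduction to the version without a given functional: \<open>q\<close> is the infimal
  convolution of \<open>p\<close> with \<open>\<xi>\<close>. It lies below \<open>p\<close>, and on
  \<open>V\<close> below \<open>\<xi>\<close>; a linear functional below \<open>\<xi>\<close> on the
  subspace \<open>V\<close> equals \<open>\<xi>\<close> there.\<close>

theorem hahn_banach_extension:
  fixes V W :: "'v::real_vector set"
  assumes V: "subspace V" and W: "subspace W" and VW: "V \<subseteq> W" and p: "sublinear_on W p"
    and \<xi>: "linear_on_set V \<xi>" and le: "\<And>v. v \<in> V \<Longrightarrow> \<xi> v \<le> p v"
  obtains g where "linear_on_set W g" "\<And>x. x \<in> W \<Longrightarrow> g x \<le> p x" "\<And>v. v \<in> V \<Longrightarrow> g v = \<xi> v"
    "\<And>x. x \<notin> W \<Longrightarrow> g x = 0"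
proof -
  define q where "q h = (INF v\<in>V. p (h - v) + \<xi> v)" for h
  have V0: "0 \<in> V" by (rule subspace_0[OF V])
  have low: "- p (- h) \<le> p (h - v) + \<xi> v" if h: "h \<in> W" and v: "v \<in> V" for h v
  proof -
    have mv: "- v \<in> V" by (rule subspace_neg[OF V v])
    have "p ((h - v) + (- h)) \<le> p (h - v) + p (- h)"
      using h v VW W by (intro sublinear_onD(1)[OF p]) (auto simp: subspace_diff subspace_neg)
    moreover have "(h - v) + (- h) = - v" by simp
    moreover have "\<xi> (- v) \<le> p (- v)" by (rule le[OF mv])
    ultimately show ?thesis using linear_on_set_uminus[OF \<xi> v] by simp
  qed
  have qle: "q h \<le> p (h - v) + \<xi> v" if "h \<in> W" "v \<in> V" for h v
  proof -
    have "bdd_below ((\<lambda>v. p (h - v) + \<xi> v) ` V)" by (rule bdd_belowI2[OF low[OF that(1)]])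
    from cINF_lower[OF this that(2)] show ?thesis by (simp add: q_def)
  qed
  have qge: "r \<le> q h" if "\<And>v. v \<in> V \<Longrightarrow> r \<le> p (h - v) + \<xi> v" for r h
    unfolding q_def using V0 that by (intro cINF_greatest) auto
  have "sublinear_on W q"
    unfolding sublinear_on_def
  proof (intro conjI ballI allI impI)
    fix h k assume hk: "h \<in> W" "k \<in> W"
    have *: "q (h + k) \<le> (p (h - v) + \<xi> v) + (p (k - u) + \<xi> u)" if vu: "v \<in> V" "u \<in> V" for v u
    proof -
      have "q (h + k) \<le> p ((h + k) - (v + u)) + \<xi> (v + u)"
        by (rule qle[OF subspace_add[OF W hk] subspace_add[OF V vu]])
      moreover have "(h + k) - (v + u) = (h - v) + (k - u)" by simp
      moreover have "p ((h - v) + (k - u)) \<le> p (h - v) + p (k - u)"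
        using hk vu VW W by (intro sublinear_onD(1)[OF p]) (auto simp: subspace_diff)
      moreover have "\<xi> (v + u) = \<xi> v + \<xi> u" using \<xi> vu by (simp add: linear_on_set_def)
      ultimately show ?thesis by simp
    qed
    have "q (h + k) - (p (h - v) + \<xi> v) \<le> q k" if "v \<in> V" for v
      using *[OF that] by (intro qge) (simp add: algebra_simps)
    then have "q (h + k) - q k \<le> q h" by (intro qge) (simp add: algebra_simps)
    then show "q (h + k) \<le> q h + q k" by simp
  next
    fix c :: real and h assume c: "c > 0" and h: "h \<in> W"
    have "q (c *\<^sub>R h) \<le> c * (p (h - v) + \<xi> v)" if v: "v \<in> V" for v
    proof -
      have "q (c *\<^sub>R h) \<le> p (c *\<^sub>R h - c *\<^sub>R v) + \<xi> (c *\<^sub>R v)"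
        by (rule qle[OF subspace_scale[OF W h] subspace_scale[OF V v]])
      moreover have "c *\<^sub>R h - c *\<^sub>R v = c *\<^sub>R (h - v)" by (simp add: algebra_simps)
      moreover have "p (c *\<^sub>R (h - v)) \<le> c * p (h - v)"
        using h v VW W by (intro sublinear_onD(2)[OF p c]) (auto simp: subspace_diff)
      moreover have "\<xi> (c *\<^sub>R v) = c * \<xi> v" using \<xi> v by (simp add: linear_on_set_def)
      ultimately show ?thesis by (simp add: distrib_left)
    qed
    then have "q (c *\<^sub>R h) / c \<le> q h" using c by (intro qge) (simp add: field_simps)
    then show "q (c *\<^sub>R h) \<le> c * q h" using c by (simp add: field_simps)
  qed
  then obtain g where g: "linear_on_set W g" "\<And>x. x \<in> W \<Longrightarrow> g x \<le> q x" "\<And>x. x \<notin> W \<Longrightarrow> g x = 0"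
    using hahn_banach_sublinear[OF W] by blast
  have p0: "p 0 = 0" by (rule sublinear_on_0[OF W p])
  have gV: "g v \<le> \<xi> v" if v: "v \<in> V" for v
  proof -
    have "g v \<le> q v" using g(2) v VW by blast
    also have "q v \<le> p (v - v) + \<xi> v" using v VW by (intro qle) auto
    finally show ?thesis using p0 by simp
  qed
  show thesis
  proof (rule that[OF g(1) _ _ g(3)])
    fix x assume x: "x \<in> W"
    have "q x \<le> p (x - 0) + \<xi> 0" by (rule qle[OF x V0])
    then show "g x \<le> p x" using g(2)[OF x] linear_on_set_0[OF \<xi> V] by simp
  next
    fix v assume v: "v \<in> V"
    have "g (- v) \<le> \<xi> (- v)" by (rule gV[OF subspace_neg[OF V v]])
    then have "\<xi> v \<le> g v"
      using linear_on_set_uminus[OF \<xi> v] linear_on_set_uminus[OF g(1), of v] v VW by auto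
    then show "g v = \<xi> v" using gV[OF v] by simp
  qed
qed

lemma dominated_extension:
  fixes X :: "'a topology"
  assumes L: "compactin X L" and V: "subspace V" "V \<subseteq> cont_funs X" and \<xi>: "linear_on_set V \<xi>" and C: "0 \<le> C"
    and le: "\<And>v c. v \<in> V \<Longrightarrow> 0 \<le> c \<Longrightarrow> (\<And>x. x \<in> L \<Longrightarrow> \<bar>v x\<bar> \<le> c) \<Longrightarrow> \<bar>\<xi> v\<bar> \<le> C * c"
  obtains \<nu> where "dominated X L C \<nu>" "\<And>v. v \<in> V \<Longrightarrow> \<nu> v = \<xi> v" "\<And>h. h \<notin> cont_funs X \<Longrightarrow> \<nu> h = 0"
proof -
  \<comment> \<open>Inserting 0 makes this the seminorm of uniform convergence on \<open>L\<close>
    also when \<open>L\<close> is empty.\<close>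
  define s where "s h = Sup (insert 0 ((\<lambda>x. \<bar>h x\<bar>) ` L))" for h :: "'a \<Rightarrow> real"
  have bdd: "bdd_above (insert 0 ((\<lambda>x. \<bar>h x\<bar>) ` L))" if h: "h \<in> cont_funs X" for h
  proof -
    obtain M where M: "M > 0" "\<And>x. x \<in> L \<Longrightarrow> \<bar>h x\<bar> < M" using cont_fun_bounded[OF h L] by blast
    show ?thesis by (rule bdd_aboveI[of _ M]) (use M in \<open>auto intro: less_imp_le\<close>)
  qed
  have s0: "0 \<le> s h" and sge: "x \<in> L \<Longrightarrow> \<bar>h x\<bar> \<le> s h" if h: "h \<in> cont_funs X" for h x
    unfolding s_def using bdd[OF h] by (auto intro: cSup_upper)
  have sle: "s h \<le> c" if "0 \<le> c" "\<And>x. x \<in> L \<Longrightarrow> \<bar>h x\<bar> \<le> c" for h c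
    unfolding s_def using that by (intro cSup_least) auto
  have "sublinear_on (cont_funs X) (\<lambda>h. C * s h)"
    unfolding sublinear_on_def
  proof (intro conjI ballI allI impI)
    fix h k assume hk: "h \<in> cont_funs X" "k \<in> cont_funs X"
    have "s (h + k) \<le> s h + s k"
    proof (rule sle)
      show "0 \<le> s h + s k" using s0 hk by simp
      fix x assume x: "x \<in> L"
      show "\<bar>(h + k) x\<bar> \<le> s h + s k"
        using sge[OF hk(1) x] sge[OF hk(2) x] abs_triangle_ineq[of "h x" "k x"] by simp
    qed
    then have "C * s (h + k) \<le> C * (s h + s k)" using C by (rule mult_left_mono)
    then show "C * s (h + k) \<le> C * s h + C * s k" by (simp add: distrib_left)
  next
    fix c :: real and h assume c: "c > 0" and h: "h \<in> cont_funs X"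
    have "s (c *\<^sub>R h) \<le> c * s h"
      using c s0[OF h] sge[OF h] by (intro sle) (auto simp: abs_mult)
    then have "C * s (c *\<^sub>R h) \<le> C * (c * s h)" using C by (rule mult_left_mono)
    then show "C * s (c *\<^sub>R h) \<le> c * (C * s h)" by (simp add: mult.left_commute)
  qed
  moreover have "\<xi> v \<le> C * s v" if v: "v \<in> V" for v
    using le[OF v, of "s v"] s0[of v] sge[of v] v V by fastforce
  ultimately obtain g where g: "linear_on_set (cont_funs X) g" "\<And>x. x \<in> cont_funs X \<Longrightarrow> g x \<le> C * s x"
    "\<And>v. v \<in> V \<Longrightarrow> g v = \<xi> v" "\<And>x. x \<notin> cont_funs X \<Longrightarrow> g x = 0"
    using hahn_banach_extension[OF V(1) subspace_cont_funs V(2) _ \<xi>, of "\<lambda>h. C * s h"] by blast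
  have "dominated X L C g"
    unfolding dominated_def
  proof (intro conjI ballI allI impI g(1))
    fix h :: "'a \<Rightarrow> real" and c :: real assume h: "h \<in> cont_funs X" and c: "0 \<le> c" "\<forall>x\<in>L. \<bar>h x\<bar> \<le> c"
    have "s h \<le> c" "s (- h) \<le> c" using c by (auto intro!: sle)
    then have "C * s h \<le> C * c" "C * s (- h) \<le> C * c" using C by (auto intro: mult_left_mono)
    then show "\<bar>g h\<bar> \<le> C * c"
      using g(2)[OF h] g(2)[OF cont_funs_uminus[OF h]] linear_on_set_uminus[OF g(1) h] by linarith
  qed
  then show thesis using that g by blast
qed

text \<open>A maximal \<open>e\<close>-separated set is an \<open>e\<close>-net. If such sets were
  countable for every \<open>e = 1 / Suc k\<close>, their union would be a countable dense
  set.\<close>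

lemma nonseparable_norm:
  assumes m: "norm_on D m" and ns: "\<not> separable_space (norm_topology D m)"
  obtains e A where "e > 0" "A \<subseteq> D" "uncountable A" "\<And>x y. x \<in> A \<Longrightarrow> y \<in> A \<Longrightarrow> x \<noteq> y \<Longrightarrow> e \<le> m (x - y)"
proof -
  define sep where "sep e A \<longleftrightarrow> A \<subseteq> D \<and> (\<forall>x\<in>A. \<forall>y\<in>A. x \<noteq> y \<longrightarrow> e \<le> m (x - y))" for e A
  have "\<exists>A. sep e A \<and> (\<forall>x\<in>D. \<exists>a\<in>A. m (a - x) < e)" if e: "e > 0" for e
  proof -
    have "\<exists>M\<in>{A. sep e A}. \<forall>A\<in>{A. sep e A}. M \<subseteq> A \<longrightarrow> A = M"
    proof (rule subset_Zorn')
      fix \<C> assume \<C>: "subset.chain {A. sep e A} \<C>"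
      have "e \<le> m (x - y)" if xy: "x \<in> \<Union>\<C>" "y \<in> \<Union>\<C>" "x \<noteq> y" for x y
      proof -
        obtain A B where AB: "A \<in> \<C>" "x \<in> A" "B \<in> \<C>" "y \<in> B" using xy by blast
        then have "A \<subseteq> B \<or> B \<subseteq> A" using \<C> unfolding subset.chain_def by blast
        then obtain E where "E \<in> \<C>" "x \<in> E" "y \<in> E" using AB by blast
        moreover then have "sep e E" using \<C> by (auto simp: subset.chain_def)
        ultimately show ?thesis using xy(3) by (auto simp: sep_def)
      qed
      moreover have "\<Union>\<C> \<subseteq> D" using \<C> by (auto simp: subset.chain_def sep_def)
      ultimately show "\<Union>\<C> \<in> {A. sep e A}" by (simp add: sep_def)
    qed
    then obtain M where M: "sep e M" "\<And>A. sep e A \<Longrightarrow> M \<subseteq> A \<Longrightarrow> A = M" by blast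
    have "\<exists>a\<in>M. m (a - x) < e" if x: "x \<in> D" for x
    proof (rule ccontr)
      assume no: "\<not> ?thesis"
      then have far: "e \<le> m (a - x)" if "a \<in> M" for a using that by force
      have xM: "x \<notin> M"
      proof
        assume "x \<in> M"
        then have "e \<le> m (x - x)" by (rule far)
        then show False using e norm_onD(3)[OF m, of 0] subspace_0[OF norm_onD(1)[OF m]] by simp
      qed
      have "e \<le> m (x - a)" if "a \<in> M" for a
        using far[OF that] norm_on_minus_commute[OF m x, of a] M(1) that by (auto simp: sep_def)
      then have "sep e (insert x M)" using M(1) far x by (auto simp: sep_def)
      then show False using M(2)[of "insert x M"] xM by blast
    qed
    then show ?thesis using M(1) by blast
  qed
  then have "\<forall>k::nat. \<exists>A. sep (1 / Suc k) A \<and> (\<forall>x\<in>D. \<exists>a\<in>A. m (a - x) < 1 / Suc k)" by simp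
  then obtain A where A: "\<And>k::nat. sep (1 / Suc k) (A k)" "\<And>k x. x \<in> D \<Longrightarrow> \<exists>a\<in>A k. m (a - x) < 1 / Suc k"
    by metis
  have "\<exists>k. uncountable (A k)"
  proof (rule ccontr)
    assume "\<not> ?thesis"
    then have c: "countable (\<Union>k. A k)" by simp
    have s: "(\<Union>k. A k) \<subseteq> D" using A(1) by (auto simp: sep_def)
    have d: "\<exists>c\<in>(\<Union>k. A k). m (c - x) < r" if "x \<in> D" "r > 0" for x r
    proof -
      obtain k where "inverse (real (Suc k)) < r" using reals_Archimedean[OF \<open>r > 0\<close>] by blast
      then have "1 / Suc k < r" by (simp add: inverse_eq_divide)
      then show ?thesis using A(2)[OF \<open>x \<in> D\<close>, of k] by (meson UN_I UNIV_I less_trans)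
    qed
    have "\<exists>C. countable C \<and> C \<subseteq> D \<and> (\<forall>x\<in>D. \<forall>r>0. \<exists>c\<in>C. m (c - x) < r)"
      by (intro exI[of _ "\<Union>k. A k"] conjI ballI allI impI c s d)
    then show False using ns unfolding separable_norm_topology[OF m] by contradiction
  qed
  then obtain k where k: "uncountable (A k)" by blast
  show thesis
    by (rule that[of "1 / Suc k" "A k"]) (use A(1)[of k] k in \<open>auto simp: sep_def\<close>)
qed

text \<open>Cantor-Bendixson: all points of \<open>B\<close> in basic open sets with countable trace
  on \<open>B\<close> are removed. Only countably many go, and every remaining point is a
  condensation point.\<close>

lemma uncountable_perfect_subset:
  fixes B :: "'b::second_countable_topology set"
  assumes B: "uncountable B"
  obtains B' where "B' \<subseteq> B" "B' \<noteq> {}" "\<And>b U. b \<in> B' \<Longrightarrow> open U \<Longrightarrow> b \<in> U \<Longrightarrow> \<exists>b'\<in>B' \<inter> U. b' \<noteq> b"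
proof -
  obtain \<B> :: "'b set set" where \<B>: "countable \<B>" "topological_basis \<B>"
    using ex_countable_basis by blast
  define N where "N = (\<Union>U\<in>{U \<in> \<B>. countable (U \<inter> B)}. U \<inter> B)"
  have N: "countable N" unfolding N_def using \<B>(1) by (intro countable_UN) (auto intro: countable_subset)
  have pts: "\<exists>b'\<in>(B - N) \<inter> U. b' \<noteq> b" if b: "b \<in> B - N" "open U" "b \<in> U" for b U
  proof -
    obtain U0 where U0: "U0 \<in> \<B>" "b \<in> U0" "U0 \<subseteq> U" using topological_basisE[OF \<B>(2) b(2,3)] by blast
    have "uncountable (U0 \<inter> B)" using b(1) U0 by (auto simp: N_def)
    then have "uncountable ((U0 \<inter> B) - (N \<union> {b}))" using N by (intro uncountable_minus_countable) auto
    then have "(U0 \<inter> B) - (N \<union> {b}) \<noteq> {}" by (metis countable_empty)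
    then show ?thesis using U0 by blast
  qed
  have "B - N \<noteq> {}" using uncountable_minus_countable[OF B N] by (metis countable_empty)
  then show thesis using that[of "B - N"] pts by blast
qed


text \<open>On a minimal closed set of extensions covering \<open>P\<close>, fragmentation yields an
  open piece whose members all have the same restriction to \<open>V\<close>. Removing it uncovers
  at least one point of \<open>P\<close> by minimality and at most one because the restriction is
  constant, so that point would be isolated in \<open>P\<close>.\<close>

theorem namioka_phelps_imp_separable_dual:
  fixes X :: "'a topology"
  assumes np: "namioka_phelps (Ck X)" and bs: "banach_subspace (Ck X) V n"
    and sepV: "separable_space (subtopology (Ck X) V)"
  shows "separable_space (norm_topology (dual_space (subtopology (Ck X) V)) (dual_norm V n))"
proof (rule ccontr)
  have nV: "norm_on V n" and topeq: "subtopology (Ck X) V = norm_topology V n" and VC: "V \<subseteq> cont_funs X"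
    using bs by (auto simp: banach_subspace_def complete_norm_on_def topspace_Ck)
  note V = norm_onD(1)[OF nV] and dn = dual_norm_props[OF nV]
  let ?D = "dual_space (norm_topology V n)"
  have subD: "subspace ?D" using norm_onD(1)[OF dn(1)] .
  have Dlin: "linear_on_set V \<xi>" if "\<xi> \<in> ?D" for \<xi>
    using that by (simp add: dual_space_def topspace_norm_topology[OF nV])
  assume "\<not> separable_space (norm_topology (dual_space (subtopology (Ck X) V)) (dual_norm V n))"
  then have "\<not> separable_space (norm_topology ?D (dual_norm V n))" by (simp add: topeq)
  then obtain e A where e: "e > 0" and AD: "A \<subseteq> ?D" and unc: "uncountable A"
    and Asep: "\<And>\<xi> \<eta>. \<xi> \<in> A \<Longrightarrow> \<eta> \<in> A \<Longrightarrow> \<xi> \<noteq> \<eta> \<Longrightarrow> e \<le> dual_norm V n (\<xi> - \<eta>)"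
    using nonseparable_norm[OF dn(1)] by metis
  have "\<exists>N::nat. uncountable {\<xi> \<in> A. dual_norm V n \<xi> \<le> real N}"
  proof (rule ccontr)
    assume "\<not> ?thesis"
    then have "countable (\<Union>N::nat. {\<xi> \<in> A. dual_norm V n \<xi> \<le> real N})" by simp
    moreover have "A \<subseteq> (\<Union>N::nat. {\<xi> \<in> A. dual_norm V n \<xi> \<le> real N})" using real_arch_simple by fastforce
    ultimately show False using unc countable_subset by blast
  qed
  then obtain N :: nat where N: "uncountable {\<xi> \<in> A. dual_norm V n \<xi> \<le> real N}" by blast
  define S where "S = {\<xi> \<in> A. dual_norm V n \<xi> \<le> real N}"
  have SA: "S \<subseteq> A" and SD: "S \<subseteq> ?D" using AD by (auto simp: S_def)
  obtain C0 where C0: "countable C0" "C0 \<subseteq> V" "\<And>v r. v \<in> V \<Longrightarrow> r > 0 \<Longrightarrow> \<exists>c\<in>C0. n (c - v) < r"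
    using sepV[unfolded topeq separable_norm_topology[OF nV]] by (elim exE conjE) (rule that, auto)
  have "C0 \<noteq> {}" using C0(3)[OF subspace_0[OF V], of 1] by auto
  define x where "x = from_nat_into C0"
  have xV: "x k \<in> V" for k using from_nat_into[OF \<open>C0 \<noteq> {}\<close>, of k] C0(2) by (auto simp: x_def)
  have xd: "\<exists>k. n (x k - v) < r" if vr: "v \<in> V" "r > 0" for v r
  proof -
    obtain c where c: "c \<in> C0" "n (c - v) < r" using C0(3)[OF vr] by blast
    then obtain k where "x k = c" using from_nat_into_surj[OF C0(1) c(1)] by (auto simp: x_def)
    then show ?thesis using c(2) by blast
  qed
  \<comment> \<open>Bounded functionals on \<open>V\<close> are determined by their values on the
    dense sequence \<open>x\<close>; \<open>c\<close> bounds \<open>a + b\<close> and stays positive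
    whatever their signs.\<close>
  have agree: "f v = g v"
    if f: "linear_on_set V f" "\<And>v. v \<in> V \<Longrightarrow> \<bar>f v\<bar> \<le> a * n v"
      and g: "linear_on_set V g" "\<And>v. v \<in> V \<Longrightarrow> \<bar>g v\<bar> \<le> b * n v"
      and eq: "\<And>k. f (x k) = g (x k)" and v: "v \<in> V" for f g :: "('a \<Rightarrow> real) \<Rightarrow> real" and a b v
  proof -
    define c where "c = \<bar>a\<bar> + \<bar>b\<bar> + 1"
    have c: "c > 0" "a \<le> c" "b \<le> c" "a + b \<le> c" by (auto simp: c_def)
    have "\<bar>f v - g v\<bar> \<le> 0 + r" if r: "r > 0" for r
    proof -
      obtain k where k: "n (x k - v) < r / c" using xd[OF v, of "r / c"] r c by auto
      have d: "x k - v \<in> V" by (rule subspace_diff[OF V xV v])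
      have "f (x k - v) = f (x k) - f v" "g (x k - v) = g (x k) - g v"
        using linear_on_set_diff[OF f(1) V xV v] linear_on_set_diff[OF g(1) V xV v] by auto
      then have "\<bar>f v - g v\<bar> \<le> \<bar>f (x k - v)\<bar> + \<bar>g (x k - v)\<bar>" using eq[of k] by simp
      also have "\<dots> \<le> a * n (x k - v) + b * n (x k - v)" by (intro add_mono f(2) g(2) d)
      also have "\<dots> = (a + b) * n (x k - v)" by (simp add: distrib_right)
      also have "\<dots> \<le> c * n (x k - v)" using c norm_onD(2)[OF nV d] by (intro mult_right_mono) auto
      also have "\<dots> \<le> c * (r / c)" using c k by (intro mult_left_mono) auto
      finally show ?thesis using c by simp
    qed
    then have "\<bar>f v - g v\<bar> \<le> 0" by (rule field_le_epsilon)
    then show ?thesis by simp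
  qed
  have ball: "\<exists>r>0. \<forall>v\<in>V. n v < r \<longrightarrow> v \<in> U" if "openin (Ck X) U" "0 \<in> U" for U
  proof -
    have "openin (norm_topology V n) (U \<inter> V)" using openin_subtopology_Int[OF that(1), of V] topeq by simp
    moreover have "0 \<in> U \<inter> V" using that(2) V by (simp add: subspace_0)
    ultimately obtain r where "r > 0" "\<forall>v\<in>V. n (v - 0) < r \<longrightarrow> v \<in> U \<inter> V"
      unfolding openin_norm_topology[OF nV] by blast
    then show ?thesis by (intro exI[of _ r]) auto
  qed
  let ?B = "{v \<in> V. n v \<le> 1}"
  have Bb: "lcs_bounded (Ck X) ?B"
  proof (rule lcs_bounded_CkI)
    show "?B \<subseteq> cont_funs X" using VC by blast
    fix L assume L: "compactin X L"
    have "0 \<in> uniform_nhd (cont_funs X) L 1 0" using cont_funs_0[of X] by (simp add: uniform_nhd_def)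
    from ball[OF openin_uniform_nhd[OF cont_funs_0 L] this]
    obtain r where r: "r > 0" "\<forall>v\<in>V. n v < r \<longrightarrow> v \<in> uniform_nhd (cont_funs X) L 1 0" by blast
    have "\<bar>v y\<bar> \<le> 2 / r" if v: "v \<in> ?B" and y: "y \<in> L" for v y
    proof -
      have "n ((r / 2) *\<^sub>R v) = r / 2 * n v" using norm_onD(4)[OF nV] v r by simp
      also have "\<dots> \<le> r / 2 * 1" using v r by (intro mult_left_mono) auto
      also have "\<dots> < r" using r by simp
      finally have "(r / 2) *\<^sub>R v \<in> uniform_nhd (cont_funs X) L 1 0" using r(2) v V by (simp add: subspace_scale)
      then have "\<bar>((r / 2) *\<^sub>R v) y - 0 y\<bar> < 1" using y unfolding uniform_nhd_def by blast
      then have "r / 2 * \<bar>v y\<bar> < 1" using r by (simp add: abs_mult)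
      then show ?thesis using r by (simp add: field_simps)
    qed
    then show "\<exists>c>0. \<forall>h\<in>?B. \<forall>x\<in>L. \<bar>h x\<bar> \<le> c" using r by (intro exI[of _ "2 / r"]) auto
  qed
  \<comment> \<open>Because the norm topology of \<open>V\<close> is induced from
    \<open>Ck X\<close>, one compact \<open>L\<close> dominates the norm on \<open>V\<close>;
    \<open>nle\<close> below states this with the constant \<open>2 / r\<close>.\<close>
  obtain L r where L: "compactin X L" and r: "r > 0"
    and small: "\<And>v. v \<in> V \<Longrightarrow> v \<in> uniform_nhd (cont_funs X) L r 0 \<Longrightarrow> n v < 1"
  proof -
    have "openin (norm_topology V n) {v \<in> V. n v < 1}"
      using openin_norm_ball[OF nV subspace_0[OF V], of 1] by simp
    then have "openin (subtopology (Ck X) V) {v \<in> V. n v < 1}" by (simp add: topeq)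
    then obtain U where U: "openin (Ck X) U" "{v \<in> V. n v < 1} = U \<inter> V" by (auto simp: openin_subtopology)
    have "0 \<in> {v \<in> V. n v < 1}" using norm_onD(3)[OF nV, of 0] V by (simp add: subspace_0)
    then have "0 \<in> U" using U(2) by blast
    then obtain L r where "compactin X L" "r > 0" "uniform_nhd (cont_funs X) L r 0 \<subseteq> U"
      using U(1) unfolding openin_Ck by blast
    then show thesis using that U(2) by blast
  qed
  have nle: "n v \<le> 2 / r * c" if v: "v \<in> V" and c: "0 \<le> c" "\<And>x. x \<in> L \<Longrightarrow> \<bar>v x\<bar> \<le> c" for v c
  proof (rule field_le_epsilon)
    fix d :: real assume d: "d > 0"
    define c' where "c' = c + d * r / 2"
    have c': "c' > 0" "c \<le> c'" using c d r by (auto simp: c'_def intro: add_nonneg_pos)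
    let ?t = "r / (2 * c')"
    have tV: "?t *\<^sub>R v \<in> V" by (rule subspace_scale[OF V v])
    have "\<bar>(?t *\<^sub>R v) y - 0 y\<bar> < r" if y: "y \<in> L" for y
    proof -
      have "\<bar>?t\<bar> * \<bar>v y\<bar> \<le> ?t * c'" using c' r c(2)[OF y] by (intro mult_mono) auto
      also have "\<dots> < r" using c' r by simp
      finally show ?thesis by (simp add: abs_mult)
    qed
    then have "?t *\<^sub>R v \<in> uniform_nhd (cont_funs X) L r 0" using tV VC unfolding uniform_nhd_def by blast
    then have "n (?t *\<^sub>R v) < 1" by (rule small[OF tV])
    then have "?t * n v < 1" using norm_onD(4)[OF nV v, of ?t] c' r by simp
    then have "n v < 2 * c' / r" using c' r by (simp add: field_simps)
    also have "2 * c' / r = 2 / r * c + d" using r by (simp add: c'_def field_simps)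
    finally show "n v \<le> 2 / r * c + d" by simp
  qed
  \<comment> \<open>\<open>N\<close> bounds the dual norms on \<open>S\<close>, and
    \<open>2 / r\<close> compares the norm of \<open>V\<close> with the supremum over
    \<open>L\<close>.\<close>
  define C where "C = real N * (2 / r)"
  have C0': "0 \<le> C" using r by (simp add: C_def)
  define K where "K = {\<nu>. dominated X L C \<nu> \<and> (\<forall>h. h \<notin> cont_funs X \<longrightarrow> \<nu> h = 0)}"
  have Kc: "compact K" unfolding K_def by (rule compact_dominated[OF L])
  have KD: "K \<subseteq> dual_space (Ck X)" using dominated_in_dual[OF L] by (auto simp: K_def)
  have ext: "\<exists>\<nu>\<in>K. \<forall>v\<in>V. \<nu> v = \<xi> v" if \<xi>: "\<xi> \<in> S" for \<xi>
  proof -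
    have \<xi>D: "\<xi> \<in> ?D" using \<xi> SD by blast
    have le: "\<bar>\<xi> v\<bar> \<le> C * c" if v: "v \<in> V" and c: "0 \<le> c" "\<And>x. x \<in> L \<Longrightarrow> \<bar>v x\<bar> \<le> c" for v c
    proof -
      have "\<bar>\<xi> v\<bar> \<le> dual_norm V n \<xi> * n v" by (rule dn(2)[OF \<xi>D v])
      also have "\<dots> \<le> real N * (2 / r * c)"
        using \<xi> nle[OF v c] norm_onD(2)[OF nV v] by (intro mult_mono) (auto simp: S_def)
      finally show ?thesis by (simp add: C_def)
    qed
    obtain \<nu> where "dominated X L C \<nu>" "\<And>v. v \<in> V \<Longrightarrow> \<nu> v = \<xi> v" "\<And>h. h \<notin> cont_funs X \<Longrightarrow> \<nu> h = 0"
      using dominated_extension[OF L V VC Dlin[OF \<xi>D] C0' le] by blast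
    then show ?thesis by (intro bexI[of _ \<nu>]) (auto simp: K_def)
  qed
  \<comment> \<open>Restriction to the dense sequence maps into real sequences, a second countable
    space; it is continuous for pointwise convergence and, by \<open>agree\<close>, injective on
    \<open>S\<close>.\<close>
  define \<rho> where "\<rho> \<nu> = (\<lambda>k. \<nu> (x k))" for \<nu> :: "('a \<Rightarrow> real) \<Rightarrow> real"
  have \<rho>c: "continuous_on Z \<rho>" for Z
    unfolding \<rho>_def by (intro continuous_on_coordinatewise_then_product continuous_on_eval)
  have "inj_on \<rho> S"
  proof (rule inj_onI)
    fix \<xi> \<eta> assume *: "\<xi> \<in> S" "\<eta> \<in> S" "\<rho> \<xi> = \<rho> \<eta>"
    have D: "\<xi> \<in> ?D" "\<eta> \<in> ?D" using * SD by auto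
    have eqk: "\<xi> (x k) = \<eta> (x k)" for k using fun_cong[OF *(3), of k] by (simp add: \<rho>_def)
    have "\<xi> v = \<eta> v" if "v \<in> V" for v
      by (rule agree[OF Dlin[OF D(1)] dn(2)[OF D(1)] Dlin[OF D(2)] dn(2)[OF D(2)] eqk that])
    moreover have "\<xi> v = \<eta> v" if "v \<notin> V" for v
      using D that by (simp add: dual_space_def topspace_norm_topology[OF nV])
    ultimately show "\<xi> = \<eta>" by blast
  qed
  then have "uncountable (\<rho> ` S)" using N countable_image_inj_on unfolding S_def[symmetric] by blast
  then obtain P where P: "P \<subseteq> \<rho> ` S" "P \<noteq> {}"
    and perf: "\<And>b U. b \<in> P \<Longrightarrow> open U \<Longrightarrow> b \<in> U \<Longrightarrow> \<exists>b'\<in>P \<inter> U. b' \<noteq> b"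
    using uncountable_perfect_subset by blast
  \<comment> \<open>The complements \<open>K - G\<close> are the closed subsets of \<open>K\<close>
    that still map onto all of \<open>P\<close>; a maximal \<open>G\<close> gives a minimal
    one.\<close>
  define \<G> where "\<G> = {G. open G \<and> P \<subseteq> \<rho> ` (K - G)}"
  have "\<exists>M\<in>\<G>. \<forall>G\<in>\<G>. M \<subseteq> G \<longrightarrow> G = M"
  proof (rule subset_Zorn_nonempty)
    have "P \<subseteq> \<rho> ` K"
    proof
      fix b assume "b \<in> P"
      then obtain \<xi> where \<xi>: "\<xi> \<in> S" "b = \<rho> \<xi>" using P(1) by blast
      then obtain \<nu> where "\<nu> \<in> K" "\<forall>v\<in>V. \<nu> v = \<xi> v" using ext by blast
      then show "b \<in> \<rho> ` K" using \<xi>(2) xV by (intro image_eqI[of _ _ \<nu>]) (auto simp: \<rho>_def)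
    qed
    then show "\<G> \<noteq> {}" by (auto simp: \<G>_def intro!: exI[of _ "{}"])
    fix \<C> assume \<C>: "\<C> \<noteq> {}" "subset.chain \<G> \<C>"
    have \<C>G: "G \<in> \<G>" if "G \<in> \<C>" for G using \<C>(2) that by (auto simp: subset.chain_def)
    have "b \<in> \<rho> ` (K - \<Union>\<C>)" if b: "b \<in> P" for b
    proof (rule ccontr)
      assume no: "b \<notin> \<rho> ` (K - \<Union>\<C>)"
      \<comment> \<open>The part of \<open>K\<close> over \<open>b\<close> is compact; if the chain
        covered it, a single member of the chain would.\<close>
      let ?Kb = "K \<inter> {\<nu>. \<rho> \<nu> = b}"
      have "{\<nu>. \<rho> \<nu> = b} = (\<Inter>k. {\<nu>. \<nu> (x k) = b k})" by (auto simp: \<rho>_def fun_eq_iff)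
      also have "closed \<dots>" by (intro closed_INT ballI closed_Collect_eq continuous_on_eval continuous_on_const)
      finally have "compact ?Kb" using Kc by (rule compact_Int_closed[rotated])
      moreover have "?Kb \<subseteq> \<Union>\<C>" using no by auto
      moreover have "\<And>G. G \<in> \<C> \<Longrightarrow> open G" using \<C>G by (auto simp: \<G>_def)
      ultimately obtain \<F> where \<F>: "\<F> \<subseteq> \<C>" "finite \<F>" "?Kb \<subseteq> \<Union>\<F>" by (rule compactE)
      obtain G where G: "G \<in> \<C>" "?Kb \<subseteq> G"
      proof (cases "\<F> = {}")
        case True
        then show thesis using that \<C>(1) \<F>(3) by auto
      next
        case False
        have "subset.chain \<G> \<F>" using \<C>(2) \<F>(1) unfolding subset.chain_def by blast
        then have "\<Union>\<F> \<in> \<F>" using Union_in_chain[OF \<F>(2) False] by blast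
        then show thesis using that \<F> by blast
      qed
      have "b \<in> \<rho> ` (K - G)" using \<C>G[OF G(1)] b by (auto simp: \<G>_def)
      then show False using G(2) by auto
    qed
    moreover have "open (\<Union>\<C>)" using \<C>G by (auto simp: \<G>_def)
    ultimately show "\<Union>\<C> \<in> \<G>" by (auto simp: \<G>_def)
  qed
  then obtain M where M: "M \<in> \<G>" and max: "\<And>G. G \<in> \<G> \<Longrightarrow> M \<subseteq> G \<Longrightarrow> G = M" by blast
  have Mo: "open M" and MP: "P \<subseteq> \<rho> ` (K - M)" using M by (auto simp: \<G>_def)
  \<comment> \<open>\<open>K - M\<close> may contain functionals over points outside
    \<open>P\<close>. Those over \<open>P\<close> restrict on \<open>V\<close> to elements of the
    separated set \<open>S\<close>, which is what \<open>restr\<close> uses.\<close>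
  define Z where "Z = {\<nu> \<in> K - M. \<rho> \<nu> \<in> P}"
  have Z: "Z \<subseteq> K" "Z \<noteq> {}" using MP P(2) by (auto simp: Z_def)
  have "fragmented_on (Ck X) ?B K"
    using np Bb Kc KD dominated_equicontinuous[OF L, of K C]
    unfolding namioka_phelps_def by (auto simp: compactin_weak_star K_def)
  then obtain U where U: "openin (weak_star (Ck X)) U" "U \<inter> Z \<noteq> {}"
    and diam: "\<And>v. v \<in> ?B \<Longrightarrow> diameter ((\<lambda>\<xi>. \<xi> v) ` (U \<inter> Z)) < e / 2"
    unfolding fragmented_on_def using Z e by (elim allE[of _ Z] allE[of _ "e / 2"]) auto
  obtain W where W: "open W" "U = W \<inter> dual_space (Ck X)"
    using U(1) by (auto simp: weak_star_euclidean openin_subtopology)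
  have UZ: "U \<inter> Z = W \<inter> Z" using W(2) Z(1) KD by blast
  obtain cB where cB: "cB > 0" "\<And>v y. v \<in> ?B \<Longrightarrow> y \<in> L \<Longrightarrow> \<bar>v y\<bar> \<le> cB"
    using lcs_bounded_CkD[OF Bb L] by blast
  have Kbound: "\<bar>\<nu> v\<bar> \<le> C * cB" if "\<nu> \<in> K" "v \<in> ?B" for \<nu> v
    using that VC cB by (intro dominatedD(5)[of X L C]) (auto simp: K_def)
  have Klin: "linear_on_set V \<nu>" if "\<nu> \<in> K" for \<nu>
    using that VC unfolding K_def dominated_def linear_on_set_def by blast
  have Kn: "\<bar>\<nu> v\<bar> \<le> C * cB * n v" if \<nu>: "\<nu> \<in> K" and v: "v \<in> V" for \<nu> v
  proof (cases "n v = 0")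
    case True
    then have "v = 0" using norm_onD(3)[OF nV v] by simp
    then show ?thesis using linear_on_set_0[OF Klin[OF \<nu>] V] True by simp
  next
    case False
    then have nv: "n v > 0" using norm_onD(2)[OF nV v] by simp
    have "(1 / n v) *\<^sub>R v \<in> ?B" using norm_onD(4)[OF nV v] V v nv by (simp add: subspace_scale)
    then have "\<bar>\<nu> ((1 / n v) *\<^sub>R v)\<bar> \<le> C * cB" by (rule Kbound[OF \<nu>])
    moreover have "\<nu> ((1 / n v) *\<^sub>R v) = \<nu> v / n v" using Klin[OF \<nu>] v by (simp add: linear_on_set_def)
    ultimately show ?thesis using nv by (simp add: abs_divide field_simps)
  qed
  have restr: "\<exists>\<xi>\<in>S. \<rho> \<nu> = \<rho> \<xi> \<and> (\<forall>v\<in>V. \<nu> v = \<xi> v)" if \<nu>: "\<nu> \<in> Z" for \<nu>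
  proof -
    obtain \<xi> where \<xi>: "\<xi> \<in> S" "\<rho> \<nu> = \<rho> \<xi>" using \<nu> P(1) by (auto simp: Z_def)
    have \<xi>D: "\<xi> \<in> ?D" and \<nu>K: "\<nu> \<in> K" using \<xi> SD \<nu> Z(1) by auto
    have eqk: "\<nu> (x k) = \<xi> (x k)" for k using fun_cong[OF \<xi>(2), of k] by (simp add: \<rho>_def)
    have "\<nu> v = \<xi> v" if "v \<in> V" for v
      by (rule agree[OF Klin[OF \<nu>K] Kn[OF \<nu>K] Dlin[OF \<xi>D] dn(2)[OF \<xi>D] eqk that])
    then show ?thesis using \<xi> by blast
  qed
  \<comment> \<open>Diameter below \<open>e / 2\<close> at every vector of the unit ball puts the
    restrictions within \<open>e / 2\<close> in the dual norm; being members of an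
    \<open>e\<close>-separated set, they coincide.\<close>
  have same: "\<rho> \<nu> = \<rho> \<nu>'" if \<nu>: "\<nu> \<in> W \<inter> Z" "\<nu>' \<in> W \<inter> Z" for \<nu> \<nu>'
  proof -
    obtain \<xi> where \<xi>: "\<xi> \<in> S" "\<rho> \<nu> = \<rho> \<xi>" "\<forall>v\<in>V. \<nu> v = \<xi> v" using restr \<nu> by blast
    obtain \<eta> where \<eta>: "\<eta> \<in> S" "\<rho> \<nu>' = \<rho> \<eta>" "\<forall>v\<in>V. \<nu>' v = \<eta> v" using restr \<nu> by blast
    have "\<bar>(\<xi> - \<eta>) v\<bar> \<le> e / 2" if v: "v \<in> ?B" for v
    proof -
      let ?I = "(\<lambda>\<xi>. \<xi> v) ` (U \<inter> Z)"
      have "bounded ?I" using Kbound[OF _ v] Z(1) by (intro boundedI[of _ "C * cB"]) auto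
      then have "dist (\<nu> v) (\<nu>' v) \<le> diameter ?I"
        using \<nu> UZ by (intro diameter_bounded_bound) auto
      then show ?thesis using diam[OF v] \<xi>(3) \<eta>(3) v by (simp add: dist_real_def)
    qed
    then have "dual_norm V n (\<xi> - \<eta>) \<le> e / 2"
      unfolding dual_norm_def using norm_onD(3)[OF nV, of 0] V
      by (intro cSUP_least) (auto simp: subspace_0 intro!: exI[of _ 0])
    then have "\<xi> = \<eta>" using Asep[of \<xi> \<eta>] \<xi>(1) \<eta>(1) SA e by fastforce
    then show ?thesis using \<xi>(2) \<eta>(2) by simp
  qed
  have "M \<union> W \<notin> \<G>"
  proof
    assume "M \<union> W \<in> \<G>"
    then have "M \<union> W = M" by (intro max) auto
    then show False using U(2) UZ by (auto simp: Z_def)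
  qed
  then obtain b where b: "b \<in> P" "b \<notin> \<rho> ` (K - (M \<union> W))" using Mo W(1) by (auto simp: \<G>_def)
  have "\<exists>\<nu>\<in>W \<inter> Z. \<rho> \<nu> = b'" if b': "b' \<in> P" "b' \<notin> \<rho> ` (K - (M \<union> W))" for b'
    using b' MP by (fastforce simp: Z_def)
  then have only: "b' = b" if "b' \<in> P" "b' \<notin> \<rho> ` (K - (M \<union> W))" for b'
    using same that b by metis
  have "compact (K - (M \<union> W))" using Kc Mo W(1) by (intro compact_diff) auto
  then have "closed (\<rho> ` (K - (M \<union> W)))"
    by (intro compact_imp_closed_fun compact_continuous_image \<rho>c)
  then have "open (- \<rho> ` (K - (M \<union> W)))" by (rule open_Compl)
  \<comment> \<open>The image of the compact remainder is closed, so the uncovered points form a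
    relatively open subset of \<open>P\<close>. By \<open>only\<close> it is \<open>{b}\<close>,
    although \<open>P\<close> has no isolated points.\<close>
  then have "\<exists>b'\<in>P \<inter> - \<rho> ` (K - (M \<union> W)). b' \<noteq> b" by (rule perf[OF b(1)]) (use b(2) in blast)
  then show False using only by blast
qed

theorem theorem3p2:
  fixes X :: "'a topology"
  assumes "tychonoff_space X"
  shows
    "(asplund_space (Ck X) \<longleftrightarrow> (\<forall>K. compactin X K \<longrightarrow> scattered_space (subtopology X K))) \<and>
     (asplund_space (Ck X) \<longleftrightarrow>
        \<not> contains_isomorphic_copy (Ck X) (norm_topology l1_seqs l1_norm)) \<and>
     (asplund_space (Ck X) \<longleftrightarrow>
        (\<forall>V n. banach_subspace (Ck X) V n \<and> separable_space (subtopology (Ck X) V) \<longrightarrow>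
           separable_space (norm_topology (dual_space (subtopology (Ck X) V)) (dual_norm V n)))) \<and>
     (asplund_space (Ck X) \<longleftrightarrow> namioka_phelps (Ck X)) \<and>
     (asplund_space (Ck X) \<longleftrightarrow> tame_space (Ck X))"
proof -
  have X: "completely_regular_space X" using assms by (simp add: tychonoff_space_def)
  let ?sc = "\<forall>K. compactin X K \<longrightarrow> scattered_space (subtopology X K)"
  let ?l1 = "contains_isomorphic_copy (Ck X) (norm_topology l1_seqs l1_norm)"
  let ?dual = "\<forall>V n. banach_subspace (Ck X) V n \<and> separable_space (subtopology (Ck X) V) \<longrightarrow>
    separable_space (norm_topology (dual_space (subtopology (Ck X) V)) (dual_norm V n))"
  have "?sc \<Longrightarrow> asplund_space (Ck X)" using scattered_imp_asplund[OF X] by blast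
  moreover have "asplund_space (Ck X) \<Longrightarrow> tame_space (Ck X)" by (rule asplund_imp_tame)
  moreover have "tame_space (Ck X) \<Longrightarrow> ?sc" using tame_imp_scattered[OF assms] by blast
  moreover have "?sc \<Longrightarrow> namioka_phelps (Ck X)" using scattered_imp_namioka_phelps[OF X] by blast
  moreover have "namioka_phelps (Ck X) \<Longrightarrow> ?dual" using namioka_phelps_imp_separable_dual by blast
  moreover have "?dual \<Longrightarrow> \<not> ?l1" using l1_copy_imp_nonseparable_dual by blast
  moreover have "\<not> ?l1 \<Longrightarrow> ?sc" using not_scattered_imp_l1_copy[OF assms] by blast
  ultimately show ?thesis by argo
qed


end
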